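(* Let $(K,v)$ be a valued field of characteristic $p>0$ with $v$ of rank one. Let $\alpha,\beta\in\overline K$ be defect Artin-Schreier elements over $K$ such that $K(\alpha)$ and $K(\beta)$ are linearly disjoint over $K$. Suppose that $a,b\in K$ satisfy $$v(ac+bd)=0\quad\text{for every }(c,d)\in\mathbb F_p^2\setminus\{(0,0)\}.$$ If $d_1(b\beta)<d_1(a\alpha)$, then $\theta=a\alpha+b\beta$ is a generator of $K(\alpha,\beta)$ over $K$ (that is, $K(\theta)=K(\alpha,\beta)$) and $$\#S_\theta=1<2=\mathrm{depth}(\theta).$$
   Context: $\overline K$ is a fixed algebraic closure of $K$ and $v$ is extended to a fixed valuation on $\overline K$, with $\Gamma=v\overline K$. Defect: for a finite extension $(L/K,v)$, $d(L/K,v)=\frac{[L^h:K^h]}{[Lv:Kv](vL:vK)}$, where $L^h,K^h\subseteq\overline K$ are the henselizations, $Lv,Kv$ the residue fields, $vL,vK$ the value groups; it is a defect extension if $d\neq1$. An Artin-Schreier (AS) element over $K$ is $\alpha\in\overline K\setminus K$ with $\alpha^p-\alpha\in K$; it is a defect AS element if $(K(\alpha)/K,v)$ is a defect extension. $S_\theta=\{v(\theta'-\theta)\mid\theta'\text{ a }K\text{-conjugate of }\theta,\ \theta'\ne\theta\}$. A cut in $\Gamma$ is a pair $\delta=(\delta^L,\delta^R)$ with $\delta^L\cup\delta^R=\Gamma$ and every element of $\delta^L$ smaller than every element of $\delta^R$; cuts are ordered by inclusion of the left sets. For $m\ge 1$, $D_m(\theta,K)=\{v(\theta-b)\mid b\in\overline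 K,\ \deg_K b=m\}$, where $\deg_K b=[K(b):K]$. For $\theta\in\overline K\setminus K$, $d_1(\theta)$ is the cut with left set $\{\gamma\in\Gamma\mid \gamma\le s\text{ for some }s\in D_1(\theta,K)\}$, where $D_1(\theta,K)=\{v(\theta-c)\mid c\in K\}$. Depth: $\mathrm{depth}(\theta)$ is the length of any Mac Lane-Vaquié chain of the valuation $v_\theta(f)=v(f(\theta))$ on $K[x]$. Equivalently (known theorem), with $n=\deg_K\theta$ and $D_m=D_m(\theta,K)\subseteq\Gamma\cup\{\infty\}$, it is the integer $s$ such that $1=d_0<d_1<\dots<d_s=n$, where $d_0=1$ and, as long as $d_{\ell-1}<n$, $d_\ell$ is the least integer $m>d_{\ell-1}$ for which some $\epsilon\in D_m$ is strictly larger than all elements of $D_{d_{\ell-1}}$ (these integers $d_\ell$ are not to be confused with the cut $d_1(\cdot)$). *)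

theory Defs
  imports "HOL-Algebra.Algebraic_Closure_Type" "HOL-Algebra.Generated_Fields" "HOL-Library.Extended"
begin

(* Convention: the algebraic closure of K is the whole type 'a::field, and K together with all
   intermediate fields are subsets of 'a.  Notions of HOL-Algebra (subfields, generated fields,
   degrees, minimal polynomials) are applied to the record ring_of_type_algebra of that type.
   Valuations are written additively, with values in an ordered abelian group extended by a top
   element; the bottom element that the type 'g extended also has is never a value. *)

abbreviation Kbar :: "'a::field ring" where
  "Kbar \<equiv> ring_of_type_algebra"

definition adjoin :: "'a::field set \<Rightarrow> 'a set \<Rightarrow> 'a set" where
  "adjoin K S = generate_field Kbar (K \<union> S)"

definition deg_over :: "'a::field set \<Rightarrow> 'a \<Rightarrow> nat" where
  "deg_over K b = ring.dim Kbar K (adjoin K {b})"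

definition conjugate :: "'a::field set \<Rightarrow> 'a \<Rightarrow> 'a \<Rightarrow> bool" where
  "conjugate K \<theta> \<theta>' \<longleftrightarrow> ring.eval Kbar (ring.Irr Kbar K \<theta>) \<theta>' = 0"

definition linearly_disjoint :: "'a::field set \<Rightarrow> 'a set \<Rightarrow> 'a set \<Rightarrow> bool" where
  "linearly_disjoint K E F \<longleftrightarrow>
     (\<forall>us. set us \<subseteq> E \<longrightarrow> ring.independent Kbar K us \<longrightarrow> ring.independent Kbar F us)"

(* In positive characteristic this is the prime field. *)
definition prime_subfield :: "'a::field set" where
  "prime_subfield = range of_nat"


subsection \<open>Valuations\<close>

definition valuation :: "('a::field \<Rightarrow> 'g::linordered_ab_group_add extended) \<Rightarrow> bool" where
  "valuation v \<longleftrightarrow>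
     (\<forall>x. v x \<noteq> -\<infinity>) \<and> (\<forall>x. v x = \<infinity> \<longleftrightarrow> x = 0) \<and>
     (\<forall>x y. v (x * y) = v x + v y) \<and> (\<forall>x y. min (v x) (v y) \<le> v (x + y))"

definition value_group :: "('a::field \<Rightarrow> 'g::linordered_ab_group_add extended) \<Rightarrow> 'a set \<Rightarrow> 'g set" where
  "value_group v F = {g. \<exists>x\<in>F. v x = Fin g}"

definition convex_subgroup :: "'g::linordered_ab_group_add set \<Rightarrow> 'g set \<Rightarrow> bool" where
  "convex_subgroup H G \<longleftrightarrow>
     H \<subseteq> G \<and> 0 \<in> H \<and> (\<forall>x\<in>H. \<forall>y\<in>H. x - y \<in> H) \<and>
     (\<forall>x\<in>H. \<forall>y\<in>H. \<forall>g\<in>G. x \<le> g \<longrightarrow> g \<le> y \<longrightarrow> g \<in> H)"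

definition rank_one :: "('a::field \<Rightarrow> 'g::linordered_ab_group_add extended) \<Rightarrow> 'a set \<Rightarrow> bool" where
  "rank_one v K \<longleftrightarrow>
     card {H. convex_subgroup H (value_group v K) \<and> H \<noteq> value_group v K} = 1"

definition valuation_ring :: "('a::field \<Rightarrow> 'g::linordered_ab_group_add extended) \<Rightarrow> 'a set \<Rightarrow> 'a set" where
  "valuation_ring v F = {x \<in> F. 0 \<le> v x}"

definition maximal_ideal :: "('a::field \<Rightarrow> 'g::linordered_ab_group_add extended) \<Rightarrow> 'a set" where
  "maximal_ideal v = {x. 0 < v x}"

definition residue_ring :: "('a::field \<Rightarrow> 'g::linordered_ab_group_add extended) \<Rightarrow> 'a set ring" where
  "residue_ring v = (Kbar \<lparr> carrier := valuation_ring v UNIV \<rparr>) Quot (maximal_ideal v)"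

(* The residue field of a subfield F, as a subfield of the residue field of the whole type. *)
definition residue_field :: "('a::field \<Rightarrow> 'g::linordered_ab_group_add extended) \<Rightarrow> 'a set \<Rightarrow> 'a set set" where
  "residue_field v F = (\<lambda>x. maximal_ideal v +>\<^bsub>Kbar\<^esub> x) ` valuation_ring v F"

definition ramification_index ::
    "('a::field \<Rightarrow> 'g::linordered_ab_group_add extended) \<Rightarrow> 'a set \<Rightarrow> 'a set \<Rightarrow> nat" where
  "ramification_index v K L = card ((\<lambda>g. (+) g ` value_group v K) ` value_group v L)"

definition residue_degree ::
    "('a::field \<Rightarrow> 'g::linordered_ab_group_add extended) \<Rightarrow> 'a set \<Rightarrow> 'a set \<Rightarrow> nat" where
  "residue_degree v K L = ring.dim (residue_ring v) (residue_field v K) (residue_field v L)"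


subsection \<open>Henselizations and the defect\<close>

(* Hensel's lemma for (F, v). *)
definition henselian :: "('a::field \<Rightarrow> 'g::linordered_ab_group_add extended) \<Rightarrow> 'a set \<Rightarrow> bool" where
  "henselian v F \<longleftrightarrow>
     (\<forall>f::'a poly. \<forall>x \<in> valuation_ring v F.
        Polynomial.lead_coeff f = 1 \<longrightarrow> (\<forall>i. Polynomial.coeff f i \<in> valuation_ring v F) \<longrightarrow>
        0 < v (poly f x) \<longrightarrow> v (poly (pderiv f) x) = 0 \<longrightarrow>
        (\<exists>y\<in>F. poly f y = 0 \<and> 0 < v (y - x)))"

(* The henselization inside the algebraic closure: the least henselian field containing F.
   (Henselian fields are closed under intersection, the lifted root being unique.) *)
definition henselization :: "('a::field \<Rightarrow> 'g::linordered_ab_group_add extended) \<Rightarrow> 'a set \<Rightarrow> 'a set" where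
  "henselization v F = \<Inter>{E. subfield E Kbar \<and> F \<subseteq> E \<and> henselian v E}"

definition defect :: "('a::field \<Rightarrow> 'g::linordered_ab_group_add extended) \<Rightarrow> 'a set \<Rightarrow> 'a set \<Rightarrow> rat" where
  "defect v K L =
     of_nat (ring.dim Kbar (henselization v K) (henselization v L)) /
     of_nat (residue_degree v K L * ramification_index v K L)"

(* To be used with p the characteristic. *)
definition artin_schreier_element :: "nat \<Rightarrow> 'a::field set \<Rightarrow> 'a \<Rightarrow> bool" where
  "artin_schreier_element p K \<alpha> \<longleftrightarrow> \<alpha> \<notin> K \<and> \<alpha> ^ p - \<alpha> \<in> K"

definition defect_artin_schreier_element ::
    "nat \<Rightarrow> ('a::field \<Rightarrow> 'g::linordered_ab_group_add extended) \<Rightarrow> 'a set \<Rightarrow> 'a \<Rightarrow> bool" where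
  "defect_artin_schreier_element p v K \<alpha> \<longleftrightarrow>
     artin_schreier_element p K \<alpha> \<and> defect v K (adjoin K {\<alpha>}) \<noteq> 1"


subsection \<open>Distances and depth\<close>

definition S_set :: "('a::field \<Rightarrow> 'g::linordered_ab_group_add extended) \<Rightarrow> 'a set \<Rightarrow> 'a \<Rightarrow> 'g extended set" where
  "S_set v K \<theta> = {v (\<theta>' - \<theta>) | \<theta>'. conjugate K \<theta> \<theta>' \<and> \<theta>' \<noteq> \<theta>}"

definition D_set :: "('a::field \<Rightarrow> 'g::linordered_ab_group_add extended) \<Rightarrow> 'a set \<Rightarrow> nat \<Rightarrow> 'a \<Rightarrow> 'g extended set" where
  "D_set v K m \<theta> = {v (\<theta> - b) | b. deg_over K b = m}"

(* Cuts in the value group of the whole type are pairs (left set, right set). *)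
definition cut_less :: "'g set \<times> 'g set \<Rightarrow> 'g set \<times> 'g set \<Rightarrow> bool" where
  "cut_less \<delta> \<epsilon> \<longleftrightarrow> fst \<delta> \<subset> fst \<epsilon>"

definition d1_cut ::
    "('a::field \<Rightarrow> 'g::linordered_ab_group_add extended) \<Rightarrow> 'a set \<Rightarrow> 'a \<Rightarrow> 'g set \<times> 'g set" where
  "d1_cut v K \<theta> =
     (let \<Gamma> = value_group v UNIV; A = {\<gamma> \<in> \<Gamma>. \<exists>c\<in>K. Fin \<gamma> \<le> v (\<theta> - c)} in (A, \<Gamma> - A))"

definition next_degree ::
    "('a::field \<Rightarrow> 'g::linordered_ab_group_add extended) \<Rightarrow> 'a set \<Rightarrow> 'a \<Rightarrow> nat \<Rightarrow> nat" where
  "next_degree v K \<theta> d =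
     (LEAST m. d < m \<and> (\<exists>\<epsilon>\<in>D_set v K m \<theta>. \<forall>\<eta>\<in>D_set v K d \<theta>. \<eta> < \<epsilon>))"

(* The length of the sequence 1 = d_0 < d_1 < ... < d_s = deg_over K \<theta> of successive degrees,
   which is the common length of the Mac Lane-Vaquie chains of f \<mapsto> v (f \<theta>).  The sequence
   always reaches deg_over K \<theta>: b = \<theta> contributes the value \<infinity> in that degree, and only there. *)
definition depth :: "('a::field \<Rightarrow> 'g::linordered_ab_group_add extended) \<Rightarrow> 'a set \<Rightarrow> 'a \<Rightarrow> nat" where
  "depth v K \<theta> = (LEAST s. (next_degree v K \<theta> ^^ s) 1 = deg_over K \<theta>)"

end

theory Submission
  imports Defs
begin

text \<open>Since the rank is one, \<open>v\<close> may be replaced by a real ultrametric norm \<open>N\<close>, and the topological closure \<open>C\<close>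
  of \<open>K\<close> in its algebraic closure is a henselian field: elements conjugate over \<open>C\<close> have the same norm.
  An Artin-Schreier element at distance at most 1 from \<open>K\<close> generates an extension without defect, so
  \<open>N (\<alpha> - c) > 1\<close> and \<open>N (\<beta> - c) > 1\<close> for all \<open>c \<in> K\<close>. Together with the inequality of cuts this shows that no
  nonzero combination of \<open>\<alpha>\<close> and \<open>\<beta>\<close> over the prime field lies in \<open>C\<close>, whence \<open>\<theta>\<close> has degree \<open>p\<^sup>2\<close> over \<open>C\<close>
  and over \<open>K\<close>, with conjugates \<open>\<theta> + ac + bd\<close> at mutual distance 1.

  A disc of radius at least 1 around \<open>\<theta>\<close> is therefore stable under conjugation over \<open>C\<close>. Let \<open>f\<close> be the minimal
  polynomial over \<open>C\<close> of an element of least degree \<open>m\<close> in it. A Hasse derivative of \<open>f\<close> of order \<open>0 < q < m\<close> whose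
  leading coefficient does not vanish again has all its roots in the disc, so \<open>m\<close> is a power of \<open>p\<close>. By
  continuity of roots the least degree over \<open>K\<close> is the same. Hence elements of degree less than \<open>p\<close>
  approximate \<open>\<theta>\<close> no better than those of \<open>K\<close>, and elements of degree less than \<open>p\<^sup>2\<close> no better than those of
  degree \<open>p\<close>; discs of radius less than 1 are excluded by Krasner's lemma. Finally the inequality of cuts says
  that some \<open>b\<beta> + c\<close> approximates \<open>\<theta>\<close> better than every element of \<open>K\<close>.\<close>

section \<open>Subfields and polynomials over them\<close>

text \<open>The closure \<open>C\<close> stands in for a completion. Roots already exist in the
  algebraic closure, so an approximation scheme only has to show that the coefficients of a known
  factor are limits of elements of a closed field. Equality of norms of conjugates over
  \<open>C\<close> is the form of henselianity used for \<theta>. The defect is defined by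
  henselizations, and that distance at most 1 from \<open>K\<close> forces defect 1 needs two cases
  after a translation. If \<alpha> is congruent to an element of \<open>K\<close>, Hensel's lemma
  puts \<alpha> into every henselian field containing \<open>K\<close>, and all degrees are 1.
  Otherwise the powers of \<alpha> remain independent in the residue field, and the degree p is
  matched by a residue degree p. This case requires the henselization of K(\<alpha>), which has to
  be identified with Kh(\<alpha>), where \<open>Kh\<close> is the henselization of \<open>K\<close>:
  every field containing \<open>C\<close> is henselian, and \<open>C\<close> is purely inseparable
  over \<open>Kh\<close>, so a Hensel root, being simple, descends from C(\<alpha>) to
  Kh(\<alpha>).\<close>

lemma Kbar_simps [simp]:
  "carrier (Kbar :: 'a::field ring) = UNIV" "x \<otimes>\<^bsub>Kbar\<^esub> y = x * y" "x \<oplus>\<^bsub>Kbar\<^esub> y = x + y"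
  "\<zero>\<^bsub>Kbar\<^esub> = (0 :: 'a)" "\<one>\<^bsub>Kbar\<^esub> = (1 :: 'a)"
  by (simp_all add: ring_of_type_algebra_def)

lemma field_Kbar: "Ring.field (Kbar :: 'a::field ring)"
  by (rule field_from_type_algebra)

lemma ring_Kbar: "Ring.ring (Kbar :: 'a::field ring)"
  by (rule ring_from_type_algebra)

lemma a_inv_Kbar [simp]: "\<ominus>\<^bsub>Kbar\<^esub> x = - (x :: 'a::field)"
proof -
  interpret R: Ring.ring "Kbar :: 'a ring" by (rule ring_Kbar)
  show ?thesis
    by (rule R.minus_equality) auto
qed

lemma m_inv_Kbar [simp]: "x \<noteq> 0 \<Longrightarrow> inv\<^bsub>Kbar\<^esub> x = inverse (x :: 'a::field)"
proof -
  assume x: "x \<noteq> 0"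
  interpret R: Ring.field "Kbar :: 'a ring" by (rule field_Kbar)
  show ?thesis
    by (rule R.inv_unique'[symmetric]) (use x in auto)
qed

lemma subfield_KbarI:
  assumes "1 \<in> E" "\<And>x y. x \<in> E \<Longrightarrow> y \<in> E \<Longrightarrow> x + y \<in> E" "\<And>x y. x \<in> E \<Longrightarrow> y \<in> E \<Longrightarrow> x * y \<in> E"
    "\<And>x. x \<in> E \<Longrightarrow> - x \<in> E" "\<And>x. x \<in> E \<Longrightarrow> inverse x \<in> E"
  shows "subfield (E :: 'a::field set) Kbar"
proof -
  interpret R: Ring.field "Kbar :: 'a ring" by (rule field_Kbar)
  show ?thesis
    by (rule R.subfieldI') (auto intro!: R.subringI simp: assms)
qed

context
  fixes E :: "'a::field set"
  assumes E: "subfield E Kbar"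
begin

lemma sf_1: "1 \<in> E"
  using subringE(3)[OF subfieldE(1)[OF E]] by simp

lemma sf_0: "0 \<in> E"
proof -
  interpret R: Ring.ring "Kbar :: 'a ring" by (rule ring_Kbar)
  show ?thesis using subringE(2)[OF subfieldE(1)[OF E]] by simp
qed

lemma sf_add: "x \<in> E \<Longrightarrow> y \<in> E \<Longrightarrow> x + y \<in> E"
  using subringE(7)[OF subfieldE(1)[OF E], of x y] by simp

lemma sf_mult: "x \<in> E \<Longrightarrow> y \<in> E \<Longrightarrow> x * y \<in> E"
  using subringE(6)[OF subfieldE(1)[OF E], of x y] by simp

lemma sf_minus: "x \<in> E \<Longrightarrow> - x \<in> E"
  using subringE(5)[OF subfieldE(1)[OF E], of x] by simp

lemma sf_diff: "x \<in> E \<Longrightarrow> y \<in> E \<Longrightarrow> x - y \<in> E"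
  using sf_add[OF _ sf_minus, of x y] by simp

lemma sf_inverse: "x \<in> E \<Longrightarrow> inverse x \<in> E"
proof -
  assume x: "x \<in> E"
  interpret R: Ring.field "Kbar :: 'a ring" by (rule field_Kbar)
  show ?thesis
    by (cases "x = 0") (use R.subfield_m_inv(1)[OF E, of x] x in auto)
qed

lemma sf_divide: "x \<in> E \<Longrightarrow> y \<in> E \<Longrightarrow> x / y \<in> E"
  using sf_mult[OF _ sf_inverse, of x y] by (simp add: divide_inverse)

lemma sf_power: "x \<in> E \<Longrightarrow> x ^ n \<in> E"
  by (induct n) (auto intro: sf_1 sf_mult)

lemma sf_of_nat: "of_nat n \<in> E"
  by (induct n) (auto intro: sf_0 sf_1 sf_add)

lemma sf_sum: "(\<And>x. x \<in> A \<Longrightarrow> f x \<in> E) \<Longrightarrow> sum f A \<in> E"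
  by (induct A rule: infinite_finite_induct) (auto intro: sf_0 sf_add)

end

lemmas sf_intros = sf_0 sf_1 sf_add sf_mult sf_minus sf_diff sf_inverse sf_divide sf_power sf_of_nat sf_sum

lemma subfield_Inter:
  assumes "\<And>E. E \<in> \<E> \<Longrightarrow> subfield E Kbar"
  shows "subfield (\<Inter>\<E> :: 'a::field set) Kbar"
  by (rule subfield_KbarI) (use assms in \<open>auto intro: sf_intros\<close>)

definition poly_over :: "'a::zero set \<Rightarrow> 'a poly \<Rightarrow> bool" where
  "poly_over E f \<longleftrightarrow> (\<forall>i. coeff f i \<in> E)"

lemma poly_over_mono: "poly_over E f \<Longrightarrow> E \<subseteq> F \<Longrightarrow> poly_over F f"
  by (auto simp: poly_over_def)

lemma poly_over_coeff: "poly_over E f \<Longrightarrow> coeff f i \<in> E"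
  by (auto simp: poly_over_def)

context
  fixes E :: "'a::field set"
  assumes E: "subfield E Kbar"
begin

lemma poly_over_0: "poly_over E 0"
  using sf_0[OF E] by (auto simp: poly_over_def)

lemma poly_over_pCons: "x \<in> E \<Longrightarrow> poly_over E f \<Longrightarrow> poly_over E (pCons x f)"
  by (auto simp: poly_over_def coeff_pCons split: nat.splits)

lemma poly_over_1: "poly_over E 1"
  by (auto simp: one_pCons intro!: poly_over_pCons sf_1[OF E] poly_over_0)

lemma poly_over_monom: "x \<in> E \<Longrightarrow> poly_over E (monom x n)"
  using sf_0[OF E] by (auto simp: poly_over_def)

lemma poly_over_add: "poly_over E f \<Longrightarrow> poly_over E g \<Longrightarrow> poly_over E (f + g)"
  by (auto simp: poly_over_def intro: sf_intros[OF E])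

lemma poly_over_diff: "poly_over E f \<Longrightarrow> poly_over E g \<Longrightarrow> poly_over E (f - g)"
  by (auto simp: poly_over_def intro: sf_intros[OF E])

lemma poly_over_smult: "x \<in> E \<Longrightarrow> poly_over E g \<Longrightarrow> poly_over E (smult x g)"
  by (auto simp: poly_over_def intro: sf_intros[OF E])

lemma poly_over_mult: "poly_over E f \<Longrightarrow> poly_over E g \<Longrightarrow> poly_over E (f * g)"
  by (auto simp: poly_over_def coeff_mult intro!: sf_intros[OF E])

lemma poly_over_sum: "(\<And>i. i \<in> A \<Longrightarrow> poly_over E (f i)) \<Longrightarrow> poly_over E (sum f A)"
  by (induct A rule: infinite_finite_induct) (auto intro: poly_over_0 poly_over_add)

lemma poly_over_pderiv: "poly_over E f \<Longrightarrow> poly_over E (pderiv f)"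
  by (auto simp: poly_over_def coeff_pderiv simp del: of_nat_Suc intro!: sf_intros[OF E])

lemma poly_over_pcompose: "poly_over E f \<Longrightarrow> poly_over E g \<Longrightarrow> poly_over E (pcompose f g)"
proof (induct f)
  case (pCons a f)
  have "a \<in> E" "poly_over E f"
    using poly_over_coeff[OF pCons(3), of 0] poly_over_coeff[OF pCons(3), of "Suc i" for i]
    by (auto simp: poly_over_def)
  then show ?case
    using pCons by (auto simp: pcompose_pCons intro!: poly_over_add poly_over_mult poly_over_pCons poly_over_0)
qed (auto intro: poly_over_0)

lemma poly_over_eval: "poly_over E f \<Longrightarrow> x \<in> E \<Longrightarrow> poly f x \<in> E"
  by (auto simp: poly_altdef poly_over_def intro!: sf_intros[OF E])

text \<open>Subfields are sets, so \<open>div\<close> and \<open>mod\<close> belong to the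
  polynomial ring of the whole type. Dividing inside \<open>E\<close> and using uniqueness of
  quotient and remainder shows that both operations preserve coefficients in
  \<open>E\<close>.\<close>

lemma poly_over_division:
  assumes g: "poly_over E g" "g \<noteq> 0" and f: "poly_over E f"
  shows "\<exists>q r. poly_over E q \<and> poly_over E r \<and> f = q * g + r \<and> (r = 0 \<or> degree r < degree g)"
  using f
proof (induct "degree f" arbitrary: f rule: less_induct)
  case less
  show ?case
  proof (cases "f = 0 \<or> degree f < degree g")
    case True
    then show ?thesis
      using less(2) by (intro exI[of _ 0] exI[of _ f]) (auto intro: poly_over_0)
  next
    case False
    define h where "h = monom (lead_coeff f / lead_coeff g) (degree f - degree g)"
    have h: "poly_over E h"
      unfolding h_def by (intro poly_over_monom sf_divide[OF E] poly_over_coeff less(2) g)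
    have deg: "degree (h * g) = degree f" "lead_coeff (h * g) = lead_coeff f" "f \<noteq> 0"
    proof -
      have "lead_coeff f / lead_coeff g \<noteq> 0" "f \<noteq> 0" using False g(2) by auto
      moreover from this have "h \<noteq> 0" unfolding h_def by simp
      ultimately show "degree (h * g) = degree f" "f \<noteq> 0"
        using False g(2) by (simp_all add: degree_mult_eq h_def degree_monom_eq)
      have "lead_coeff h = lead_coeff f / lead_coeff g"
        unfolding h_def by (rule lead_coeff_monom)
      then show "lead_coeff (h * g) = lead_coeff f"
        using g(2) by (simp add: lead_coeff_mult)
    qed
    have over: "poly_over E (f - h * g)"
      by (intro poly_over_diff poly_over_mult h g less(2))
    have "degree (f - h * g) \<le> degree f" "coeff (f - h * g) (degree f) = 0"
      using degree_diff_le[of f "degree f" "h * g"] deg by auto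
    then consider "f - h * g = 0" | "degree (f - h * g) < degree f"
      using eq_zero_or_degree_less by blast
    then show ?thesis
    proof cases
      case 1
      then show ?thesis
        by (intro exI[of _ h] exI[of _ 0]) (auto simp: h poly_over_0)
    next
      case 2
      then obtain q r where qr: "poly_over E q" "poly_over E r" "f - h * g = q * g + r"
        "r = 0 \<or> degree r < degree g"
        using less(1) over by blast
      then show ?thesis
        by (intro exI[of _ "q + h"] exI[of _ r])
          (auto intro!: poly_over_add h simp: algebra_simps)
    qed
  qed
qed

lemma poly_over_div_mod:
  assumes "poly_over E f" "poly_over E g"
  shows "poly_over E (f div g)" "poly_over E (f mod g)"
proof -
  have "poly_over E (f div g) \<and> poly_over E (f mod g)"
  proof (cases "g = 0")
    case False
    obtain q r where qr: "poly_over E q" "poly_over E r" "f = q * g + r" "r = 0 \<or> degree r < degree g"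
      using poly_over_division[OF assms(2) False assms(1)] by blast
    have "r mod g = r" "r div g = 0"
      using qr(4) by (auto simp: mod_poly_less div_poly_less)
    then have "f mod g = r" "f div g = q"
      using qr(3) False by auto
    then show ?thesis using qr by simp
  qed (use assms poly_over_0 in auto)
  then show "poly_over E (f div g)" "poly_over E (f mod g)" by auto
qed

lemma poly_over_dvd_quotient:
  assumes "poly_over E (g * h)" "poly_over E g" "g \<noteq> 0"
  shows "poly_over E h"
  using poly_over_div_mod(1)[OF assms(1,2)] assms(3) by simp

end

lemma poly_over_root_linear: "subfield E Kbar \<Longrightarrow> x \<in> E \<Longrightarrow> poly_over E [:-x, 1:]"
  by (auto intro!: poly_over_pCons poly_over_0 sf_1 sf_minus)

section \<open>Minimal polynomials\<close>

text \<open>Minimality of the degree, rather than irreducibility, is the characterization that the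
  degree estimates below use directly. \<open>Irr_Kbar\<close> identifies it with the polynomial of
  HOL-Algebra.\<close>

definition min_poly :: "'a::field set \<Rightarrow> 'a \<Rightarrow> 'a poly \<Rightarrow> bool" where
  "min_poly E x f \<longleftrightarrow> poly_over E f \<and> lead_coeff f = 1 \<and> poly f x = 0 \<and>
     (\<forall>g. poly_over E g \<longrightarrow> poly g x = 0 \<longrightarrow> g \<noteq> 0 \<longrightarrow> degree f \<le> degree g)"

lemma min_polyD:
  assumes "min_poly E x f"
  shows "poly_over E f" "lead_coeff f = 1" "poly f x = 0" "f \<noteq> 0"
    "\<And>g. poly_over E g \<Longrightarrow> poly g x = 0 \<Longrightarrow> g \<noteq> 0 \<Longrightarrow> degree f \<le> degree g"
  using assms by (auto simp: min_poly_def)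

lemma min_poly_degree_pos: "min_poly E x f \<Longrightarrow> degree f > 0"
  by (rule ccontr) (use min_polyD(2,3)[of E x f] in \<open>auto elim: degree_eq_zeroE\<close>)

lemma min_poly_exists:
  assumes E: "subfield E Kbar" and "poly_over E g" "g \<noteq> 0" "poly g x = 0"
  shows "\<exists>f. min_poly E x f"
proof -
  let ?P = "\<lambda>g. poly_over E g \<and> g \<noteq> 0 \<and> poly g x = 0"
  obtain f where f: "?P f" "\<And>g. ?P g \<Longrightarrow> degree f \<le> degree g"
    using assms ex_has_least_nat[of ?P g degree] by blast
  let ?f = "smult (inverse (lead_coeff f)) f"
  have "min_poly E x ?f"
    unfolding min_poly_def using f
    by (auto intro!: poly_over_smult[OF E] sf_inverse[OF E] poly_over_coeff)
  then show ?thesis ..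
qed

lemma min_poly_dvd:
  assumes E: "subfield E Kbar" and f: "min_poly E x f" and g: "poly_over E g" "poly g x = 0"
  shows "f dvd g"
proof -
  note fD = min_polyD[OF f]
  have "poly (g mod f) x = 0"
    using g(2) fD(3) by (metis div_mult_mod_eq poly_add poly_mult mult_zero_right add_0)
  moreover have "poly_over E (g mod f)"
    using poly_over_div_mod(2)[OF E g(1) fD(1)] .
  ultimately have "g mod f = 0"
    using fD(5)[of "g mod f"] degree_mod_less'[of f g] fD(4) by fastforce
  then show ?thesis by auto
qed

lemma min_poly_root:
  assumes "subfield E Kbar" "min_poly E x f" "poly_over E g" "poly g x = 0" "poly f y = 0"
  shows "poly g y = 0"
  using min_poly_dvd[OF assms(1-4)] assms(5) by (auto elim!: dvdE)

lemma min_poly_unique: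
  assumes E: "subfield E Kbar" and f: "min_poly E x f" and g: "min_poly E x g"
  shows "f = g"
proof -
  obtain k where k: "g = f * k"
    using min_poly_dvd[OF E f] min_polyD(1,3)[OF g] by (auto elim: dvdE)
  have "degree g \<le> degree f"
    using min_polyD[OF f] by (intro min_polyD(5)[OF g]) auto
  moreover have "k \<noteq> 0" "f \<noteq> 0" using k min_polyD(4)[OF g] by auto
  ultimately have "degree k = 0" using k by (auto simp: degree_mult_eq)
  then obtain c where c: "k = [:c:]" by (auto elim: degree_eq_zeroE)
  have "lead_coeff k = 1"
    using min_polyD(2)[OF f] min_polyD(2)[OF g] unfolding k lead_coeff_mult by simp
  then show ?thesis
    using k c by (simp add: one_pCons)
qed

lemma min_poly_degree_1_iff:
  assumes E: "subfield E Kbar" and f: "min_poly E x f"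
  shows "degree f = 1 \<longleftrightarrow> x \<in> E"
proof
  note fD = min_polyD[OF f]
  assume d: "degree f = 1"
  have "poly f x = coeff f 0 + x"
    using d fD(2) by (simp add: poly_altdef)
  then have "x = - coeff f 0"
    using fD(3) by (simp add: add_eq_0_iff2)
  then show "x \<in> E" using poly_over_coeff[OF fD(1)] sf_minus[OF E] by metis
next
  assume "x \<in> E"
  then have "degree f \<le> degree [:-x, 1:]"
    by (intro min_polyD(5)[OF f] poly_over_root_linear E) auto
  then show "degree f = 1" using min_poly_degree_pos[OF f] by simp
qed

section \<open>Algebraically closed fields\<close>

locale alg_closed =
  fixes ty :: "'a::field itself"
  assumes has_root: "\<And>f :: 'a poly. degree f > 0 \<Longrightarrow> \<exists>x. poly f x = 0"
begin

lemma factorization: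
  fixes f :: "'a poly"
  assumes "lead_coeff f = 1"
  shows "\<exists>A. size A = degree f \<and> f = (\<Prod>x\<in>#A. [:-x, 1:])"
  using assms
proof (induction "degree f" arbitrary: f)
  case 0
  then show ?case
    by (intro exI[of _ "{#}"]) (auto elim!: degree_eq_zeroE simp: one_pCons)
next
  case (Suc n)
  then obtain x where "poly f x = 0" using has_root[of f] by auto
  then obtain q where q: "f = [:-x, 1:] * q"
    using poly_eq_0_iff_dvd[of f x] by (auto elim: dvdE)
  have "q \<noteq> 0" "lead_coeff q = 1" using q Suc(3) by (auto simp: lead_coeff_mult simp del: mult_pCons_left)
  moreover from this have "degree f = Suc (degree q)"
    unfolding q by (subst degree_mult_eq) auto
  ultimately obtain A where "size A = degree q" "q = (\<Prod>x\<in>#A. [:-x, 1:])"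
    using Suc(1)[of q] Suc(2) by auto
  then show ?case
    using q \<open>degree f = Suc (degree q)\<close>
    by (intro exI[of _ "add_mset x A"]) auto
qed

end

lemma degree_prod_mset_linear: "degree (\<Prod>x\<in>#A. [:-x, 1:] :: 'a::field poly) = size A"
  proof (induct A)
  case (add x A)
  have "(\<Prod>x\<in>#A. [:-x, 1:] :: 'a poly) \<noteq> 0"
    by (auto simp: prod_mset_zero_iff)
  then show ?case using add by (simp add: degree_mult_eq del: mult_pCons_left)
qed simp

lemma lead_coeff_prod_mset_linear: "lead_coeff (\<Prod>x\<in>#A. [:-x, 1:] :: 'a::field poly) = 1"
  by (induct A) (auto simp: lead_coeff_mult simp del: mult_pCons_left)

lemma poly_prod_mset_linear: "poly (\<Prod>x\<in>#A. [:-x, 1:] :: 'a::field poly) y = (\<Prod>x\<in>#A. y - x)"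
  by (simp add: poly_prod_mset)

lemma poly_prod_mset_linear_eq_0_iff: "poly (\<Prod>x\<in>#A. [:-x, 1:] :: 'a::field poly) y = 0 \<longleftrightarrow> y \<in># A"
  unfolding poly_prod_mset_linear by (auto simp: prod_mset_zero_iff)

section \<open>Ultrametric norms\<close>

locale ultrametric = alg_closed ty for ty :: "'a::field itself" +
  fixes N :: "'a \<Rightarrow> real"
  assumes N_nonneg [simp]: "0 \<le> N x" and N_eq_0_iff [simp]: "N x = 0 \<longleftrightarrow> x = 0"
    and N_mult: "N (x * y) = N x * N y" and N_add: "N (x + y) \<le> max (N x) (N y)"
begin

lemma N_0 [simp]: "N 0 = 0"
  by simp

lemma N_pos_iff [simp]: "0 < N x \<longleftrightarrow> x \<noteq> 0"
  using N_nonneg[of x] N_eq_0_iff[of x] by linarith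

lemma N_1 [simp]: "N 1 = 1"
  using N_mult[of 1 1] N_eq_0_iff[of 1] by simp

lemma N_minus [simp]: "N (- x) = N x"
proof -
  have "N (- 1) * N (- 1) = 1" using N_mult[of "-1" "-1"] by simp
  then have "N (- 1) = 1"
    using N_nonneg[of "-1"] by (metis abs_of_nonneg power2_eq_square real_sqrt_abs real_sqrt_one)
  then show ?thesis using N_mult[of "-1" x] by simp
qed

lemma N_minus_commute: "N (x - y) = N (y - x)"
  using N_minus[of "x - y"] by simp

lemma N_diff: "N (x - y) \<le> max (N x) (N y)"
  using N_add[of x "- y"] by simp

lemma N_triangle: "N (x - z) \<le> max (N (x - y)) (N (y - z))"
  using N_add[of "x - y" "y - z"] by simp

lemma N_inverse: "N (inverse x) = inverse (N x)"
proof (cases "x = 0")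
  case False
  then have "N x * N (inverse x) = 1" using N_mult[of x "inverse x"] by simp
  then show ?thesis by (simp add: inverse_unique)
qed simp

lemma N_divide: "N (x / y) = N x / N y"
  by (simp add: divide_inverse N_mult N_inverse)

lemma N_power: "N (x ^ n) = N x ^ n"
  by (induct n) (auto simp: N_mult)

lemma N_prod_mset: "N (\<Prod>x\<in>#A. f x) = (\<Prod>x\<in>#A. N (f x))"
  by (induct A) (auto simp: N_mult)

lemma N_prod: "N (\<Prod>x\<in>A. f x) = (\<Prod>x\<in>A. N (f x))"
  by (induct A rule: infinite_finite_induct) (auto simp: N_mult)

lemma N_sum_le:
  assumes "\<And>i. i \<in> A \<Longrightarrow> N (f i) \<le> B" "0 \<le> B"
  shows "N (\<Sum>i\<in>A. f i) \<le> B"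
  using assms(1)
proof (induct A rule: infinite_finite_induct)
  case (insert i A)
  then have "max (N (f i)) (N (\<Sum>i\<in>A. f i)) \<le> B" by auto
  then show ?case using insert(1,2) order_trans[OF N_add] by simp
qed (use assms(2) in auto)

lemma N_of_nat: "N (of_nat n) \<le> 1"
proof (induct n)
  case (Suc n)
  then show ?case using N_add[of 1 "of_nat n"] by simp
qed simp

lemma N_add_eq: "N x < N y \<Longrightarrow> N (x + y) = N y"
  using N_add[of x y] N_diff[of "x + y" x] by (simp add: max_def split: if_splits)

lemma N_diff_eq: "N x < N y \<Longrightarrow> N (x - y) = N y"
  using N_add_eq[of x "- y"] by simp

lemma N_diff_eq': "N x < N y \<Longrightarrow> N (y - x) = N y"
  using N_diff_eq[of x y] by (simp add: N_minus_commute)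

lemma N_close_eq: "N (x - y) < N y \<Longrightarrow> N x = N y"
  using N_add_eq[of "x - y" y] by simp

subsection \<open>Topological closure\<close>

text \<open>For a subfield this is the intersection of its completion with the given algebraically
  closed field.\<close>

definition cl :: "'a set \<Rightarrow> 'a set" where
  "cl K = {x. \<forall>e>0. \<exists>c\<in>K. N (x - c) < e}"

lemma cl_D: "x \<in> cl K \<Longrightarrow> e > 0 \<Longrightarrow> \<exists>c\<in>K. N (x - c) < e"
  by (auto simp: cl_def)

lemma subset_cl: "K \<subseteq> cl K"
  by (force simp: cl_def)

lemma cl_cl: "cl (cl K) = cl K"
proof
  show "cl (cl K) \<subseteq> cl K"
  proof
    fix x assume x: "x \<in> cl (cl K)"
    show "x \<in> cl K"
      unfolding cl_def
    proof (clarify)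
      fix e :: real assume e: "e > 0"
      then obtain y where y: "y \<in> cl K" "N (x - y) < e" using cl_D[OF x] by blast
      then obtain z where "z \<in> K" "N (y - z) < e" using cl_D e by blast
      then show "\<exists>c\<in>K. N (x - c) < e"
        using N_triangle[of x z y] y(2) by (auto intro!: bexI[of _ z])
    qed
  qed
qed (rule subset_cl)

lemma subfield_cl:
  assumes K: "subfield K Kbar"
  shows "subfield (cl K) Kbar"
proof (rule subfield_KbarI)
  show "1 \<in> cl K" using subset_cl sf_1[OF K] by blast
next
  fix x y assume xy: "x \<in> cl K" "y \<in> cl K"
  show "x + y \<in> cl K"
    unfolding cl_def
  proof clarify
    fix e :: real assume "e > 0"
    then obtain c d where cd: "c \<in> K" "N (x - c) < e" "d \<in> K" "N (y - d) < e"
      using cl_D xy by metis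
    have "N ((x + y) - (c + d)) < e"
      using N_add[of "x - c" "y - d"] cd by (simp add: algebra_simps)
    then show "\<exists>c\<in>K. N (x + y - c) < e"
      using cd sf_add[OF K] by blast
  qed
  show "x * y \<in> cl K"
    unfolding cl_def
  proof clarify
    fix e :: real assume e: "e > 0"
    define M where "M = max 1 (max (N x) (N y))"
    have M: "M \<ge> 1" "N x \<le> M" "N y \<le> M" by (auto simp: M_def)
    define e' where "e' = min 1 (e / M)"
    have e': "e' > 0" "e' \<le> 1" "M * e' \<le> e" using e M by (auto simp: e'_def min_def field_simps)
    then obtain c d where cd: "c \<in> K" "N (x - c) < e'" "d \<in> K" "N (y - d) < e'"
      using cl_D xy by metis
    have "N d \<le> M"
      using N_diff[of y "y - d"] cd(4) e' M by simp
    have "N (x * (y - d)) < e"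
    proof -
      have "N x * N (y - d) \<le> M * N (y - d)" using M by (intro mult_right_mono) auto
      also have "\<dots> < M * e'" using M cd by simp
      finally show ?thesis using e' by (simp add: N_mult)
    qed
    moreover have "N ((x - c) * d) < e"
    proof -
      have "N (x - c) * N d \<le> N (x - c) * M" using \<open>N d \<le> M\<close> by (intro mult_left_mono) auto
      also have "\<dots> < e' * M" using M cd by simp
      finally show ?thesis using e' by (simp add: N_mult mult.commute)
    qed
    moreover have "x * y - c * d = x * (y - d) + (x - c) * d" by (simp add: algebra_simps)
    ultimately have "N (x * y - c * d) < e"
      using N_add[of "x * (y - d)" "(x - c) * d"] by simp
    then show "\<exists>c\<in>K. N (x * y - c) < e"
      using cd sf_mult[OF K] by blast
  qed
next
  fix x assume x: "x \<in> cl K"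
  show "- x \<in> cl K"
    unfolding cl_def
  proof clarify
    fix e :: real assume "e > 0"
    then obtain c where c: "c \<in> K" "N (x - c) < e" using cl_D x by metis
    have "N (- x - (- c)) < e" using c N_minus_commute[of x c] by (simp add: algebra_simps)
    then show "\<exists>c\<in>K. N (- x - c) < e" using c sf_minus[OF K] by blast
  qed
  show "inverse x \<in> cl K"
  proof (cases "x = 0")
    case True
    then show ?thesis using x by simp
  next
    case False
    show ?thesis
      unfolding cl_def
    proof clarify
      fix e :: real assume e: "e > 0"
      have "min (N x) (e * (N x * N x)) > 0" using e False by simp
      then obtain c where c: "c \<in> K" "N (x - c) < min (N x) (e * (N x * N x))"
        using cl_D x by metis
      have Nc: "N c = N x" using N_close_eq[of c x] c by (simp add: N_minus_commute)
      then have "c \<noteq> 0" using False N_eq_0_iff by metis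
      then have "inverse x - inverse c = (c - x) / (x * c)"
        using False by (simp add: field_simps)
      then have "N (inverse x - inverse c) = N (x - c) / (N x * N x)"
        using Nc by (simp add: N_divide N_mult N_minus_commute)
      also have "\<dots> < e" using c False by (simp add: field_simps)
      finally show "\<exists>c\<in>K. N (inverse x - c) < e" using c sf_inverse[OF K] by blast
    qed
  qed
qed

subsection \<open>Gauss norms\<close>

text \<open>Upper bound for the Gauss norm of radius \<open>r\<close>. Only such bounds occur, so
  the maximum itself is never formed and the zero polynomial needs no special treatment.\<close>

definition gauss_le :: "real \<Rightarrow> 'a poly \<Rightarrow> real \<Rightarrow> bool" where
  "gauss_le r f B \<longleftrightarrow> (\<forall>i. N (coeff f i) * r ^ i \<le> B)"

context
  fixes r :: real
  assumes r: "r > 0"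
begin

lemma gauss_leD: "gauss_le r f B \<Longrightarrow> N (coeff f i) * r ^ i \<le> B"
  by (auto simp: gauss_le_def)

lemma gauss_le_nonneg: "gauss_le r f B \<Longrightarrow> 0 \<le> B"
  using gauss_leD[of f B 0] N_nonneg[of "coeff f 0"] by (simp del: N_nonneg)

lemma gauss_le_mono: "gauss_le r f B \<Longrightarrow> B \<le> B' \<Longrightarrow> gauss_le r f B'"
  unfolding gauss_le_def by (meson order_trans)

lemma gauss_le_0: "0 \<le> B \<Longrightarrow> gauss_le r 0 B"
  by (auto simp: gauss_le_def)

lemma gauss_le_add:
  assumes "gauss_le r f B" "gauss_le r g B"
  shows "gauss_le r (f + g) B"
  unfolding gauss_le_def
proof
  fix i
  have "N (coeff (f + g) i) \<le> max (N (coeff f i)) (N (coeff g i))" by (simp add: N_add)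
  then have "N (coeff (f + g) i) * r ^ i \<le> max (N (coeff f i)) (N (coeff g i)) * r ^ i"
    using r by simp
  also have "\<dots> \<le> B" using gauss_leD[OF assms(1), of i] gauss_leD[OF assms(2), of i]
    by (simp add: max_def)
  finally show "N (coeff (f + g) i) * r ^ i \<le> B" .
qed

lemma gauss_le_minus: "gauss_le r f B \<Longrightarrow> gauss_le r (- f) B"
  by (simp add: gauss_le_def)

lemma gauss_le_diff: "gauss_le r f B \<Longrightarrow> gauss_le r g B \<Longrightarrow> gauss_le r (f - g) B"
  using gauss_le_add[of f B "- g"] gauss_le_minus[of g B] by simp

lemma gauss_le_smult: "gauss_le r f B \<Longrightarrow> gauss_le r (smult c f) (N c * B)"
  by (auto simp: gauss_le_def N_mult mult.assoc intro!: mult_left_mono)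

lemma gauss_le_mult:
  assumes "gauss_le r f A" "gauss_le r g B"
  shows "gauss_le r (f * g) (A * B)"
  unfolding gauss_le_def
proof
  fix i
  have "N (coeff f j * coeff g (i - j)) \<le> A * B / r ^ i" if "j \<in> {..i}" for j
  proof -
    have "(N (coeff f j) * r ^ j) * (N (coeff g (i - j)) * r ^ (i - j)) \<le> A * B"
      using gauss_leD[OF assms(1), of j] gauss_leD[OF assms(2), of "i - j"] r
      by (intro mult_mono) (auto intro: gauss_le_nonneg[OF assms(1)])
    moreover have "r ^ j * r ^ (i - j) = r ^ i"
      using that by (simp flip: power_add)
    ultimately have "N (coeff f j * coeff g (i - j)) * r ^ i \<le> A * B"
      by (metis (no_types, opaque_lifting) N_mult mult.assoc mult.left_commute)
    then show ?thesis using r by (simp add: field_simps)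
  qed
  then have "N (coeff (f * g) i) \<le> A * B / r ^ i"
    unfolding coeff_mult using r gauss_le_nonneg[OF assms(1)] gauss_le_nonneg[OF assms(2)]
    by (intro N_sum_le) auto
  then show "N (coeff (f * g) i) * r ^ i \<le> A * B"
    using r by (simp add: field_simps)
qed

lemma gauss_le_monom: "gauss_le r (monom c n) (N c * r ^ n)"
  using r by (auto simp: gauss_le_def)

text \<open>In each division step the subtracted multiple of \<open>g\<close> has Gauss norm at most
  that of the leading monomial of \<open>f\<close>, because \<open>g\<close> is monic with Gauss
  norm at most \<open>r ^ degree g\<close>. The bound for \<open>f\<close> therefore survives every
  step.\<close>

lemma gauss_le_mod:
  assumes g: "lead_coeff g = 1" "gauss_le r g (r ^ degree g)" and f: "gauss_le r f B"
  shows "gauss_le r (f mod g) B"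
  using f
proof (induct "degree f" arbitrary: f rule: less_induct)
  case less
  have g0: "g \<noteq> 0" using g by auto
  show ?case
  proof (cases "f = 0 \<or> degree f < degree g")
    case True
    then show ?thesis using less(2) by (auto simp: mod_poly_less)
  next
    case False
    define h where "h = monom (lead_coeff f) (degree f - degree g)"
    have "gauss_le r (h * g) (N (lead_coeff f) * r ^ (degree f - degree g) * r ^ degree g)"
      unfolding h_def by (intro gauss_le_mult gauss_le_monom g)
    also have "N (lead_coeff f) * r ^ (degree f - degree g) * r ^ degree g = N (lead_coeff f) * r ^ degree f"
      using False by (simp add: mult.assoc flip: power_add)
    finally have "gauss_le r (h * g) B"
      by (rule gauss_le_mono) (rule gauss_leD[OF less(2)])
    then have fhg: "gauss_le r (f - h * g) B"
      by (intro gauss_le_diff less(2))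
    have mod: "f mod g = (f - h * g) mod g"
      by (simp add: mod_eq_dvd_iff)
    have h0: "h \<noteq> 0" "lead_coeff h = lead_coeff f"
      using False unfolding h_def lead_coeff_monom by auto
    then have dh: "degree (h * g) = degree f"
      using False g0 by (simp add: degree_mult_eq h_def degree_monom_eq)
    moreover have "lead_coeff (h * g) = lead_coeff f"
      using g h0 by (simp add: lead_coeff_mult)
    ultimately have "degree (f - h * g) \<le> degree f" "coeff (f - h * g) (degree f) = 0"
      using degree_diff_le[of f "degree f" "h * g"] by auto
    then consider "f - h * g = 0" | "degree (f - h * g) < degree f"
      using eq_zero_or_degree_less by blast
    then show ?thesis
    proof cases
      case 1
      then show ?thesis
        unfolding mod using gauss_le_nonneg[OF less(2)] by (simp add: gauss_le_0)
    next
      case 2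
      then show ?thesis unfolding mod using less(1)[OF _ fhg] by blast
    qed
  qed
qed

lemma gauss_le_linear: "N x \<le> B \<Longrightarrow> r \<le> B \<Longrightarrow> gauss_le r [:-x, 1:] B"
  using r by (auto simp: gauss_le_def coeff_pCons split: nat.splits)

lemma gauss_le_small_roots:
  "(\<And>x. x \<in># A \<Longrightarrow> N x \<le> r) \<Longrightarrow> gauss_le r (\<Prod>x\<in>#A. [:-x, 1:]) (r ^ size A)"
proof (induct A)
  case empty
  then show ?case by (auto simp: gauss_le_def one_pCons coeff_pCons split: nat.splits)
next
  case (add x A)
  have "gauss_le r ([:-x, 1:] * (\<Prod>x\<in>#A. [:-x, 1:])) (r * r ^ size A)"
    by (intro gauss_le_mult gauss_le_linear add) (use add in auto)
  then show ?case by (simp del: mult_pCons_left)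
qed

text \<open>Each factor X - x equals -x(1 - X/x), and X/x has Gauss norm at most \<open>k\<close>.
  The product is thus its constant term up to a relative error \<open>k\<close>.\<close>

lemma gauss_le_large_roots:
  assumes k: "0 \<le> k" "k \<le> 1" "\<And>x. x \<in># A \<Longrightarrow> r \<le> k * N x"
  shows "gauss_le r (\<Prod>x\<in>#A. [:-x, 1:]) (N (\<Prod>x\<in>#A. - x)) \<and>
    gauss_le r ((\<Prod>x\<in>#A. [:-x, 1:]) - [:\<Prod>x\<in>#A. - x:]) (k * N (\<Prod>x\<in>#A. - x))"
  using k(3)
proof (induct A)
  case empty
  then show ?case using k(1) by (auto simp: gauss_le_def one_pCons coeff_pCons split: nat.splits)
next
  case (add x A)
  let ?f = "\<Prod>x\<in>#A. [:-x, 1:]" and ?e = "\<Prod>x\<in>#A. - x"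
  have x: "r \<le> k * N x" using add by auto
  then have x1: "r \<le> N x" using k(2) mult_right_mono[of k 1 "N x"] by simp
  have IH: "gauss_le r ?f (N ?e)" "gauss_le r (?f - [:?e:]) (k * N ?e)" using add by auto
  have 1: "gauss_le r ([:-x, 1:] * ?f) (N x * N ?e)"
    by (intro gauss_le_mult gauss_le_linear IH) (use x1 in auto)
  have "gauss_le r ([:0, 1:] * ?f) (r * N ?e)"
    using gauss_le_linear[of 0 r] r by (intro gauss_le_mult IH) auto
  then have "gauss_le r ([:0, 1:] * ?f) (k * N x * N ?e)"
    by (rule gauss_le_mono) (use x in \<open>auto intro: mult_right_mono\<close>)
  moreover have "gauss_le r (smult (- x) (?f - [:?e:])) (k * N x * N ?e)"
    using gauss_le_smult[OF IH(2), of "- x"] by (simp add: ac_simps)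
  ultimately have "gauss_le r ([:0, 1:] * ?f + smult (- x) (?f - [:?e:])) (k * N x * N ?e)"
    by (rule gauss_le_add)
  moreover have "[:0, 1:] * ?f + smult (- x) (?f - [:?e:]) = [:-x, 1:] * ?f - [:- x * ?e:]"
    by (simp add: smult_diff_right)
  ultimately show ?case using 1 by (simp add: N_mult mult.assoc del: mult_pCons_left)
qed

end

end

section \<open>Splitting off the small roots over a closed field\<close>

context ultrametric
begin

subsection \<open>Factorization by the size of the roots\<close>

text \<open>One step of the iteration converging to the factor \<open>f\<^sub>S\<close> carrying the small roots: for \<open>f = f\<^sub>T f\<^sub>S\<close>
  with \<open>f\<^sub>T\<close> close to the constant \<open>e\<close>, the remainder of \<open>f\<close> modulo an approximation \<open>g\<close> of \<open>f\<^sub>S\<close> is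
  approximately \<open>- e (g - f\<^sub>S)\<close>.\<close>

lemma small_factor_step:
  assumes r: "r > 0" and k: "0 < k" "k < 1"
    and fS: "lead_coeff fS = 1" "degree fS = s" "gauss_le r fS (r ^ s)"
    and fT: "gauss_le r (fT - [:e:]) (k * N e)" "e \<noteq> 0"
    and E: "subfield E Kbar" "poly_over E (fT * fS)"
    and g: "poly_over E g" "lead_coeff g = 1" "degree g = s" "gauss_le r (g - fS) B" "B \<le> r ^ s"
    and s: "s > 0"
  shows "\<exists>g'. poly_over E g' \<and> lead_coeff g' = 1 \<and> degree g' = s \<and> gauss_le r (g' - fS) (k * B)"
proof -
  define f where "f = fT * fS"
  define d where "d = g - fS"
  \<comment> \<open>The constant \<open>e\<close> need not lie in \<open>E\<close>. The coefficient
    \<open>e'\<close> of \<open>f\<close> does, and it differs from \<open>e\<close> by at most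
    \<open>k * N e\<close> because \<open>fS\<close> is monic of degree \<open>s\<close>; so it can
    replace \<open>e\<close> in the correction.\<close>
  define e' where "e' = coeff f s"
  define R where "R = (- (fT - [:e:]) * d) mod g"
  define g' where "g' = g + smult (inverse e') (f mod g)"
  have B0: "0 \<le> B" by (rule gauss_le_nonneg[OF r g(4)])
  have gg: "gauss_le r g (r ^ degree g)"
    using gauss_le_add[OF r gauss_le_mono[OF r g(4,5)] fS(3)] g(3) by simp
  have "degree d < s"
  proof -
    have "degree d \<le> s" "coeff d s = 0"
      unfolding d_def using degree_diff_le[of g s fS] fS g by auto
    then show ?thesis using eq_zero_or_degree_less[of d s] s by auto
  qed
  then have dmod: "d mod g = d"
    using g(3) by (simp add: mod_poly_less)
  \<comment> \<open>Indeed f + fT d = fT fS + fT (g - fS) = fT g.\<close>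
  have "f mod g = (- fT * d) mod g"
    unfolding mod_eq_dvd_iff f_def d_def by (rule dvdI[of _ _ fT], simp add: algebra_simps)
  also have "- fT * d = smult (- e) d + (- (fT - [:e:]) * d)"
    by (simp add: algebra_simps)
  also have "\<dots> mod g = smult (- e) d + R"
    unfolding R_def by (subst poly_mod_add_left, subst mod_smult_left) (simp only: dmod)
  finally have fmod: "f mod g = smult (- e) d + R" .
  have R: "gauss_le r R (k * N e * B)"
    unfolding R_def by (intro gauss_le_mod gauss_le_mult gauss_le_minus fT g gg r) (use g in \<open>simp add: d_def\<close>)
  have ee': "N (e' - e) \<le> k * N e"
  proof -
    have "gauss_le r ((fT - [:e:]) * fS) (k * N e * r ^ s)"
      by (intro gauss_le_mult fT fS r)
    then have "N (coeff ((fT - [:e:]) * fS) s) * r ^ s \<le> k * N e * r ^ s"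
      by (rule gauss_leD[OF r])
    moreover have "coeff ((fT - [:e:]) * fS) s = e' - e"
      using fS by (simp add: e'_def f_def left_diff_distrib)
    ultimately show ?thesis using r by simp
  qed
  have Ne: "N e' = N e"
  proof (rule N_close_eq)
    have "k * N e < N e" using k fT(2) by simp
    then show "N (e' - e) < N e" using ee' by linarith
  qed
  then have e'0: "e' \<noteq> 0" using fT(2) N_eq_0_iff by metis
  have "g' - fS = smult (inverse e') (smult (e' - e) d + R)"
  proof -
    have "smult (e' - e) d + R = smult e' d + (smult (- e) d + R)"
      by (simp add: smult_diff_left)
    then have "smult (inverse e') (smult (e' - e) d + R) = smult (inverse e' * e') d + smult (inverse e') (smult (- e) d + R)"
      by (simp only: smult_add_right smult_smult add.assoc)
    then show ?thesis
      using e'0 unfolding g'_def fmod by (simp add: d_def)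
  qed
  moreover have "gauss_le r (smult (e' - e) d + R) (k * N e * B)"
  proof (rule gauss_le_add[OF r _ R])
    have "gauss_le r (smult (e' - e) d) (N (e' - e) * B)"
      unfolding d_def by (intro gauss_le_smult g r)
    then show "gauss_le r (smult (e' - e) d) (k * N e * B)"
      by (rule gauss_le_mono[OF r]) (intro mult_right_mono ee' B0)
  qed
  ultimately have "gauss_le r (g' - fS) (N (inverse e') * (k * N e * B))"
    using gauss_le_smult[OF r] by metis
  also have "N (inverse e') * (k * N e * B) = k * B"
    unfolding N_inverse Ne using fT(2) by simp
  finally have 1: "gauss_le r (g' - fS) (k * B)" .
  have "degree (f mod g) < degree g"
    using degree_mod_less[of g f] g(2,3) s by force
  then have "degree (smult (inverse e') (f mod g)) < degree g"
    using e'0 by simp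
  then have 2: "degree g' = s" "lead_coeff g' = 1"
    unfolding g'_def using g(2,3) lead_coeff_add_le[of "smult (inverse e') (f mod g)" g]
    by (simp_all only: degree_add_eq_left add.commute)
  have "poly_over E g'"
    unfolding g'_def e'_def using E g(1)
    by (intro poly_over_add poly_over_smult poly_over_div_mod sf_inverse poly_over_coeff)
      (auto simp: f_def)
  then show ?thesis using 1 2 by blast
qed

text \<open>The strict gap between \<open>r\<close> and the finitely many large roots gives one
  factor \<open>k\<close> below 1, which makes the iteration converge geometrically.\<close>

lemma contraction_const:
  assumes "r > 0" "\<And>x. x \<in># T \<Longrightarrow> r < N x"
  shows "\<exists>k. 0 < k \<and> k < 1 \<and> (\<forall>x\<in>#T. r \<le> k * N x)"
proof (cases "T = {#}")
  case True
  then show ?thesis by (intro exI[of _ "1/2"]) auto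
next
  case False
  define m where "m = Min (N ` set_mset T)"
  have "m \<in> N ` set_mset T" unfolding m_def using False by (intro Min_in) auto
  then have m: "r < m" using assms(2) by auto
  have "r \<le> r / m * N x" if "x \<in># T" for x
  proof -
    have "m \<le> N x" unfolding m_def using that by (intro Min_le) auto
    then have "r / m * m \<le> r / m * N x" using m assms(1) by (intro mult_left_mono) auto
    then show ?thesis using m assms(1) by simp
  qed
  then show ?thesis using m assms(1) by (intro exI[of _ "r / m"]) auto
qed

text \<open>Starting from X^s, whose distance to the factor is at most \<open>r ^ s\<close>, the
  n-th approximation over \<open>E\<close> has error at most \<open>k ^ n * r ^ s\<close>. The
  coefficients of the factor are hence limits of elements of \<open>E\<close>, and \<open>E\<close>
  is closed.\<close>

lemma poly_over_small_factor:
  assumes E: "subfield E Kbar" "cl E = E" and r: "r > 0"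
    and S: "\<And>x. x \<in># S \<Longrightarrow> N x \<le> r" and T: "\<And>x. x \<in># T \<Longrightarrow> r < N x"
    and f: "poly_over E ((\<Prod>x\<in>#T. [:-x, 1:]) * (\<Prod>x\<in>#S. [:-x, 1:]))"
  shows "poly_over E (\<Prod>x\<in>#S. [:-x, 1:])"
proof (cases "size S = 0")
  case True
  then show ?thesis by (auto intro: poly_over_1[OF E(1)])
next
  case False
  let ?fS = "\<Prod>x\<in>#S. [:-x, 1:]" and ?fT = "\<Prod>x\<in>#T. [:-x, 1:]" and ?e = "\<Prod>x\<in>#T. - x"
  define s where "s = size S"
  obtain k where k: "0 < k" "k < 1" "\<forall>x\<in>#T. r \<le> k * N x"
    using contraction_const[OF r T] by blast
  have fS: "lead_coeff ?fS = 1" "degree ?fS = s" "gauss_le r ?fS (r ^ s)"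
    using gauss_le_small_roots[OF r S] lead_coeff_prod_mset_linear degree_prod_mset_linear
    by (auto simp: s_def)
  have e: "?e \<noteq> 0" using T r by (force simp: prod_mset_zero_iff)
  have fT: "gauss_le r (?fT - [:?e:]) (k * N ?e)"
    using gauss_le_large_roots[OF r, of k T] k by auto
  have "\<exists>g. poly_over E g \<and> lead_coeff g = 1 \<and> degree g = s \<and> gauss_le r (g - ?fS) (k ^ n * r ^ s)" for n
  proof (induct n)
    case 0
    have "gauss_le r (monom 1 s) (N 1 * r ^ s)" by (rule gauss_le_monom[OF r])
    then have "gauss_le r (monom 1 s - ?fS) (r ^ s)"
      by (intro gauss_le_diff r fS) simp
    then show ?case
      by (intro exI[of _ "monom 1 s"]) (auto simp: degree_monom_eq intro!: poly_over_monom sf_1 E)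
  next
    case (Suc n)
    then obtain g where g: "poly_over E g" "lead_coeff g = 1" "degree g = s" "gauss_le r (g - ?fS) (k ^ n * r ^ s)"
      by blast
    have "k ^ n * r ^ s \<le> 1 * r ^ s"
      using k r by (intro mult_right_mono power_le_one) auto
    then show ?case
      using small_factor_step[OF r k(1,2) fS fT e E(1) f g] False by (simp add: s_def mult.assoc)
  qed
  note approx = this
  have "coeff ?fS i \<in> cl E" for i
    unfolding cl_def
  proof clarify
    fix \<epsilon> :: real assume "\<epsilon> > 0"
    then have "\<epsilon> * r ^ i / r ^ s > 0" using r by simp
    then obtain n where n: "k ^ n < \<epsilon> * r ^ i / r ^ s"
      using real_arch_pow_inv k(2) by blast
    obtain g where g: "poly_over E g" "gauss_le r (g - ?fS) (k ^ n * r ^ s)"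
      using approx by blast
    have "N (coeff (g - ?fS) i) * r ^ i \<le> k ^ n * r ^ s"
      by (rule gauss_leD[OF r g(2)])
    also have "\<dots> < \<epsilon> * r ^ i" using n r by (simp add: field_simps)
    finally have "N (coeff ?fS i - coeff g i) < \<epsilon>"
      using r by (simp add: N_minus_commute)
    then show "\<exists>c\<in>E. N (coeff ?fS i - c) < \<epsilon>"
      using poly_over_coeff[OF g(1)] by blast
  qed
  then show ?thesis using E(2) by (simp add: poly_over_def)
qed

text \<open>A radius separating two roots of different norms would split the minimal polynomial into
  two proper factors over \<open>E\<close>.\<close>

lemma min_poly_roots_norm_eq:
  assumes E: "subfield E Kbar" "cl E = E" and f: "min_poly E y f"
    and x: "poly f x = 0" "poly f x' = 0"
  shows "N x = N x'"
proof -
  have "\<not> N x < N x'" if x: "poly f x = 0" "poly f x' = 0" for x x'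
  proof
    assume less: "N x < N x'"
    note fD = min_polyD[OF f]
    obtain A where A: "size A = degree f" "f = (\<Prod>x\<in>#A. [:-x, 1:])"
      using factorization[OF fD(2)] by blast
    have xA: "x \<in># A" "x' \<in># A"
      using x unfolding A(2) poly_prod_mset_linear_eq_0_iff by auto
    define t where "t = Min {N z | z. z \<in># A \<and> N z > N x}"
    have fin: "finite {N z | z. z \<in># A \<and> N z > N x}" by simp
    have "{N z | z. z \<in># A \<and> N z > N x} \<noteq> {}" using less xA by auto
    then have "t \<in> {N z | z. z \<in># A \<and> N z > N x}"
      unfolding t_def by (rule Min_in[OF fin])
    moreover have "\<And>z. z \<in># A \<Longrightarrow> N z > N x \<Longrightarrow> t \<le> N z"
      unfolding t_def using fin by (auto intro!: Min_le)
    ultimately have t: "t > N x" "\<And>z. z \<in># A \<Longrightarrow> N z > N x \<Longrightarrow> t \<le> N z"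
      by auto
    \<comment> \<open>Here \<open>t\<close> is the next larger norm of a root. The midpoint
      separates the same roots as N x does, and it is positive even for x = 0.\<close>
    define r where "r = (N x + t) / 2"
    have r: "r > N x" "r < t" "r > 0"
      using t(1) N_nonneg[of x] by (auto simp: r_def simp del: N_nonneg)
    define S where "S = filter_mset (\<lambda>z. N z \<le> r) A"
    define T where "T = filter_mset (\<lambda>z. \<not> N z \<le> r) A"
    have AST: "A = T + S" unfolding S_def T_def
      by (simp add: add.commute flip: multiset_partition)
    let ?fS = "\<Prod>x\<in>#S. [:-x, 1:]" and ?fT = "\<Prod>x\<in>#T. [:-x, 1:]"
    have fST: "f = ?fT * ?fS" unfolding A(2) AST by simp
    have nz: "?fS \<noteq> 0" "?fT \<noteq> 0" using fST fD(4) by auto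
    have "poly_over E (?fT * ?fS)" using fST fD(1) by simp
    then have over: "poly_over E ?fS"
      by (rule poly_over_small_factor[OF E r(3), rotated 2]) (auto simp: S_def T_def)
    then have over': "poly_over E ?fT"
      using poly_over_dvd_quotient[OF E(1), of ?fS ?fT] fD(1) fST nz by (simp add: mult.commute)
    have "r < N x'" using t(2)[OF xA(2) less] r by linarith
    then have "x \<in># S" "x' \<in># T" using xA r by (simp_all add: S_def T_def)
    then have "size S > 0" "size T > 0" by (auto simp: nonempty_has_size[symmetric])
    then have "degree ?fS < degree f" "degree ?fT < degree f"
      using A(1) AST unfolding degree_prod_mset_linear by auto
    moreover have "poly ?fS y = 0 \<or> poly ?fT y = 0" using fST fD(3) by auto
    ultimately show False
      using fD(5)[OF over] fD(5)[OF over'] nz by auto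
  qed
  from this[OF x] this[OF x(2,1)] show ?thesis by linarith
qed

end

section \<open>Norms of conjugates over a closed subfield\<close>

locale closed_subfield = ultrametric ty N for ty :: "'a::field itself" and N +
  fixes C :: "'a set"
  assumes C: "subfield C Kbar" "cl C = C"
    and C_algebraic: "\<And>x. \<exists>g. poly_over C g \<and> g \<noteq> 0 \<and> poly g x = 0"
begin

lemma C_min_poly: "\<exists>f. min_poly C x f"
  using C_algebraic min_poly_exists[OF C(1)] by blast

text \<open>The elements g(y) and g(z) are roots of the same minimal polynomial over
  \<open>C\<close>: composing it with \<open>g\<close> gives a polynomial over \<open>C\<close>
  vanishing at \<open>y\<close>, hence at \<open>z\<close>.\<close>

lemma conj_norm_eq:
  assumes f: "min_poly C y f" and z: "poly f z = 0" and g: "poly_over C g"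
  shows "N (poly g z) = N (poly g y)"
proof -
  obtain h where h: "min_poly C (poly g y) h" using C_min_poly by blast
  have "poly (pcompose h g) z = 0"
  proof (rule min_poly_root[OF C(1) f _ _ z])
    show "poly_over C (pcompose h g)"
      by (rule poly_over_pcompose[OF C(1) min_polyD(1)[OF h] g])
    show "poly (pcompose h g) y = 0"
      using min_polyD(3)[OF h] by (simp add: poly_pcompose)
  qed
  then show ?thesis
    by (intro min_poly_roots_norm_eq[OF C h] min_polyD(3)[OF h]) (simp add: poly_pcompose)
qed

end

section \<open>Hasse derivatives\<close>

text \<open>The q-th derivative is q! times this polynomial and vanishes identically in
  characteristic p once q \<ge> p; the Taylor coefficient retains the information. For i < q the
  binomial coefficient is 0, so the truncated exponent does no harm.\<close>

definition hasse :: "nat \<Rightarrow> 'a::field poly \<Rightarrow> 'a poly" where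
  "hasse q f = (\<Sum>i\<le>degree f. monom (of_nat (i choose q) * coeff f i) (i - q))"

lemma poly_over_hasse:
  "subfield E Kbar \<Longrightarrow> poly_over E f \<Longrightarrow> poly_over E (hasse q f)"
  unfolding hasse_def
  by (intro poly_over_sum poly_over_monom sf_mult sf_of_nat poly_over_coeff)

lemma pcompose_sum:
  "pcompose f (g :: 'a::comm_ring_1 poly) = (\<Sum>i\<le>degree f. smult (coeff f i) (g ^ i))"
proof -
  have "degree (map_poly (\<lambda>x. [:x:]) f) = degree f"
    by (rule degree_map_poly) simp
  then show ?thesis
    unfolding pcompose_altdef poly_altdef by (simp add: coeff_map_poly)
qed

lemma poly_hasse: "poly (hasse q f) z = coeff (pcompose f [:z, 1:]) q"
proof -
  have "coeff ([:z, 1:] ^ i) q = of_nat (i choose q) * z ^ (i - q)" for i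
  proof (cases "q \<le> i")
    case False
    have "degree ([:z, 1:] ^ i) \<le> i"
      using degree_power_le[of "[:z, 1:]" i] by simp
    then show ?thesis using False by (simp add: coeff_eq_0 binomial_eq_0)
  qed (simp add: coeff_linear_poly_power)
  then show ?thesis
    by (simp add: hasse_def poly_sum poly_monom pcompose_sum coeff_sum ac_simps)
qed

lemma degree_hasse: "degree (hasse q f) \<le> degree f - q"
  unfolding hasse_def
  by (intro degree_sum_le) (auto intro!: order_trans[OF degree_monom_le])

lemma coeff_hasse:
  assumes "q \<le> degree f"
  shows "coeff (hasse q f) (degree f - q) = of_nat (degree f choose q) * lead_coeff f"
proof -
  have "coeff (hasse q f) (degree f - q) =
      (\<Sum>i\<le>degree f. if i - q = degree f - q then of_nat (i choose q) * coeff f i else 0)"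
    by (simp add: hasse_def coeff_sum)
  also have "\<dots> = (\<Sum>i\<in>{degree f}. of_nat (i choose q) * coeff f i)"
  proof (rule sum.mono_neutral_cong_right)
    show "\<forall>i\<in>{..degree f} - {degree f}. (if i - q = degree f - q then of_nat (i choose q) * coeff f i else 0) = 0"
    proof
      fix i assume i: "i \<in> {..degree f} - {degree f}"
      have "i < q" if "i - q = degree f - q" using that i assms by (cases "i < q") auto
      then show "(if i - q = degree f - q then of_nat (i choose q) * coeff f i else 0) = 0"
        by (simp add: binomial_eq_0)
    qed
  qed auto
  finally show ?thesis by simp
qed

lemma pcompose_prod_mset_linear:
  "pcompose (\<Prod>x\<in>#A. [:-x, 1:]) [:z, 1:] = (\<Prod>x\<in>#A. [:z - x, 1:] :: 'a::field poly)"
proof (induct A)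
  case (add x A)
  have "pcompose [:-x, 1:] [:z, 1:] = [:z - x, 1:]"
    by (simp add: pcompose_pCons)
  then show ?case using add by (simp only: image_mset_add_mset prod_mset.add_mset pcompose_mult)
qed (simp add: pcompose_1)

text \<open>If p does not divide m, then q = 1 works. Otherwise m = pu with 1 < u < p, and q = p
  works because the binomial coefficient of pu over p is congruent to u modulo p. This case of
  Lucas's theorem follows from Vandermonde's identity by induction on u.\<close>

lemma binomial_nonzero_mod_prime:
  fixes p :: nat
  assumes p: "prime p" and m: "1 < m" "m < p ^ 2" "m \<noteq> p"
  shows "\<exists>q. 0 < q \<and> q < m \<and> \<not> p dvd (m choose q)"
proof (cases "p dvd m")
  case False
  then show ?thesis using m by (intro exI[of _ 1]) auto
next
  case True
  then obtain u where u: "m = p * u" by (auto elim: dvdE)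
  have p0: "p > 0" using prime_gt_0_nat[OF p] .
  have binom: "((p * k) choose p) mod p = k mod p" for k
  proof (induct k)
    case 0
    then show ?case using p0 by (cases p) auto
  next
    case (Suc k)
    have "(p * Suc k) choose p = (\<Sum>j\<le>p. ((p * k) choose j) * (p choose (p - j)))"
      by (simp add: vandermonde add.commute)
    also have "\<dots> = (\<Sum>j\<in>{0, p}. ((p * k) choose j) * (p choose (p - j))) +
        (\<Sum>j\<in>{..p} - {0, p}. ((p * k) choose j) * (p choose (p - j)))"
      by (subst add.commute, rule sum.subset_diff) auto
    also have "(\<Sum>j\<in>{0, p}. ((p * k) choose j) * (p choose (p - j))) = 1 + ((p * k) choose p)"
      using p0 by simp
    finally have "((p * Suc k) choose p) mod p =
        (1 + ((p * k) choose p) + (\<Sum>j\<in>{..p} - {0, p}. ((p * k) choose j) * (p choose (p - j)))) mod p"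
      by simp
    moreover have "p dvd (\<Sum>j\<in>{..p} - {0, p}. ((p * k) choose j) * (p choose (p - j)))"
      by (intro dvd_sum dvd_mult dvd_choose_prime p) (use p0 in auto)
    ultimately have "((p * Suc k) choose p) mod p = (1 + ((p * k) choose p)) mod p"
      by (metis add.right_neutral dvd_eq_mod_eq_0 mod_add_right_eq)
    also have "\<dots> = Suc k mod p"
      using Suc by (metis mod_add_right_eq plus_1_eq_Suc)
    finally show ?case .
  qed
  have "u \<noteq> 0" using m u by (intro notI) simp
  moreover have "u \<noteq> 1" "u < p" using m u p0 by (auto simp: power2_eq_square)
  ultimately have "u < p" "u > 1" by linarith+
  then have "\<not> p dvd (m choose p)"
    using binom[of u] unfolding u dvd_eq_mod_eq_0 by simp
  then show ?thesis using p0 \<open>u > 1\<close> u by (intro exI[of _ p]) auto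
qed

section \<open>Inequalities for products over multisets of roots\<close>

lemma prod_mset_nonneg:
  fixes F :: "'b \<Rightarrow> real"
  shows "(\<And>a. a \<in># A \<Longrightarrow> 0 \<le> F a) \<Longrightarrow> 0 \<le> (\<Prod>a\<in>#A. F a)"
  by (induct A) auto

lemma prod_mset_ge_1:
  fixes F :: "'b \<Rightarrow> real"
  shows "(\<And>a. a \<in># A \<Longrightarrow> 1 \<le> F a) \<Longrightarrow> 1 \<le> (\<Prod>a\<in>#A. F a)"
proof (induct A)
  case (add a A)
  then have "1 \<le> F a" "1 \<le> (\<Prod>a\<in>#A. F a)" by auto
  then have "1 * 1 \<le> F a * (\<Prod>a\<in>#A. F a)" by (intro mult_mono) linarith+
  then show ?case by simp
qed simp

lemma prod_mset_le_power:
  fixes F :: "'b \<Rightarrow> real"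
  assumes "\<And>a. a \<in># A \<Longrightarrow> 0 \<le> F a \<and> F a \<le> R"
  shows "(\<Prod>a\<in>#A. F a) \<le> R ^ size A"
  using assms
proof (induct A)
  case (add a A)
  have "(\<Prod>a\<in>#A. F a) \<ge> 0" using add(2) by (intro prod_mset_nonneg) auto
  moreover have "0 \<le> F a" "F a \<le> R" "(\<Prod>a\<in>#A. F a) \<le> R ^ size A" using add by auto
  ultimately show ?case by (auto intro!: mult_mono order_trans[of 0 "F a" R])
qed simp

lemma prod_mset_gt_power:
  fixes F :: "'b \<Rightarrow> real"
  assumes "\<And>a. a \<in># A \<Longrightarrow> R < F a" "0 \<le> R" "A \<noteq> {#}"
  shows "R ^ size A < (\<Prod>a\<in>#A. F a)"
  using assms(1,3)
proof (induct A)
  case (add a A)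
  show ?case
  proof (cases "A = {#}")
    case False
    then have "R ^ size A < (\<Prod>a\<in>#A. F a)" "R < F a" using add by auto
    then have "R * R ^ size A < F a * (\<Prod>a\<in>#A. F a)"
      using assms(2) by (intro mult_strict_mono') auto
    then show ?thesis by simp
  qed (use add in auto)
qed simp

lemma prod_mset_less_1:
  fixes F :: "'b \<Rightarrow> real"
  assumes "\<And>a. a \<in># A \<Longrightarrow> 0 \<le> F a \<and> F a \<le> 1" "b \<in># A" "F b < 1"
  shows "(\<Prod>a\<in>#A. F a) < 1"
proof -
  obtain B where B: "A = add_mset b B" using assms(2) by (meson multi_member_split)
  have "(\<Prod>a\<in>#B. F a) \<le> 1"
    using prod_mset_le_power[of B F 1] assms(1) B by auto
  moreover have "(\<Prod>a\<in>#B. F a) \<ge> 0" using assms(1) unfolding B by (intro prod_mset_nonneg) auto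
  ultimately have "F b * (\<Prod>a\<in>#B. F a) \<le> F b * 1"
    using assms(1)[of b] B by (intro mult_left_mono) auto
  then show ?thesis using B assms(3) by simp
qed

definition mdeg :: "'a::field set \<Rightarrow> 'a \<Rightarrow> nat" where
  "mdeg E x = degree (THE f. min_poly E x f)"

lemma mdeg_eq: "subfield E Kbar \<Longrightarrow> min_poly E x f \<Longrightarrow> mdeg E x = degree f"
  unfolding mdeg_def by (rule arg_cong[of _ _ degree], rule the_equality) (auto intro: min_poly_unique)

lemma mdeg_le:
  assumes "subfield E Kbar" "poly_over E g" "poly g x = 0" "g \<noteq> 0"
  shows "mdeg E x \<le> degree g"
proof -
  obtain f where f: "min_poly E x f" using min_poly_exists[OF assms(1,2,4,3)] by blast
  then show ?thesis using mdeg_eq[OF assms(1) f] min_polyD(5)[OF f assms(2,3,4)] by simp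
qed

section \<open>Roots of Hasse derivatives and continuity of roots\<close>

context ultrametric
begin

text \<open>By Bezout some multiple of \<open>n\<close> is 1 in the field, and natural numbers have
  norm at most 1.\<close>

lemma N_of_nat_eq_1:
  assumes "prime CHAR('a)" "of_nat n \<noteq> (0 :: 'a)"
  shows "N (of_nat n) = 1"
proof -
  have "\<not> CHAR('a) dvd n" using assms(2) of_nat_eq_0_iff_char_dvd by blast
  moreover from this have "n \<noteq> 0" by (metis dvd_0_right)
  ultimately obtain x y where "n * x = CHAR('a) * y + 1"
    using bezout_nat[of n "CHAR('a)"] assms(1)
    by (metis coprime_iff_gcd_eq_1 coprime_commute prime_imp_coprime)
  then have "of_nat (n * x) = (of_nat (CHAR('a) * y + 1) :: 'a)" by simp
  then have "N (of_nat n) * N (of_nat x) = 1" by (simp flip: N_mult)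
  moreover have "N (of_nat n) * N (of_nat x) \<le> N (of_nat n)"
    using N_of_nat[of x] by (intro mult_left_le) auto
  ultimately show ?thesis using N_of_nat[of n] by linarith
qed

text \<open>To be applied to f(z + X) for a point \<open>z\<close> outside the disc: seen from there
  all roots are close to the centre, so the polynomial is (X + w)^n up to a relative error
  \<open>k\<close>.\<close>

lemma gauss_le_shifted_roots:
  assumes M: "N w = M" "M > 0" and k: "0 \<le> k" "k \<le> 1" and A: "\<And>x. x \<in># A \<Longrightarrow> N (y x - w) \<le> k * M"
  shows "gauss_le M (\<Prod>x\<in>#A. [:y x, 1:]) (M ^ size A) \<and>
    gauss_le M ((\<Prod>x\<in>#A. [:y x, 1:]) - [:w, 1:] ^ size A) (k * M ^ size A)"
  using A
proof (induct A)
  case empty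
  show ?case using k by (auto simp: gauss_le_def one_pCons coeff_pCons split: nat.splits)
next
  case (add x A)
  let ?P = "\<Prod>x\<in>#A. [:y x, 1:]" and ?W = "[:w, 1:] ^ size A"
  have IH: "gauss_le M ?P (M ^ size A)" "gauss_le M (?P - ?W) (k * M ^ size A)"
    using add by auto
  have x: "N (y x - w) \<le> k * M" using add by auto
  also have kM: "k * M \<le> M" using k M by (simp add: mult_left_le_one_le)
  finally have "N (y x) \<le> M"
    using N_add[of "y x - w" w] M by simp
  then have 1: "gauss_le M ([:y x, 1:] * ?P) (M * M ^ size A)"
    using gauss_le_linear[OF M(2), of "- y x" M] by (intro gauss_le_mult IH M) auto
  have "gauss_le M [:y x - w:] (k * M)"
    using x k M by (auto simp: gauss_le_def coeff_pCons split: nat.splits)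
  then have "gauss_le M ([:y x - w:] * ?P) (k * M * M ^ size A)"
    by (intro gauss_le_mult IH M)
  moreover have "gauss_le M ([:w, 1:] * (?P - ?W)) (M * (k * M ^ size A))"
    using gauss_le_linear[OF M(2), of "- w" M] M by (intro gauss_le_mult IH M) auto
  ultimately have "gauss_le M ([:y x - w:] * ?P + [:w, 1:] * (?P - ?W)) (k * M * M ^ size A)"
    by (intro gauss_le_add M) (simp_all add: ac_simps)
  moreover have "[:y x - w:] * ?P + [:w, 1:] * (?P - ?W) = [:y x, 1:] * ?P - [:w, 1:] * ?W"
  proof -
    have "[:y x, 1:] = [:y x - w:] + [:w, 1:]" by simp
    then show ?thesis by (simp only: ring_distribs) simp
  qed
  ultimately show ?case using 1 by (simp add: mult.assoc del: mult_pCons_left)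
qed

text \<open>An ultrametric analogue of the Gauss-Lucas theorem. At \<open>z\<close> outside the disc
  the Hasse derivative is the q-th coefficient of f(z + X), which is dominated by the corresponding
  coefficient of (X + w)^n with w = z - \<theta>. The latter is nonzero because the binomial
  coefficient has norm 1.\<close>

lemma hasse_roots:
  assumes char: "prime CHAR('a)" and A: "\<And>x. x \<in># A \<Longrightarrow> N (x - \<theta>) \<le> R" and R: "0 \<le> R"
    and q: "q \<le> size A" "of_nat (size A choose q) \<noteq> (0 :: 'a)"
    and z: "poly (hasse q (\<Prod>x\<in>#A. [:-x, 1:])) z = 0"
  shows "N (z - \<theta>) \<le> R"
proof (rule ccontr)
  assume that0: "\<not> N (z - \<theta>) \<le> R"
  define w where "w = z - \<theta>"
  define M where "M = N w"
  define n where "n = size A"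
  have M: "R < M" "M > 0" using that0 R by (auto simp: M_def w_def simp del: N_pos_iff)
  let ?P = "\<Prod>x\<in>#A. [:z - x, 1:]"
  have "gauss_le M (?P - [:w, 1:] ^ n) (R / M * M ^ n)"
    unfolding n_def
    by (intro gauss_le_shifted_roots[THEN conjunct2])
      (use M R A in \<open>auto simp: M_def w_def N_minus_commute\<close>)
  then have "N (coeff (?P - [:w, 1:] ^ n) q) * M ^ q \<le> R / M * M ^ n"
    by (rule gauss_leD[OF M(2)])
  also have "\<dots> < 1 * M ^ n" using M by (intro mult_strict_right_mono) auto
  also have "1 * M ^ n = M ^ (n - q) * M ^ q" using q by (simp add: n_def flip: power_add)
  finally have "N (coeff (?P - [:w, 1:] ^ n) q) < M ^ (n - q)" using M by simp
  moreover have "coeff ?P q = 0"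
    using z unfolding poly_hasse pcompose_prod_mset_linear .
  ultimately have "N (of_nat (n choose q) * w ^ (n - q)) < M ^ (n - q)"
    using q by (simp add: coeff_linear_poly_power n_def)
  then show False
    using N_of_nat_eq_1[OF char q(2)] by (simp add: N_mult N_power M_def n_def)
qed

text \<open>If \<open>h\<close> has coefficients close to those of \<open>f\<close>, then h(x) is
  small; being the product of the distances from \<open>x\<close> to the roots of \<open>h\<close>,
  it forces one of these distances to be small.\<close>

lemma approximate_root:
  assumes K: "subfield K Kbar" and f: "poly_over (cl K) f" "lead_coeff f = 1" "poly f x = 0"
    and d: "degree f > 0" and R: "R > 0"
  shows "\<exists>x' h. N (x - x') \<le> R \<and> poly_over K h \<and> h \<noteq> 0 \<and> degree h = degree f \<and> poly h x' = 0"
proof -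
  define d where "d = degree f"
  define B where "B = max 1 (N x)"
  have B: "B \<ge> 1" "N x \<le> B" by (auto simp: B_def)
  \<comment> \<open>An error \<open>e\<close> in the coefficients changes the value at
    \<open>x\<close> by at most \<open>e * B ^ d\<close>, which is to be
    \<open>R ^ d\<close>.\<close>
  define e where "e = R ^ d / B ^ d"
  have e: "e > 0" using R B by (simp add: e_def)
  have "\<exists>c\<in>K. N (coeff f i - c) < e" for i
    using cl_D[OF poly_over_coeff[OF f(1)] e] .
  then obtain c where c: "\<And>i. c i \<in> K" "\<And>i. N (coeff f i - c i) < e" by metis
  define h where "h = monom 1 d + (\<Sum>i<d. monom (c i) i)"
  have small: "degree (\<Sum>i<d. monom (c i) i) < d"
  proof -
    have "degree (\<Sum>i<d. monom (c i) i) \<le> d - 1"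
      by (intro degree_sum_le) (auto intro!: order_trans[OF degree_monom_le])
    then show ?thesis using \<open>degree f > 0\<close> by (simp add: d_def)
  qed
  have h: "degree h = d" "lead_coeff h = 1"
  proof -
    show "degree h = d"
      unfolding h_def using small by (subst degree_add_eq_left) (auto simp: degree_monom_eq)
    then show "lead_coeff h = 1"
      using small by (simp add: h_def coeff_eq_0)
  qed
  have hK: "poly_over K h"
    unfolding h_def by (intro poly_over_add poly_over_sum poly_over_monom c sf_1 K)
  have "poly f x = x ^ d + (\<Sum>i<d. coeff f i * x ^ i)"
    unfolding poly_altdef d_def[symmetric] lessThan_Suc_atMost[symmetric]
    using f(2) by (simp add: d_def)
  then have "poly h x = (\<Sum>i<d. c i * x ^ i) - (\<Sum>i<d. coeff f i * x ^ i)"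
    using f(3) by (simp add: h_def poly_monom poly_sum eq_neg_iff_add_eq_0 algebra_simps)
  also have "\<dots> = (\<Sum>i<d. (c i - coeff f i) * x ^ i)"
    by (simp add: sum_subtractf left_diff_distrib)
  finally have hx: "poly h x = (\<Sum>i<d. (c i - coeff f i) * x ^ i)" .
  have "N (poly h x) \<le> R ^ d"
    unfolding hx
  proof (rule N_sum_le)
    fix i assume "i \<in> {..<d}"
    then have "N x ^ i \<le> B ^ d"
      using B power_mono[of "N x" B i] power_increasing[of i d B] by auto
    then have "N (c i - coeff f i) * N x ^ i \<le> e * B ^ d"
      using c(2)[of i] e by (intro mult_mono) (auto simp: N_minus_commute)
    then show "N ((c i - coeff f i) * x ^ i) \<le> R ^ d"
      using B by (simp add: N_mult N_power e_def)
  qed (use R in auto)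
  obtain A where A: "size A = degree h" "h = (\<Prod>x\<in>#A. [:-x, 1:])"
    using factorization[OF h(2)] by blast
  have "\<exists>a\<in>#A. N (x - a) \<le> R"
  proof (rule ccontr)
    assume "\<not> (\<exists>a\<in>#A. N (x - a) \<le> R)"
    then have "R ^ size A < (\<Prod>a\<in>#A. N (x - a))"
      using A(1) h(1) \<open>degree f > 0\<close> R by (intro prod_mset_gt_power) (auto simp: d_def)
    also have "\<dots> = N (poly h x)"
      unfolding A(2) poly_prod_mset_linear N_prod_mset ..
    finally show False using \<open>N (poly h x) \<le> R ^ d\<close> A h by simp
  qed
  then obtain a where "a \<in># A" "N (x - a) \<le> R" by blast
  moreover from this have "poly h a = 0"
    unfolding A(2) poly_prod_mset_linear_eq_0_iff by simp
  moreover have "h \<noteq> 0" using h by auto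
  ultimately show ?thesis using hK h(1) d_def by blast
qed

end

section \<open>Discs stable under conjugation over \<open>C\<close>\<close>

context closed_subfield
begin

lemma C_mdeg: "min_poly C x f \<Longrightarrow> mdeg C x = degree f"
  using mdeg_eq[OF C(1)] .

text \<open>Let \<open>?g\<close> be the polynomial over \<open>C\<close> with roots \<Theta>. Its
  value has norm at most \<open>R ^ size \<Theta>\<close> in the disc and strictly larger norm
  outside, whereas conjugate arguments give equal norms.\<close>

lemma roots_in_disc:
  assumes \<Theta>: "poly_over C (\<Prod>t\<in>#\<Theta>. [:-t, 1:])" "\<Theta> \<noteq> {#}" "\<And>t. t \<in># \<Theta> \<Longrightarrow> N (t - \<theta>) \<le> R"
    and R: "0 \<le> R" and f: "min_poly C x f" and x: "N (x - \<theta>) \<le> R" and z: "poly f z = 0"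
  shows "N (z - \<theta>) \<le> R"
proof (rule ccontr)
  assume zR: "\<not> N (z - \<theta>) \<le> R"
  let ?g = "\<Prod>t\<in>#\<Theta>. [:-t, 1:]"
  have "N (poly ?g x) \<le> R ^ size \<Theta>"
    unfolding poly_prod_mset_linear N_prod_mset
  proof (rule prod_mset_le_power)
    fix t assume "t \<in># \<Theta>"
    then show "0 \<le> N (x - t) \<and> N (x - t) \<le> R"
      using N_triangle[of x t \<theta>] \<Theta>(3)[of t] x by (auto simp: N_minus_commute)
  qed
  moreover have "R ^ size \<Theta> < N (poly ?g z)"
    unfolding poly_prod_mset_linear N_prod_mset
  proof (rule prod_mset_gt_power[OF _ R \<Theta>(2)])
    fix t assume "t \<in># \<Theta>"
    then show "R < N (z - t)"
      using N_triangle[of z \<theta> t] \<Theta>(3)[of t] zR by auto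
  qed
  ultimately show False using conj_norm_eq[OF f z \<Theta>(1)] by simp
qed

lemma min_degree_in_disc:
  assumes char: "prime CHAR('a)"
    and \<Theta>: "poly_over C (\<Prod>t\<in>#\<Theta>. [:-t, 1:])" "\<Theta> \<noteq> {#}" "\<And>t. t \<in># \<Theta> \<Longrightarrow> N (t - \<theta>) \<le> R"
    and R: "0 \<le> R" and x: "N (x - \<theta>) \<le> R"
    and least: "\<And>y. N (y - \<theta>) \<le> R \<Longrightarrow> mdeg C x \<le> mdeg C y"
    and q: "0 < q" "q < mdeg C x"
  shows "CHAR('a) dvd (mdeg C x choose q)"
proof (rule ccontr)
  assume ndvd: "\<not> ?thesis"
  obtain f where f: "min_poly C x f" using C_min_poly by blast
  have d: "mdeg C x = degree f" using C_mdeg[OF f] .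
  note fD = min_polyD[OF f]
  obtain A where A: "size A = degree f" "f = (\<Prod>x\<in>#A. [:-x, 1:])"
    using factorization[OF fD(2)] by blast
  have nz: "of_nat (degree f choose q) \<noteq> (0 :: 'a)"
    using ndvd d of_nat_eq_0_iff_char_dvd by metis
  have "coeff (hasse q f) (degree f - q) \<noteq> 0"
    using coeff_hasse[of q f] q nz fD(2) d by simp
  then have h: "hasse q f \<noteq> 0" "degree (hasse q f) = degree f - q"
    using degree_hasse[of q f] le_degree[of "hasse q f" "degree f - q"] by auto
  then obtain z where z: "poly (hasse q f) z = 0"
    using has_root[of "hasse q f"] q d by auto
  have "N (z - \<theta>) \<le> R"
  proof (rule hasse_roots[OF char _ R])
    show "q \<le> size A" "of_nat (size A choose q) \<noteq> (0 :: 'a)"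
      using A q d nz by auto
    show "poly (hasse q (\<Prod>x\<in>#A. [:-x, 1:])) z = 0" using z A(2) by simp
    show "N (y - \<theta>) \<le> R" if "y \<in># A" for y
      using that roots_in_disc[OF \<Theta> R f x, of y] A(2) poly_prod_mset_linear_eq_0_iff by metis
  qed
  then have "mdeg C x \<le> mdeg C z" by (rule least)
  also have "\<dots> \<le> degree f - q"
    using mdeg_le[OF C(1) poly_over_hasse[OF C(1) fD(1)] z] h by simp
  finally show False using d q by simp
qed

text \<open>A form of Krasner's lemma: every conjugate of \<open>\<theta>\<close> has a conjugate of \<open>b\<close> close to it.\<close>

lemma krasner_degree:
  assumes \<Theta>: "finite \<Theta>" "\<theta> \<in> \<Theta>" "min_poly C \<theta> (\<Prod>t\<in>#mset_set \<Theta>. [:-t, 1:])"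
    and sep: "\<And>s t. s \<in> \<Theta> \<Longrightarrow> t \<in> \<Theta> \<Longrightarrow> s \<noteq> t \<Longrightarrow> N (s - t) = 1"
    and b: "N (b - \<theta>) < 1"
  shows "card \<Theta> \<le> mdeg C b"
proof -
  let ?g = "\<Prod>t\<in>#mset_set \<Theta>. [:-t, 1:]"
  obtain f where f: "min_poly C b f" using C_min_poly by blast
  note fD = min_polyD[OF f]
  obtain A where A: "size A = degree f" "f = (\<Prod>x\<in>#A. [:-x, 1:])"
    using factorization[OF fD(2)] by blast
  have rootA: "poly f x = 0 \<longleftrightarrow> x \<in># A" for x
    unfolding A(2) poly_prod_mset_linear_eq_0_iff ..
  have le1: "N (x - t) \<le> 1" if "N (x - s) \<le> 1" "s \<in> \<Theta>" "t \<in> \<Theta>" for x s t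
    using N_triangle[of x t s] that sep[of s t] by (cases "s = t") auto
  have "N (poly ?g b) < 1"
    unfolding poly_prod_mset_linear N_prod_mset
    by (rule prod_mset_less_1[of _ _ \<theta>]) (use \<Theta> b le1[of b \<theta>] in auto)
  then have "N (poly ?g x) < 1" if "x \<in># A" for x
    using conj_norm_eq[OF f _ min_polyD(1)[OF \<Theta>(3)], of x] that rootA by simp
  then have near: "\<exists>t\<in>\<Theta>. N (x - t) < 1" if "x \<in># A" for x
    using that prod_mset_ge_1[of "mset_set \<Theta>" "\<lambda>t. N (x - t)"] \<Theta>(1)
    unfolding poly_prod_mset_linear N_prod_mset by force
  have "N (poly f \<theta>) < 1"
    unfolding A(2) poly_prod_mset_linear N_prod_mset
  proof (rule prod_mset_less_1)
    fix x assume "x \<in># A"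
    then obtain t where "t \<in> \<Theta>" "N (x - t) < 1" using near by blast
    then show "0 \<le> N (\<theta> - x) \<and> N (\<theta> - x) \<le> 1"
      using le1[of x t \<theta>] \<Theta>(2) by (simp add: N_minus_commute)
  next
    show "b \<in># A" using rootA fD(3) by simp
    show "N (\<theta> - b) < 1" using b by (simp add: N_minus_commute)
  qed
  moreover have "N (poly f t) = N (poly f \<theta>)" if "t \<in> \<Theta>" for t
    using that \<Theta>(1) by (intro conj_norm_eq[OF \<Theta>(3) _ fD(1)]) (simp only: poly_prod_mset_linear_eq_0_iff, simp)
  ultimately have "\<exists>x\<in>#A. N (t - x) < 1" if "t \<in> \<Theta>" for t
    using that prod_mset_ge_1[of A "\<lambda>x. N (t - x)"]
    unfolding A(2) poly_prod_mset_linear N_prod_mset by force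
  then obtain z where z: "\<And>t. t \<in> \<Theta> \<Longrightarrow> z t \<in># A \<and> N (t - z t) < 1" by metis
  \<comment> \<open>A common close root would put two elements of \<Theta> at distance less than 1.
    So \<open>b\<close> has at least as many conjugates as \<Theta> has elements.\<close>
  have "inj_on z \<Theta>"
  proof (rule inj_onI, rule ccontr)
    fix s t assume st: "s \<in> \<Theta>" "t \<in> \<Theta>" "z s = z t" "s \<noteq> t"
    then have "N (s - t) < 1"
      using N_triangle[of s t "z s"] z[of s] z[of t] N_minus_commute[of t "z s"] by auto
    then show False using sep[OF st(1,2,4)] by simp
  qed
  then have "card \<Theta> \<le> card (set_mset A)"
    by (intro card_inj_on_le[of z]) (use z in auto)
  also have "\<dots> \<le> size A" by (induct A) (auto simp: card_insert_if)
  finally show ?thesis using A(1) C_mdeg[OF f] by simp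
qed

end

section \<open>Artin-Schreier polynomials\<close>

lemma monic_eq_prod_roots:
  fixes f :: "'a::field poly"
  assumes f: "lead_coeff f = 1" and S: "finite S" "card S = degree f" "\<And>x. x \<in> S \<Longrightarrow> poly f x = 0"
  shows "f = (\<Prod>t\<in>#mset_set S. [:-t, 1:])"
proof (rule ccontr)
  let ?g = "\<Prod>t\<in>#mset_set S. [:-t, 1:]"
  assume "f \<noteq> ?g"
  then have nz: "f - ?g \<noteq> 0" by simp
  have "degree ?g = degree f" using S(2) unfolding degree_prod_mset_linear by simp
  then have "degree (f - ?g) \<le> degree f" "coeff (f - ?g) (degree f) = 0"
    using degree_diff_le[of f "degree f" ?g] f lead_coeff_prod_mset_linear[of "mset_set S"] by auto
  then have "degree (f - ?g) < degree f" using eq_zero_or_degree_less nz by blast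
  moreover have "S \<subseteq> {x. poly (f - ?g) x = 0}"
    using S poly_prod_mset_linear_eq_0_iff[of "mset_set S"] by auto
  then have "card S \<le> card {x. poly (f - ?g) x = 0}"
    by (intro card_mono poly_roots_finite nz)
  ultimately show False using card_poly_roots_bound[OF nz] S(2) by linarith
qed

lemma pderiv_dvd_root:
  assumes "f dvd g" "poly f x = 0" "poly (pderiv g) x \<noteq> (0 :: 'a::field)"
  shows "poly (pderiv f) x \<noteq> 0"
  using assms by (auto elim!: dvdE simp: pderiv_mult)

lemma (in alg_closed) card_simple_roots:
  fixes f :: "'a poly"
  assumes "lead_coeff f = 1" "\<And>x. poly f x = 0 \<Longrightarrow> poly (pderiv f) x \<noteq> 0"
  shows "card {x. poly f x = 0} = degree f"
proof -
  obtain A where A: "size A = degree f" "f = (\<Prod>x\<in>#A. [:-x, 1:])"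
    using factorization[OF assms(1)] by blast
  have roots: "poly f x = 0 \<longleftrightarrow> x \<in># A" for x
    unfolding A(2) poly_prod_mset_linear_eq_0_iff ..
  have "count A x = 1" if x: "x \<in># A" for x
  proof (rule ccontr)
    assume ne: "count A x \<noteq> 1"
    obtain B where B: "A = add_mset x B" using x by (meson multi_member_split)
    then have "x \<in># B" using ne by (auto simp: not_in_iff)
    have fB: "f = [:-x, 1:] * (\<Prod>x\<in>#B. [:-x, 1:])" unfolding A(2) B by simp
    have "poly (pderiv f) x = poly (\<Prod>x\<in>#B. [:-x, 1:]) x"
      unfolding fB pderiv_mult by (simp add: pderiv_pCons)
    also have "\<dots> = 0" using \<open>x \<in># B\<close> poly_prod_mset_linear_eq_0_iff by blast
    finally show False using assms(2)[of x] roots x by simp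
  qed
  then have "size A = card (set_mset A)" by (simp add: size_multiset_overloaded_eq)
  moreover have "{x. poly f x = 0} = set_mset A" using roots by auto
  ultimately show ?thesis using A by simp
qed

text \<open>Since \<open>z\<close> is a simple root of a multiple of \<open>m\<close>, it is a
  simple root of \<open>m\<close>; being the only root, it makes \<open>m\<close> linear. This is
  how Hensel roots are later brought down to subfields without Galois theory.\<close>

lemma (in alg_closed) unique_simple_root_mem:
  fixes M :: "'a set"
  assumes M: "subfield M Kbar" and m: "min_poly M z m" and g: "m dvd g" "poly (pderiv g) z \<noteq> 0"
    and unique: "\<And>w. poly m w = 0 \<Longrightarrow> w = z"
  shows "z \<in> M"
proof -
  note mD = min_polyD[OF m]
  have "card {w. poly m w = 0} = degree m"
  proof (rule card_simple_roots[OF mD(2)])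
    fix w assume "poly m w = 0"
    then have "w = z" by (rule unique)
    then show "poly (pderiv m) w \<noteq> 0"
      using pderiv_dvd_root[OF g(1) mD(3) g(2)] by (simp only:) simp
  qed
  moreover have "{w. poly m w = 0} = {z}"
    using unique mD(3) by blast
  ultimately have "degree m = 1" by (metis is_singletonI is_singleton_altdef)
  then show ?thesis using min_poly_degree_1_iff[OF M m] by blast
qed

text \<open>Translation by \<open>w\<close> permutes the roots as soon as it sends one root to a
  root. The translations by elements of \<open>E\<close> preserving the roots are therefore closed
  under addition.\<close>

lemma min_poly_shift:
  assumes E: "subfield E Kbar" and f: "min_poly E x f" and w: "w \<in> E" "poly f (x + w) = 0"
    and y: "poly f y = 0"
  shows "poly f (y + w) = 0"
proof -
  have "poly (pcompose f [:w, 1:]) y = 0"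
  proof (rule min_poly_root[OF E f _ _ y])
    show "poly_over E (pcompose f [:w, 1:])"
      by (intro poly_over_pcompose poly_over_pCons poly_over_0 sf_1 w min_polyD(1)[OF f] E)
  qed (use w in \<open>simp add: poly_pcompose add.commute\<close>)
  then show ?thesis by (simp add: poly_pcompose add.commute)
qed

lemma min_poly_shift_mult:
  assumes E: "subfield E Kbar" and f: "min_poly E x f" and w: "w \<in> E" "poly f (x + w) = 0"
  shows "poly f (x + of_nat n * w) = 0"
proof (induct n)
  case 0
  show ?case using min_polyD(3)[OF f] by simp
next
  case (Suc n)
  then show ?case using min_poly_shift[OF E f w Suc] by (simp add: algebra_simps)
qed

lemma mdeg_affine_le:
  assumes E: "subfield E Kbar" and x: "\<exists>g. poly_over E g \<and> g \<noteq> 0 \<and> poly g x = 0"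
    and u: "u \<in> E" "u \<noteq> 0" and w: "w \<in> E"
  shows "mdeg E (u * x + w) \<le> mdeg E x"
proof -
  obtain f where f: "min_poly E x f" using x min_poly_exists[OF E] by blast
  let ?g = "pcompose f [:- w / u, 1 / u:]"
  have dg: "degree ?g = degree f"
    using u by (simp add: degree_pcompose)
  then have g0: "?g \<noteq> 0"
    using min_poly_degree_pos[OF f] by auto
  have "mdeg E (u * x + w) \<le> degree ?g"
  proof (rule mdeg_le[OF E _ _ g0])
    show "poly_over E ?g"
      by (intro poly_over_pcompose poly_over_pCons poly_over_0 min_polyD(1)[OF f] sf_divide sf_minus sf_1 E u w)
    have "- w / u + (u * x + w) * (1 / u) = x" using u by (simp add: field_simps)
    then show "poly ?g (u * x + w) = 0" using min_polyD(3)[OF f] by (simp add: poly_pcompose)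
  qed
  then show ?thesis using dg mdeg_eq[OF E f] by simp
qed

lemma mdeg_affine:
  assumes E: "subfield E Kbar" and alg: "\<And>x. \<exists>g. poly_over E g \<and> g \<noteq> 0 \<and> poly g x = 0"
    and u: "u \<in> E" "u \<noteq> 0" and w: "w \<in> E"
  shows "mdeg E (u * x + w) = mdeg E x"
proof (rule antisym)
  have "mdeg E ((1 / u) * (u * x + w) + (- w / u)) \<le> mdeg E (u * x + w)"
    by (intro mdeg_affine_le E alg sf_divide sf_1 sf_minus u w) (use u in auto)
  also have "(1 / u) * (u * x + w) + (- w / u) = x" using u by (simp add: field_simps)
  finally show "mdeg E x \<le> mdeg E (u * x + w)" .
qed (intro mdeg_affine_le assms)

section \<open>Characteristic p: the prime field and the extensions generated by Artin-Schreier
  elements\<close>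

locale alg_closed_char = alg_closed ty for ty :: "'a::field itself" +
  fixes p :: nat
  assumes p: "prime p" "CHAR('a) = p"
begin

abbreviation Fp :: "'a set" where "Fp \<equiv> prime_subfield"

lemma p_gt_1: "p > 1" and p_pos: "p > 0"
  using prime_gt_1_nat[OF p(1)] by auto

lemma of_nat_p: "of_nat p = (0 :: 'a)"
  using of_nat_CHAR[where 'a = 'a] p(2) by simp

lemma frob_add: "(x + y :: 'a) ^ p = x ^ p + y ^ p"
  by (rule freshmans_dream) (use p in simp_all)

lemma frob_diff: "(x - y :: 'a) ^ p = x ^ p - y ^ p"
  using frob_add[of "x - y" y] by simp

lemma frob_of_nat: "(of_nat n :: 'a) ^ p = of_nat n"
  using p_pos by (induct n) (simp_all add: frob_add)

lemma Fp_eq: "Fp = of_nat ` {..<p}"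
proof -
  have "of_nat n = (of_nat (n mod p) :: 'a)" for n
  proof -
    have "of_nat n = (of_nat (p * (n div p) + n mod p) :: 'a)" by simp
    also have "\<dots> = of_nat (n mod p)" by (simp only: of_nat_add of_nat_mult of_nat_p) simp
    finally show ?thesis .
  qed
  then show ?thesis
    unfolding prime_subfield_def using p_pos by (auto intro!: image_eqI[of _ _ "_ mod p"])
qed

lemma inj_on_of_nat: "inj_on (of_nat :: nat \<Rightarrow> 'a) {..<p}"
proof -
  have "False" if "i < j" "j < p" "of_nat i = (of_nat j :: 'a)" for i j
  proof -
    have "of_nat (j - i) = (0 :: 'a)" using that by (simp add: of_nat_diff)
    then have "CHAR('a) dvd j - i" by (simp only: of_nat_eq_0_iff_char_dvd)
    then show False using that dvd_imp_le[of p "j - i"] p(2) by simp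
  qed
  then show ?thesis
    by (intro inj_onI) (metis lessThan_iff linorder_neqE_nat)
qed

lemma card_Fp: "card Fp = p" "finite Fp"
  unfolding Fp_eq using card_image[OF inj_on_of_nat] by auto

lemma poly_AS: "poly (monom 1 p - [:s, 1:]) x = x ^ p - x - (s :: 'a)"
  by (simp add: poly_monom)

lemma monic_AS: "degree (monom 1 p - [:s, 1:] :: 'a poly) = p" "lead_coeff (monom 1 p - [:s, 1 :: 'a:]) = 1"
proof -
  have *: "degree [:s, 1 :: 'a:] < p" using p_gt_1 by simp
  then show d: "degree (monom 1 p - [:s, 1:] :: 'a poly) = p"
    unfolding diff_conv_add_uminus using p_gt_1
    by (subst degree_add_eq_left) (simp_all add: degree_monom_eq)
  show "lead_coeff (monom 1 p - [:s, 1 :: 'a:]) = 1"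
    unfolding d using * coeff_eq_0[OF *] by simp
qed

lemma AS_nonzero: "monom 1 p - [:s, 1:] \<noteq> (0 :: 'a poly)"
  using monic_AS(1)[of s] p_pos by (metis degree_0 less_numeral_extra(3))

lemma Fp_iff: "x \<in> Fp \<longleftrightarrow> x ^ p = x"
proof -
  let ?g = "monom 1 p - [:0, 1:] :: 'a poly"
  have g0: "?g \<noteq> 0" by (rule AS_nonzero)
  have "Fp \<subseteq> {x. poly ?g x = 0}"
    by (auto simp: poly_AS prime_subfield_def frob_of_nat poly_monom)
  moreover have "card {x. poly ?g x = 0} \<le> card Fp"
    using card_poly_roots_bound[OF g0] monic_AS(1)[of 0] card_Fp by simp
  ultimately have "Fp = {x. poly ?g x = 0}"
    using poly_roots_finite[OF g0] by (meson card_seteq)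
  then show ?thesis by (auto simp: poly_monom)
qed

lemma subfield_Fp: "subfield Fp Kbar"
proof (rule subfield_KbarI)
  fix x assume "x \<in> Fp"
  then show "- x \<in> Fp" "inverse x \<in> Fp"
    using frob_diff[of 0 x] p_pos by (auto simp: Fp_iff power_inverse)
qed (auto simp: Fp_iff frob_add power_mult_distrib)

lemma Fp_subset: "subfield E Kbar \<Longrightarrow> Fp \<subseteq> E"
  by (auto simp: prime_subfield_def sf_of_nat)

lemma AS_roots: "x ^ p - x = y ^ p - y \<longleftrightarrow> x - y \<in> Fp"
  unfolding Fp_iff frob_diff by (auto simp: algebra_simps)

lemma prod_AS: "(\<Prod>c\<in>Fp. x - c) = x ^ p - x"
proof -
  have "monom 1 p - [:0, 1:] = (\<Prod>t\<in>#mset_set Fp. [:-t, 1:])"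
    using monic_AS[of 0] card_Fp by (intro monic_eq_prod_roots) (auto simp: poly_AS Fp_iff poly_monom)
  then have "poly (monom 1 p - [:0, 1:]) x = (\<Prod>t\<in>#mset_set Fp. x - t)"
    using poly_prod_mset_linear by metis
  also have "\<dots> = (\<Prod>c\<in>Fp. x - c)" by (simp add: prod_unfold_prod_mset)
  finally show ?thesis by (simp add: poly_monom)
qed

lemma poly_over_AS: "subfield (E :: 'a set) Kbar \<Longrightarrow> s \<in> E \<Longrightarrow> poly_over E (monom 1 p - [:s, 1:])"
  by (intro poly_over_diff poly_over_monom poly_over_pCons poly_over_0 sf_1)

lemma pderiv_AS: "pderiv (monom 1 p - [:s, 1:]) = (- 1 :: 'a poly)"
  by (simp add: pderiv_diff pderiv_monom pderiv_pCons of_nat_p one_pCons)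

text \<open>The minimal polynomial divides the separable polynomial with roots \<beta> + c, c in the
  prime field. As \<beta> is not in \<open>E\<close>, a second root \<beta> + c exists; the
  multiples of c exhaust the prime field, and all these translates are roots.\<close>

lemma AS_degree:
  fixes E :: "'a set"
  assumes E: "subfield E Kbar" and \<beta>: "\<beta> \<notin> E" "\<beta> ^ p - \<beta> \<in> E" and f: "min_poly E \<beta> f"
  shows "degree f = p"
proof -
  define g where "g = monom 1 p - [:\<beta> ^ p - \<beta>, 1:]"
  have "g \<noteq> 0" unfolding g_def by (rule AS_nonzero)
  moreover have "poly_over E g" "poly g \<beta> = 0"
    unfolding g_def using poly_over_AS[OF E \<beta>(2)] by (simp_all add: poly_monom)
  ultimately have g: "poly_over E g" "poly g \<beta> = 0" "g \<noteq> 0" by auto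
  have dvd: "f dvd g" by (rule min_poly_dvd[OF E f g(1,2)])
  have simple: "card {x. poly f x = 0} = degree f"
    by (rule card_simple_roots[OF min_polyD(2)[OF f]])
      (rule pderiv_dvd_root[OF dvd], auto simp: g_def pderiv_AS)
  have roots: "x - \<beta> \<in> Fp" if "poly f x = 0" for x
  proof -
    have "poly g x = 0" using dvd that by (auto elim: dvdE)
    then show ?thesis unfolding AS_roots[symmetric] by (simp add: g_def poly_monom)
  qed
  have "degree f \<noteq> 1" using min_poly_degree_1_iff[OF E f] \<beta> by simp
  then have "{x. poly f x = 0} \<noteq> {\<beta>}" using simple by auto
  then obtain x where x: "poly f x = 0" "x \<noteq> \<beta>" using min_polyD(3)[OF f] by auto
  define c where "c = x - \<beta>"
  have c: "c \<in> Fp" "c \<noteq> 0" "poly f (\<beta> + c) = 0" using roots x by (auto simp: c_def)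
  have "poly f (\<beta> + d) = 0" if "d \<in> Fp" for d
  proof -
    have "d / c \<in> Fp" using sf_divide[OF subfield_Fp] that c by blast
    then obtain n where n: "d / c = of_nat n" by (auto simp: prime_subfield_def)
    then have "d = of_nat n * c" using c(2) by (simp add: field_simps)
    then show ?thesis
      using min_poly_shift_mult[OF E f _ c(3)] Fp_subset[OF E] c(1) by auto
  qed
  then have "(+) \<beta> ` Fp \<subseteq> {x. poly f x = 0}" by auto
  then have "card ((+) \<beta> ` Fp) \<le> card {x. poly f x = 0}"
    by (intro card_mono poly_roots_finite min_polyD(4)[OF f])
  then have "p \<le> degree f" using simple card_Fp by (simp add: card_image)
  moreover have "degree f \<le> p"
    using min_polyD(5)[OF f g] monic_AS(1) by (simp add: g_def)
  ultimately show ?thesis by simp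
qed

text \<open>\<open>\<alpha>\<close> and \<open>\<beta>\<close> are polynomials in \<open>\<theta> = a\<alpha> + b\<beta>\<close> because \<open>x\<^sup>p - b\<^sup>p\<^sup>-\<^sup>1x\<close> is additive and kills \<open>b\<close>,
  so that its value at \<open>\<theta>\<close> is \<open>(a\<^sup>p - b\<^sup>p\<^sup>-\<^sup>1a)\<alpha>\<close> up to an element of the base field.\<close>

lemma AS_pair:
  assumes E: "subfield E Kbar" and ab: "a \<in> E" "b \<in> E"
    and \<alpha>: "\<alpha> ^ p - \<alpha> \<in> E" and \<beta>: "\<beta> ^ p - \<beta> \<in> E"
    and ind: "\<And>c d. c \<in> Fp \<Longrightarrow> d \<in> Fp \<Longrightarrow> (c, d) \<noteq> (0, 0) \<Longrightarrow> a * c + b * d \<noteq> 0"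
    and \<theta>: "\<theta> = a * \<alpha> + b * \<beta>"
  obtains A B where "poly_over E A" "poly_over E B" "poly A \<theta> = \<alpha>" "poly B \<theta> = \<beta>" "degree A = p"
    "\<And>c d x. c \<in> Fp \<Longrightarrow> d \<in> Fp \<Longrightarrow> poly A (x + (a * c + b * d)) = poly A x + c"
    "\<And>c d x. c \<in> Fp \<Longrightarrow> d \<in> Fp \<Longrightarrow> poly B (x + (a * c + b * d)) = poly B x + d"
    "\<And>x. poly A x = \<alpha> \<Longrightarrow> \<exists>d\<in>Fp. x = \<theta> + b * d"
    "\<exists>r. r \<noteq> 0 \<and> pderiv A = [:r:]"
proof -
  have b0: "b \<noteq> 0" using ind[of 0 1] sf_0[OF subfield_Fp] sf_1[OF subfield_Fp] by auto
  have bp: "b ^ p = b ^ (p - 1) * b" using p_pos by (metis power_minus_mult)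
  define H where "H = a ^ p - b ^ (p - 1) * a"
  have H: "H \<noteq> 0"
  proof
    assume "H = 0"
    then have "(a / b) ^ p = a / b"
      using b0 by (simp add: H_def power_divide bp)
    then have "a / b \<in> Fp" unfolding Fp_iff .
    then have "- (a / b) \<in> Fp" using sf_minus[OF subfield_Fp] by blast
    then have "a * 1 + b * (- (a / b)) \<noteq> 0"
      by (intro ind sf_1 subfield_Fp) auto
    then show False using b0 by simp
  qed
  \<comment> \<open>The element of \<open>E\<close> by which \<theta>^p - b^(p-1) \<theta> exceeds
    H\<alpha>.\<close>
  define u where "u = a ^ p * (\<alpha> ^ p - \<alpha>) + b ^ p * (\<beta> ^ p - \<beta>)"
  define A where "A = smult (inverse H) (monom 1 p - [:u, b ^ (p - 1):])"
  define B where "B = smult (inverse b) ([:0, 1:] - smult a A)"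
  have polyA: "poly A x = (x ^ p - b ^ (p - 1) * x - u) / H" for x
    by (simp add: A_def poly_monom divide_inverse algebra_simps)
  have polyB: "poly B x = (x - a * poly A x) / b" for x
    by (simp add: B_def divide_inverse algebra_simps)
  have HE: "H \<in> E" "u \<in> E"
    unfolding H_def u_def by (intro sf_diff sf_add sf_mult sf_power E ab \<alpha> \<beta>)+
  have A: "poly_over E A"
    unfolding A_def
    by (intro poly_over_smult poly_over_diff poly_over_monom poly_over_pCons poly_over_0 sf_1 sf_inverse sf_power HE ab E)
  have B: "poly_over E B"
    unfolding B_def
    by (intro poly_over_smult poly_over_diff poly_over_pCons poly_over_0 sf_0 sf_1 sf_inverse A ab E)
  have "\<theta> ^ p = a ^ p * \<alpha> ^ p + b ^ p * \<beta> ^ p"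
    by (simp add: \<theta> frob_add power_mult_distrib)
  then have "\<theta> ^ p - b ^ (p - 1) * \<theta> - u = H * \<alpha>"
    by (simp add: \<theta> u_def H_def bp algebra_simps)
  then have A\<theta>: "poly A \<theta> = \<alpha>" using H by (simp add: polyA)
  have B\<theta>: "poly B \<theta> = \<beta>" unfolding polyB A\<theta> using b0 by (simp add: \<theta>)
  have *: "degree [:u, b ^ (p - 1):] < p" using p_gt_1 by (auto intro: le_less_trans[OF degree_pCons_le])
  have "degree (monom 1 p - [:u, b ^ (p - 1):]) = p"
    unfolding diff_conv_add_uminus by (subst degree_add_eq_left) (use * in \<open>simp_all add: degree_monom_eq del: minus_pCons\<close>)
  then have dA: "degree A = p"
    using H by (simp add: A_def)
  have Aadd: "poly A (x + y) = poly A x + (y ^ p - b ^ (p - 1) * y) / H" for x y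
    by (simp add: polyA frob_add algebra_simps diff_divide_distrib add_divide_distrib)
  have Ashift: "poly A (x + (a * c + b * d)) = poly A x + c" if "c \<in> Fp" "d \<in> Fp" for c d x
  proof -
    have "(a * c + b * d) ^ p = a ^ p * c + b ^ p * d"
      using that by (simp add: frob_add power_mult_distrib Fp_iff)
    then have "(a * c + b * d) ^ p - b ^ (p - 1) * (a * c + b * d) = H * c"
      by (simp add: H_def bp algebra_simps)
    then show ?thesis using H by (simp add: Aadd)
  qed
  have Bshift: "poly B (x + (a * c + b * d)) = poly B x + d" if "c \<in> Fp" "d \<in> Fp" for c d x
    unfolding polyB Ashift[OF that] using b0 by (simp add: field_simps)
  have Afib: "\<exists>d\<in>Fp. x = \<theta> + b * d" if "poly A x = \<alpha>" for x
  proof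
    let ?y = "x - \<theta>"
    have "poly A (\<theta> + ?y) = poly A \<theta>" using that A\<theta> by simp
    then have "?y ^ p = b ^ (p - 1) * ?y" using H unfolding Aadd by simp
    then have "(?y / b) ^ p = ?y / b"
      using b0 by (simp add: power_divide bp)
    then show "?y / b \<in> Fp" unfolding Fp_iff .
    show "x = \<theta> + b * (?y / b)" using b0 by simp
  qed
  have "pderiv A = [:- (inverse H * b ^ (p - 1)):]"
    by (simp add: A_def pderiv_smult pderiv_diff pderiv_monom pderiv_pCons of_nat_p)
  then have "\<exists>r. r \<noteq> 0 \<and> pderiv A = [:r:]" using H b0 by (intro exI[of _ "- (inverse H * b ^ (p - 1))"]) auto
  then show ?thesis using that A B A\<theta> B\<theta> dA Ashift Bshift Afib by blast
qed

text \<open>What \<theta> = a\<alpha> + b\<beta> becomes when \<alpha> and \<beta> are replaced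
  independently by their Artin-Schreier translates \<alpha> + c and \<beta> + d.\<close>

definition fp_lattice :: "'a \<Rightarrow> 'a \<Rightarrow> 'a \<Rightarrow> 'a set" where
  "fp_lattice a b \<theta> = (\<lambda>(c, d). \<theta> + (a * c + b * d)) ` (Fp \<times> Fp)"

lemma card_fp_lattice:
  assumes ind: "\<And>c d. c \<in> Fp \<Longrightarrow> d \<in> Fp \<Longrightarrow> (c, d) \<noteq> (0, 0) \<Longrightarrow> a * c + b * d \<noteq> (0 :: 'a)"
  shows "finite (fp_lattice a b \<theta>)" "card (fp_lattice a b \<theta>) = p ^ 2"
proof -
  have "inj_on (\<lambda>(c, d). \<theta> + (a * c + b * d)) (Fp \<times> Fp)"
  proof (rule inj_onI, clarsimp)
    fix c d c' d' assume *: "c \<in> Fp" "d \<in> Fp" "c' \<in> Fp" "d' \<in> Fp" "a * c + b * d = a * c' + b * d'"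
    then have "a * (c - c') + b * (d - d') = 0" by (simp add: algebra_simps)
    then show "c = c' \<and> d = d'"
      using ind[of "c - c'" "d - d'"] sf_diff[OF subfield_Fp] * by auto
  qed
  then show "finite (fp_lattice a b \<theta>)" "card (fp_lattice a b \<theta>) = p ^ 2"
    using card_Fp by (auto simp: fp_lattice_def card_image card_cartesian_product power2_eq_square)
qed

text \<open>The differences of roots of the minimal polynomial form a group of pairs \<open>(c, d)\<close> over the prime field. If it is proper, a
  nonzero linear form \<open>kc + ld\<close> vanishes on it, and then \<open>k\<alpha> + l\<beta>\<close> lies in the base field.\<close>

lemma AS_pair_degree:
  assumes E: "subfield E Kbar" and ab: "a \<in> E" "b \<in> E"
    and \<alpha>: "\<alpha> ^ p - \<alpha> \<in> E" and \<beta>: "\<beta> ^ p - \<beta> \<in> E"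
    and ind: "\<And>c d. c \<in> Fp \<Longrightarrow> d \<in> Fp \<Longrightarrow> (c, d) \<noteq> (0, 0) \<Longrightarrow> a * c + b * d \<noteq> 0"
    and ind': "\<And>k l. k \<in> Fp \<Longrightarrow> l \<in> Fp \<Longrightarrow> (k, l) \<noteq> (0, 0) \<Longrightarrow> k * \<alpha> + l * \<beta> \<notin> E"
    and \<theta>: "\<theta> = a * \<alpha> + b * \<beta>" and f: "min_poly E \<theta> f"
  shows "degree f = p ^ 2" "f = (\<Prod>t\<in>#mset_set (fp_lattice a b \<theta>). [:-t, 1:])"
proof -
  obtain A B where AB: "poly_over E A" "poly_over E B" "poly A \<theta> = \<alpha>" "poly B \<theta> = \<beta>" "degree A = p"
    "\<And>c d x. c \<in> Fp \<Longrightarrow> d \<in> Fp \<Longrightarrow> poly A (x + (a * c + b * d)) = poly A x + c"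
    "\<And>c d x. c \<in> Fp \<Longrightarrow> d \<in> Fp \<Longrightarrow> poly B (x + (a * c + b * d)) = poly B x + d"
    "\<And>x. poly A x = \<alpha> \<Longrightarrow> \<exists>d\<in>Fp. x = \<theta> + b * d"
    "\<exists>r. r \<noteq> 0 \<and> pderiv A = [:r:]"
    by (rule AS_pair[OF E ab \<alpha> \<beta> ind \<theta>]) blast+
  note A = AB(1,3,5,6,8,9) and B = AB(2,4,7)
  note fD = min_polyD[OF f]
  define s where "s = \<alpha> ^ p - \<alpha>"
  define g where "g = pcompose (monom 1 p - [:s, 1:]) A"
  have gx: "poly g x = poly A x ^ p - poly A x - s" for x
    by (simp add: g_def poly_pcompose poly_monom)
  have g: "poly_over E g" "poly g \<theta> = 0"
    unfolding gx using \<alpha> by (auto simp: g_def s_def A intro!: poly_over_pcompose poly_over_AS E A(1))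
  have dg: "degree g = p ^ 2"
    unfolding g_def degree_pcompose by (simp add: monic_AS A(3) power2_eq_square)
  then have g0: "g \<noteq> 0" using p_pos by auto
  have dvd: "f dvd g" by (rule min_poly_dvd[OF E f g])
  have "pderiv g = - pderiv A"
    unfolding g_def pderiv_pcompose pderiv_AS by (simp add: pcompose_uminus pcompose_1)
  then have simple: "card {x. poly f x = 0} = degree f"
    using A(6) by (intro card_simple_roots[OF fD(2)] pderiv_dvd_root[OF dvd]) auto
  have roots: "\<exists>c\<in>Fp. \<exists>d\<in>Fp. x = \<theta> + (a * c + b * d)" if "poly f x = 0" for x
  proof -
    have "poly g x = 0" using dvd that by (auto elim: dvdE)
    then have "poly A x - \<alpha> \<in> Fp" unfolding AS_roots[symmetric] gx s_def by simp
    then obtain c where c: "c \<in> Fp" "poly A x = \<alpha> + c" by (metis add_diff_cancel_left' diff_add_cancel add.commute)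
    then have "poly A (x + (a * (- c) + b * 0)) = \<alpha>"
      using A(4)[of "- c" 0 x] sf_minus[OF subfield_Fp] sf_0[OF subfield_Fp] by simp
    then obtain d where "d \<in> Fp" "x + (a * (- c) + b * 0) = \<theta> + b * d" using A(5) by blast
    then show ?thesis using c(1) by (intro bexI[of _ c] bexI[of _ d]) (auto simp: algebra_simps)
  qed
  define J where "J c d \<longleftrightarrow> c \<in> Fp \<and> d \<in> Fp \<and> poly f (\<theta> + (a * c + b * d)) = 0" for c d
  have inE: "a * c + b * d \<in> E" if "c \<in> Fp" "d \<in> Fp" for c d
    using that Fp_subset[OF E] by (intro sf_add sf_mult E ab) auto
  have Jlin: "J (x * c + y * c') (x * d + y * d')" if J: "J c d" "J c' d'" and xy: "x \<in> Fp" "y \<in> Fp" for c d c' d' x y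
  proof -
    obtain m n where mn: "x = of_nat m" "y = of_nat n" using xy by (auto simp: prime_subfield_def)
    have "poly f (\<theta> + of_nat m * (a * c + b * d)) = 0"
      using J by (intro min_poly_shift_mult[OF E f] inE) (auto simp: J_def)
    moreover have "poly f (\<theta> + of_nat n * (a * c' + b * d')) = 0"
      using J by (intro min_poly_shift_mult[OF E f] inE) (auto simp: J_def)
    moreover have "of_nat n * (a * c' + b * d') \<in> E"
      using J by (intro sf_mult sf_of_nat E inE) (auto simp: J_def)
    ultimately have "poly f (\<theta> + of_nat m * (a * c + b * d) + of_nat n * (a * c' + b * d')) = 0"
      using min_poly_shift[OF E f] by blast
    moreover have "x * c + y * c' \<in> Fp" "x * d + y * d' \<in> Fp"
      using J xy by (auto simp: J_def intro!: sf_add sf_mult subfield_Fp)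
    ultimately show ?thesis by (simp add: J_def mn algebra_simps)
  qed
  have "\<exists>c d c' d'. J c d \<and> J c' d' \<and> c * d' \<noteq> c' * d"
  proof (rule ccontr)
    assume "\<not> ?thesis"
    then have par: "\<And>c d c' d'. J c d \<Longrightarrow> J c' d' \<Longrightarrow> c * d' = c' * d" by blast
    have "\<exists>k\<in>Fp. \<exists>l\<in>Fp. (k, l) \<noteq> (0, 0) \<and> (\<forall>c d. J c d \<longrightarrow> k * c + l * d = 0)"
    proof (cases "\<exists>c d. J c d \<and> (c, d) \<noteq> (0, 0)")
      case True
      then obtain c d where cd: "J c d" "(c, d) \<noteq> (0, 0)" by blast
      have "d * c' + (- c) * d' = 0" if "J c' d'" for c' d'
        using par[OF cd(1) that] by (simp add: mult.commute)
      then show ?thesis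
        using cd sf_minus[OF subfield_Fp]
        by (intro bexI[of _ d] bexI[of _ "- c"]) (auto simp: J_def)
    next
      case False
      have "1 * c + 1 * d = 0" if "J c d" for c d
      proof -
        have "c = 0 \<and> d = 0" using False that by blast
        then show ?thesis by simp
      qed
      moreover have "(1 :: 'a) \<in> Fp" by (rule sf_1[OF subfield_Fp])
      ultimately show ?thesis
        by (intro bexI[of _ 1]) auto
    qed
    then obtain k l where kl: "k \<in> Fp" "l \<in> Fp" "(k, l) \<noteq> (0, 0)" "\<And>c d. J c d \<Longrightarrow> k * c + l * d = 0"
      by blast
    define P where "P = smult k A + smult l B"
    have P: "poly_over E P"
      unfolding P_def using Fp_subset[OF E] kl by (intro poly_over_add poly_over_smult A B E) auto
    define \<kappa> where "\<kappa> = k * \<alpha> + l * \<beta>"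
    have Px: "poly P x = \<kappa>" if fx: "poly f x = 0" for x
    proof -
      obtain c d where cd: "c \<in> Fp" "d \<in> Fp" "x = \<theta> + (a * c + b * d)" using roots[OF fx] by blast
      then have "J c d" using fx by (simp add: J_def)
      have "poly P x = \<kappa> + (k * c + l * d)"
        unfolding P_def cd(3) using A(4)[OF cd(1,2)] B(3)[OF cd(1,2)] A(2) B(2)
        by (simp add: \<kappa>_def algebra_simps)
      then show ?thesis using kl(4)[OF \<open>J c d\<close>] by simp
    qed
    \<comment> \<open>The remainder has degree below that of \<open>f\<close> but takes the value
      \<kappa> at all the distinct roots of \<open>f\<close>. It is therefore the constant \<kappa>,
      which puts \<kappa> into \<open>E\<close>.\<close>
    define r where "r = P mod f"
    have r: "poly_over E r" unfolding r_def by (rule poly_over_div_mod(2)[OF E P fD(1)])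
    have rx: "poly r x = \<kappa>" if "poly f x = 0" for x
    proof -
      have "poly P x = poly (P div f * f + r) x" unfolding r_def by simp
      then show ?thesis using Px[OF that] that by simp
    qed
    have "r = [:\<kappa>:]"
    proof (rule ccontr)
      assume "r \<noteq> [:\<kappa>:]"
      then have nz: "r - [:\<kappa>:] \<noteq> 0" by simp
      have "degree r < degree f"
        unfolding r_def using degree_mod_less[of f P] fD(4) min_poly_degree_pos[OF f] by auto
      then have "degree (r - [:\<kappa>:]) < degree f"
        using min_poly_degree_pos[OF f] by (intro degree_diff_less) auto
      moreover have "card {x. poly f x = 0} \<le> card {x. poly (r - [:\<kappa>:]) x = 0}"
        by (intro card_mono poly_roots_finite nz) (auto simp: rx)
      ultimately show False using card_poly_roots_bound[OF nz] simple by linarith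
    qed
    then have "\<kappa> \<in> E" using poly_over_coeff[OF r, of 0] by simp
    then show False using ind'[OF kl(1-3)] by (simp add: \<kappa>_def)
  qed
  then obtain c d c' d' where J: "J c d" "J c' d'" "c * d' \<noteq> c' * d" by blast
  define D where "D = c * d' - c' * d"
  have D: "D \<noteq> 0" "D \<in> Fp" using J by (auto simp: D_def J_def intro!: sf_diff sf_mult subfield_Fp)
  have "J x y" if xy: "x \<in> Fp" "y \<in> Fp" for x y
  proof -
    \<comment> \<open>Cramer's rule: the coefficients express (x, y) in the basis (c, d), (c',
      d').\<close>
    have "J ((x * d' - y * c') / D * c + (y * c - x * d) / D * c') ((x * d' - y * c') / D * d + (y * c - x * d) / D * d')"
      using J D xy by (intro Jlin) (auto simp: J_def intro!: sf_divide sf_diff sf_mult subfield_Fp)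
    moreover have "(x * d' - y * c') / D * c + (y * c - x * d) / D * c' = x * D / D"
      by (simp only: times_divide_eq_left flip: add_divide_distrib) (simp add: D_def algebra_simps)
    moreover have "(x * d' - y * c') / D * d + (y * c - x * d) / D * d' = y * D / D"
      by (simp only: times_divide_eq_left flip: add_divide_distrib) (simp add: D_def algebra_simps)
    ultimately show ?thesis using D by simp
  qed
  then have all: "\<And>x. x \<in> fp_lattice a b \<theta> \<Longrightarrow> poly f x = 0"
    by (auto simp: fp_lattice_def J_def)
  have "fp_lattice a b \<theta> \<subseteq> {x. poly f x = 0}" using all by auto
  then have "card (fp_lattice a b \<theta>) \<le> card {x. poly f x = 0}"
    by (intro card_mono poly_roots_finite fD(4))
  then have "p ^ 2 \<le> degree f" using simple card_fp_lattice(2)[OF ind] by simp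
  moreover have "degree f \<le> p ^ 2" using fD(5)[OF g g0] dg by simp
  ultimately show d: "degree f = p ^ 2" by simp
  show "f = (\<Prod>t\<in>#mset_set (fp_lattice a b \<theta>). [:-t, 1:])"
    by (rule monic_eq_prod_roots[OF fD(2) _ _ all]) (use d card_fp_lattice[OF ind] in auto)
qed

end

section \<open>Approximation of \<open>\<theta>\<close> by elements of small degree\<close>

locale valued_char = ultrametric ty N + alg_closed_char ty p
  for ty :: "'a::field itself" and N and p +
  fixes K :: "'a set"
  assumes K: "subfield K Kbar"
    and K_algebraic: "\<And>x. \<exists>g. poly_over K g \<and> g \<noteq> 0 \<and> poly g x = 0"
begin

abbreviation C :: "'a set" where "C \<equiv> cl K"

sublocale closed_subfield ty N C
proof (intro closed_subfield.intro closed_subfield_axioms.intro)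
  show "ultrametric N" by (rule ultrametric_axioms)
  show "subfield C Kbar" by (rule subfield_cl[OF K])
  show "cl C = C" by (rule cl_cl)
  show "\<exists>g. poly_over C g \<and> g \<noteq> 0 \<and> poly g x = 0" for x
    using K_algebraic[of x] poly_over_mono[OF _ subset_cl] by blast
qed

lemma K_min_poly: "\<exists>f. min_poly K x f"
  using K_algebraic min_poly_exists[OF K] by blast

lemma mdeg_C_le: "mdeg C x \<le> mdeg K x"
proof -
  obtain f where f: "min_poly K x f" using K_min_poly by blast
  then show ?thesis
    using mdeg_le[OF C(1) poly_over_mono[OF min_polyD(1)[OF f] subset_cl]] min_polyD(3,4)[OF f] mdeg_eq[OF K f]
    by simp
qed

lemma mdeg_pos: "0 < mdeg K x" "0 < mdeg C x"
proof -
  obtain f g where "min_poly K x f" "min_poly C x g" using K_min_poly C_min_poly by blast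
  then show "0 < mdeg K x" "0 < mdeg C x"
    using mdeg_eq[OF K] mdeg_eq[OF C(1)] min_poly_degree_pos by metis+
qed

lemma mdeg_1_iff: "mdeg K x = 1 \<longleftrightarrow> x \<in> K"
proof -
  obtain f where "min_poly K x f" using K_min_poly by blast
  then show ?thesis using min_poly_degree_1_iff[OF K] mdeg_eq[OF K] by metis
qed

lemma approximate_element:
  assumes "R > 0"
  shows "\<exists>x'. N (x - x') \<le> R \<and> mdeg K x' \<le> mdeg C x"
proof -
  obtain f where f: "min_poly C x f" using C_min_poly by blast
  obtain x' h where "N (x - x') \<le> R" "poly_over K h" "h \<noteq> 0" "degree h = degree f" "poly h x' = 0"
    using approximate_root[OF K min_polyD(1-3)[OF f] min_poly_degree_pos[OF f] assms] by blast
  then show ?thesis using mdeg_le[OF K] C_mdeg[OF f] by metis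
qed

text \<open>The valuation-theoretic hypotheses in terms of the norm: \<open>far\<close> is what the
  defects yield, and \<open>cut\<close> says that a\<alpha> comes closer to \<open>K\<close> than
  b\<beta> ever does.\<close>

context
  fixes a b \<alpha> \<beta> \<theta>
  assumes ab: "a \<in> K" "b \<in> K"
    and \<alpha>: "\<alpha> ^ p - \<alpha> \<in> K" and \<beta>: "\<beta> ^ p - \<beta> \<in> K"
    and N_ind: "\<And>c d. c \<in> Fp \<Longrightarrow> d \<in> Fp \<Longrightarrow> (c, d) \<noteq> (0, 0) \<Longrightarrow> N (a * c + b * d) = 1"
    and far: "\<And>c. c \<in> K \<Longrightarrow> 1 < N (\<alpha> - c)" "\<And>c. c \<in> K \<Longrightarrow> 1 < N (\<beta> - c)"
    and cut: "\<exists>c\<in>K. \<forall>c'\<in>K. N (a * \<alpha> - c) < N (b * \<beta> - c')"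
    and \<theta>: "\<theta> = a * \<alpha> + b * \<beta>"
begin

lemma Fp_01: "0 \<in> Fp" "1 \<in> Fp"
  using sf_0[OF subfield_Fp] sf_1[OF subfield_Fp] by auto

lemma N_a: "N a = 1" and N_b: "N b = 1"
  using N_ind[of 1 0] N_ind[of 0 1] Fp_01 by auto

lemma ab_nonzero: "a \<noteq> 0" "b \<noteq> 0"
  using N_a N_b by auto

lemma ind: "c \<in> Fp \<Longrightarrow> d \<in> Fp \<Longrightarrow> (c, d) \<noteq> (0, 0) \<Longrightarrow> a * c + b * d \<noteq> 0"
  using N_ind[of c d] by (metis N_0 zero_neq_one)

lemma N_Fp: "c \<in> Fp \<Longrightarrow> c \<noteq> 0 \<Longrightarrow> N c = 1"
  using N_ind[of c 0] Fp_01 N_a by (simp add: N_mult)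

lemma far_scaled:
  assumes far: "\<And>c. c \<in> K \<Longrightarrow> 1 < N (\<gamma> - c)" and t: "t \<in> K" "N t = 1" and c: "c \<in> K"
  shows "1 < N (t * \<gamma> - c)"
proof -
  have "t \<noteq> 0" using t by auto
  then have "t * \<gamma> - c = t * (\<gamma> - c / t)" by (simp add: right_diff_distrib)
  then have "N (t * \<gamma> - c) = N (\<gamma> - c / t)" using t by (simp add: N_mult)
  then show ?thesis using far[of "c / t"] sf_divide[OF K c t(1)] by simp
qed

text \<open>Take \<open>e\<close> in \<open>K\<close> approximating a\<alpha> better than any
  element approximates b\<beta>. In \<theta> - c = (a\<alpha> - e) + (b\<beta> - (c - e)) the second
  summand then dominates.\<close>

lemma closest: "\<exists>e\<in>K. \<forall>c\<in>K. N (\<theta> - (b * \<beta> + e)) < N (b * \<beta> - c) \<and> N (\<theta> - c) = N (b * \<beta> - (c - e))"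
proof -
  obtain e where e: "e \<in> K" "\<And>c. c \<in> K \<Longrightarrow> N (a * \<alpha> - e) < N (b * \<beta> - c)" using cut by blast
  have "N (\<theta> - c) = N (b * \<beta> - (c - e))" if "c \<in> K" for c
    using N_add_eq[OF e(2)[of "c - e"]] sf_diff[OF K that e(1)] by (simp add: \<theta> algebra_simps)
  moreover have "\<theta> - (b * \<beta> + e) = a * \<alpha> - e" by (simp add: \<theta>)
  ultimately show ?thesis using e by (intro bexI[of _ e] ballI conjI) (simp_all only:)
qed

lemma far_\<theta>: "c \<in> K \<Longrightarrow> 1 < N (\<theta> - c)"
  using closest far_scaled[OF far(2) ab(2) N_b] sf_diff[OF K] by metis

text \<open>Otherwise, up to scalars, \<open>\<alpha>\<close> and \<open>\<beta>\<close> would have the same distances from \<open>K\<close>.\<close>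

lemma combination_notin_C:
  assumes kl: "k \<in> Fp" "l \<in> Fp" "(k, l) \<noteq> (0, 0)"
  shows "k * \<alpha> + l * \<beta> \<notin> C"
proof
  assume "k * \<alpha> + l * \<beta> \<in> C"
  then obtain e where e: "e \<in> K" "N (k * \<alpha> + l * \<beta> - e) < 1"
    using cl_D[of _ K 1] by auto
  have klK: "k \<in> K" "l \<in> K" using kl Fp_subset[OF K] by auto
  consider "l = 0" "k \<noteq> 0" | "k = 0" "l \<noteq> 0" | "k \<noteq> 0" "l \<noteq> 0" using kl by auto
  then show False
  proof cases
    case 1
    then show False using far_scaled[OF far(1) klK(1) _ e(1)] N_Fp[OF kl(1)] e by simp
  next
    case 2
    then show False using far_scaled[OF far(2) klK(2) _ e(1)] N_Fp[OF kl(2)] e by simp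
  next
    case 3
    \<comment> \<open>Multiplication by \<open>u\<close> turns the combination into a\<alpha> +
      t(b\<beta>), the terms compared by \<open>cut\<close>; both \<open>u\<close> and
      \<open>t\<close> have norm 1, so no distance changes.\<close>
    define u where "u = a / k"
    have u: "u \<in> K" "N u = 1" "u \<noteq> 0"
      unfolding u_def using sf_divide[OF K ab(1) klK(1)] N_a N_Fp[OF kl(1)] 3 ab_nonzero by (auto simp: N_divide)
    define t where "t = u * l / b"
    have t: "t \<in> K" "N t = 1" "t \<noteq> 0"
      unfolding t_def using u sf_divide[OF K sf_mult[OF K u(1) klK(2)] ab(2)] N_b N_Fp[OF kl(2)] 3 ab_nonzero
      by (auto simp: N_divide N_mult)
    have small: "N (a * \<alpha> + t * (b * \<beta>) - u * e) < 1"
    proof -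
      have "a * \<alpha> + t * (b * \<beta>) - u * e = u * (k * \<alpha> + l * \<beta> - e)"
        using 3 ab_nonzero by (simp add: t_def u_def field_simps)
      then show ?thesis using e u by (simp add: N_mult)
    qed
    obtain c where c: "c \<in> K" "\<And>c'. c' \<in> K \<Longrightarrow> N (a * \<alpha> - c) < N (b * \<beta> - c')" using cut by blast
    \<comment> \<open>With this choice t(b\<beta> - c') is the small element minus (a\<alpha> - c).
      Its norm exceeds 1 by \<open>far\<close> and exceeds that of a\<alpha> - c by
      \<open>cut\<close>, which contradicts the ultrametric inequality.\<close>
    define c' where "c' = (u * e - c) / t"
    have c': "c' \<in> K" unfolding c'_def by (intro sf_divide sf_diff sf_mult K u e c t)
    have "t * (b * \<beta> - c') = (a * \<alpha> + t * (b * \<beta>) - u * e) - (a * \<alpha> - c)"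
    proof -
      have "t * c' = u * e - c" using t by (simp add: c'_def)
      then show ?thesis by (simp add: algebra_simps)
    qed
    then have eq: "N (b * \<beta> - c') = N ((a * \<alpha> + t * (b * \<beta>) - u * e) - (a * \<alpha> - c))"
      using t N_mult[of t "b * \<beta> - c'"] by simp
    also have "\<dots> \<le> max (N (a * \<alpha> + t * (b * \<beta>) - u * e)) (N (a * \<alpha> - c))" by (rule N_diff)
    finally show False
      using small c(2)[OF c'] far_scaled[OF far(2) ab(2) N_b c'] by simp
  qed
qed

lemma combination_notin_K: "k \<in> Fp \<Longrightarrow> l \<in> Fp \<Longrightarrow> (k, l) \<noteq> (0, 0) \<Longrightarrow> k * \<alpha> + l * \<beta> \<notin> K"
  using combination_notin_C subset_cl by blast

lemma min_poly_\<theta>: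
  assumes "min_poly K \<theta> f"
  shows "degree f = p ^ 2" "f = (\<Prod>t\<in>#mset_set (fp_lattice a b \<theta>). [:-t, 1:])"
  using AS_pair_degree[OF K ab \<alpha> \<beta> ind combination_notin_K \<theta> assms] by auto

lemma mdeg_\<theta>: "mdeg K \<theta> = p ^ 2"
  using K_min_poly min_poly_\<theta>(1) mdeg_eq[OF K] by metis

lemma min_poly_C_\<theta>: "min_poly C \<theta> (\<Prod>t\<in>#mset_set (fp_lattice a b \<theta>). [:-t, 1:])"
proof -
  obtain f where f: "min_poly C \<theta> f" using C_min_poly by blast
  have "a \<in> C" "b \<in> C" "\<alpha> ^ p - \<alpha> \<in> C" "\<beta> ^ p - \<beta> \<in> C" using ab \<alpha> \<beta> subset_cl by auto
  from AS_pair_degree(2)[OF C(1) this ind combination_notin_C \<theta> f] f show ?thesis by simp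
qed

lemma lattice_dist:
  assumes "s \<in> fp_lattice a b \<theta>" "t \<in> fp_lattice a b \<theta>" "s \<noteq> t"
  shows "N (s - t) = 1"
proof -
  obtain c d c' d' where *: "c \<in> Fp" "d \<in> Fp" "c' \<in> Fp" "d' \<in> Fp"
    "s = \<theta> + (a * c + b * d)" "t = \<theta> + (a * c' + b * d')"
    using assms by (auto simp: fp_lattice_def)
  then have "s - t = a * (c - c') + b * (d - d')" by (simp add: algebra_simps)
  moreover have "(c - c', d - d') \<noteq> (0, 0)" using * assms(3) by auto
  ultimately show ?thesis using N_ind[of "c - c'" "d - d'"] sf_diff[OF subfield_Fp] * by simp
qed

lemma \<theta>_in_lattice: "\<theta> \<in> fp_lattice a b \<theta>"
  unfolding fp_lattice_def using Fp_01 by (intro image_eqI[of _ _ "(0, 0)"]) auto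

lemma mdeg_shifted_\<beta>: "e \<in> K \<Longrightarrow> mdeg K (b * \<beta> + e) = p"
proof -
  assume e: "e \<in> K"
  obtain f where f: "min_poly K \<beta> f" using K_min_poly by blast
  have "\<beta> \<notin> K" using combination_notin_K[of 0 1] Fp_01 by auto
  then have "mdeg K \<beta> = p" using AS_degree[OF K _ \<beta> f] mdeg_eq[OF K f] by simp
  then show ?thesis using mdeg_affine[OF K K_algebraic ab(2) ab_nonzero(2) e] by simp
qed

lemma good_approximation:
  "\<exists>y. mdeg K y = p \<and> (\<forall>c\<in>K. N (\<theta> - y) < N (\<theta> - c))"
proof -
  obtain e where e: "e \<in> K" "\<And>c. c \<in> K \<Longrightarrow> N (\<theta> - (b * \<beta> + e)) < N (b * \<beta> - c)"
    "\<And>c. c \<in> K \<Longrightarrow> N (\<theta> - c) = N (b * \<beta> - (c - e))" using closest by blast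
  then have "N (\<theta> - (b * \<beta> + e)) < N (\<theta> - c)" if "c \<in> K" for c
    using that sf_diff[OF K that e(1)] by simp
  then show ?thesis using mdeg_shifted_\<beta>[OF e(1)] by blast
qed

lemma degree_p_approximation:
  assumes x: "N (\<theta> - x) \<le> R" "mdeg K x < p ^ 2" and R: "1 \<le> R"
  shows "\<exists>y. N (\<theta> - y) \<le> R \<and> mdeg K y \<le> mdeg K x \<and> (mdeg K y = 1 \<or> mdeg K y = p)"
proof -
  have "N (x - \<theta>) \<le> R" using x(1) by (simp add: N_minus_commute)
  then obtain z where z: "N (z - \<theta>) \<le> R" "\<And>y. N (y - \<theta>) \<le> R \<Longrightarrow> mdeg C z \<le> mdeg C y"
    using ex_has_least_nat[of "\<lambda>y. N (y - \<theta>) \<le> R" x "mdeg C"] by blast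
  have zx: "mdeg C z \<le> mdeg K x"
    using z(2)[of x] x(1) mdeg_C_le[of x] by (simp add: N_minus_commute)
  let ?\<Theta> = "mset_set (fp_lattice a b \<theta>)"
  have fin: "finite (fp_lattice a b \<theta>)" by (rule card_fp_lattice(1)[OF ind])
  have d: "p dvd (mdeg C z choose q)" if "0 < q" "q < mdeg C z" for q
  proof -
    have "CHAR('a) dvd (mdeg C z choose q)"
    proof (rule min_degree_in_disc[OF _ min_polyD(1)[OF min_poly_C_\<theta>] _ _ _ z that])
      show "prime CHAR('a)" using p by simp
      show "?\<Theta> \<noteq> {#}" using fin \<theta>_in_lattice by (auto simp: mset_set_empty_iff)
      show "0 \<le> R" using R by simp
      show "N (t - \<theta>) \<le> R" if "t \<in># ?\<Theta>" for t
      proof (cases "t = \<theta>")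
        case True
        then show ?thesis using R by simp
      next
        case False
        have "t \<in> fp_lattice a b \<theta>" using that fin by simp
        then show ?thesis using lattice_dist[OF _ \<theta>_in_lattice False] R by simp
      qed
    qed
    then show ?thesis using p(2) by simp
  qed
  have mz: "mdeg C z = 1 \<or> mdeg C z = p"
  proof (rule ccontr)
    assume "\<not> ?thesis"
    then have "1 < mdeg C z" "mdeg C z \<noteq> p" using mdeg_pos(2)[of z] by auto
    then show False using binomial_nonzero_mod_prime[OF p(1), of "mdeg C z"] d zx x(2) by auto
  qed
  \<comment> \<open>As \<open>y\<close> again lies in the disc and its degree over \<open>C\<close>
    is at most that over \<open>K\<close>, minimality of \<open>z\<close> turns the inequality of
    degrees into an equality.\<close>
  obtain y where y: "N (z - y) \<le> R" "mdeg K y \<le> mdeg C z"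
    using approximate_element[of R z] R by auto
  have yR: "N (\<theta> - y) \<le> R"
    using N_triangle[of \<theta> y z] y(1) z(1) by (auto simp: N_minus_commute)
  have "mdeg C z \<le> mdeg K y"
    using z(2)[of y] yR mdeg_C_le[of y] by (simp add: N_minus_commute)
  then show ?thesis using y zx mz yR by (intro exI[of _ y]) auto
qed

lemma no_approximation_below_p:
  assumes "mdeg K x < p"
  shows "\<exists>c\<in>K. N (\<theta> - c) \<le> N (\<theta> - x)"
proof -
  \<comment> \<open>The disc must have radius at least 1 to contain the conjugates of \<theta>. The
    element of \<open>K\<close> found in it is at distance more than 1 from \<theta>, so the bound
    by N (\<theta> - x) is recovered.\<close>
  define R where "R = max 1 (N (\<theta> - x))"
  have "p < p ^ 2" using p_gt_1 by (simp add: power2_eq_square)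
  then obtain y where y: "N (\<theta> - y) \<le> R" "mdeg K y \<le> mdeg K x" "mdeg K y = 1 \<or> mdeg K y = p"
    using degree_p_approximation[of x R] assms unfolding R_def by auto
  then have "y \<in> K" using assms mdeg_1_iff by auto
  moreover from this have "1 < N (\<theta> - y)" by (rule far_\<theta>)
  ultimately show ?thesis using y(1) by (intro bexI[of _ y]) (auto simp: R_def)
qed

lemma no_approximation_below_p2:
  assumes x: "mdeg K x < p ^ 2"
  shows "\<exists>y. mdeg K y = p \<and> N (\<theta> - y) \<le> N (\<theta> - x)"
proof (cases "N (\<theta> - x) < 1")
  case True
  have "card (fp_lattice a b \<theta>) \<le> mdeg C x"
    by (rule krasner_degree[OF _ \<theta>_in_lattice min_poly_C_\<theta> lattice_dist])
      (use True card_fp_lattice(1)[OF ind] in \<open>auto simp: N_minus_commute\<close>)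
  then show ?thesis using x mdeg_C_le[of x] card_fp_lattice(2)[OF ind, of \<theta>] by simp
next
  case False
  then obtain y where y: "N (\<theta> - y) \<le> N (\<theta> - x)" "mdeg K y = 1 \<or> mdeg K y = p"
    using degree_p_approximation[of x "N (\<theta> - x)"] x by auto
  obtain w where w: "mdeg K w = p" "\<forall>c\<in>K. N (\<theta> - w) < N (\<theta> - c)" using good_approximation by blast
  show ?thesis
  proof (cases "mdeg K y = p")
    case False
    then have "N (\<theta> - w) < N (\<theta> - y)" using w y mdeg_1_iff by auto
    then show ?thesis using w y by (intro exI[of _ w]) auto
  qed (use y in blast)
qed

end

end

section \<open>Rank one valuations as real norms\<close>

locale valued_field =
  fixes v :: "'a::field \<Rightarrow> 'g::linordered_ab_group_add extended"
  assumes v: "valuation v"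
begin

lemma v_not_Minf [simp]: "v x \<noteq> -\<infinity>" and v_eq_Pinf [simp]: "v x = \<infinity> \<longleftrightarrow> x = 0"
  and v_mult: "v (x * y) = v x + v y" and v_add: "min (v x) (v y) \<le> v (x + y)"
  using v by (auto simp: valuation_def)

lemma v_Fin: "x \<noteq> 0 \<Longrightarrow> \<exists>g. v x = Fin g"
  by (cases "v x") auto

lemma v_0 [simp]: "v 0 = \<infinity>"
  by simp

lemma v_1 [simp]: "v 1 = 0"
proof -
  obtain g where g: "v 1 = Fin g" using v_Fin by fastforce
  then have "Fin g = Fin (g + g)" using v_mult[of 1 1] by simp
  then show ?thesis using g by (simp add: zero_extended_def)
qed

lemma v_mono: "v x \<le> v y \<Longrightarrow> v x' \<le> v y' \<Longrightarrow> v (x * x') \<le> v (y * y')"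
  unfolding v_mult by (rule add_mono)

lemma v_cancel: "z \<noteq> 0 \<Longrightarrow> v (x * z) \<le> v (y * z) \<longleftrightarrow> v x \<le> v y"
  using v_mono[of "x * z" "y * z" "inverse z" "inverse z"] v_mono[of x y z z]
  by (auto simp: mult.assoc)

lemma v_power_mono: "v x \<le> v y \<Longrightarrow> v (x ^ n) \<le> v (y ^ n)"
  by (induct n) (auto intro: v_mono)

lemma v_strict_mono:
  assumes "v x < v y" "v x' \<le> v y'" "x' \<noteq> 0"
  shows "v (x * x') < v (y * y')"
proof -
  have "\<not> v (y * x') \<le> v (x * x')" using v_cancel[OF assms(3)] assms(1) by simp
  moreover have "v (y * x') \<le> v (y * y')" using assms(2) by (intro v_mono) auto
  ultimately show ?thesis by auto
qed

lemma v_power_cancel: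
  assumes "n > 0" "v (x ^ n) \<le> v (y ^ n)" "x \<noteq> 0" "y \<noteq> 0"
  shows "v x \<le> v y"
proof (rule ccontr)
  assume "\<not> v x \<le> v y"
  then have less: "v y < v x" by simp
  have "v (y ^ Suc m) < v (x ^ Suc m)" for m
  proof (induct m)
    case (Suc m)
    show ?case
      unfolding power_Suc[of _ "Suc m"]
      by (rule v_strict_mono[OF less]) (use Suc assms in auto)
  qed (use less in simp)
  then show False using assms(1,2) by (metis Suc_pred not_le)
qed

lemma v_uminus: "v (- x) = v x"
proof -
  have "v ((- 1) ^ 2) = v (1 ^ 2)" by simp
  then have "v (- 1) = v 1"
    using v_power_cancel[of 2 "- 1" 1] v_power_cancel[of 2 1 "- 1"] by force
  then show ?thesis using v_mult[of "- 1" x] by simp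
qed

lemma v_add_eq: "v x < v y \<Longrightarrow> v (x + y) = v x"
  using v_add[of x y] v_add[of "x + y" "- y"] v_uminus[of y]
  by (auto simp: min_def split: if_splits)

text \<open>Applied in contrapositive form: a vanishing sum of nonzero terms must contain two terms
  of equal value.\<close>

lemma two_equal_values:
  assumes "finite A" "A \<noteq> {}" "\<And>i. i \<in> A \<Longrightarrow> t i \<noteq> 0" "inj_on (\<lambda>i. v (t i)) A"
  shows "\<exists>i\<in>A. v (\<Sum>i\<in>A. t i) = v (t i)"
  using assms
proof (induct A rule: finite_ne_induct)
  case (insert x A)
  then obtain i where i: "i \<in> A" "v (\<Sum>i\<in>A. t i) = v (t i)" by auto
  then have "v (t x) \<noteq> v (t i)" using insert by (auto simp: inj_on_def)
  then consider "v (t x) < v (\<Sum>i\<in>A. t i)" | "v (\<Sum>i\<in>A. t i) < v (t x)" using i by fastforce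
  then show ?case
  proof cases
    case 1
    then show ?thesis using insert v_add_eq[OF 1] by simp
  next
    case 2
    then show ?thesis using insert i v_add_eq[OF 2] by (auto simp: add.commute)
  qed
qed auto

text \<open>In an algebraic equation for \<open>x\<close> two terms have the same value, and
  dividing them leaves a power of \<open>x\<close> with a value from \<open>K\<close>.\<close>

lemma value_torsion:
  assumes K: "subfield K Kbar" and g: "poly_over K g" "g \<noteq> 0" "poly g x = 0" and x: "x \<noteq> 0"
  shows "\<exists>n k. n > 0 \<and> k \<in> K \<and> k \<noteq> 0 \<and> v (x ^ n) = v k"
proof -
  define A where "A = {i. i \<le> degree g \<and> coeff g i \<noteq> 0}"
  have A: "finite A" "A \<noteq> {}" using g(2) by (auto simp: A_def intro!: exI[of _ "degree g"])
  define t where "t i = coeff g i * x ^ i" for i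
  have t: "t i \<noteq> 0" if "i \<in> A" for i using that x by (auto simp: A_def t_def)
  have "(\<Sum>i\<in>A. t i) = poly g x"
    unfolding poly_altdef t_def A_def by (rule sum.mono_neutral_left) auto
  then have sum0: "(\<Sum>i\<in>A. t i) = 0" using g(3) by simp
  have "\<not> inj_on (\<lambda>i. v (t i)) A"
  proof
    assume "inj_on (\<lambda>i. v (t i)) A"
    then obtain i where i: "i \<in> A" "v (\<Sum>i\<in>A. t i) = v (t i)"
      using two_equal_values[of A t, OF A t] by blast
    then have "v (t i) = \<infinity>" unfolding sum0 by simp
    then show False using t[OF i(1)] by simp
  qed
  then obtain i j where "i \<in> A" "j \<in> A" "i \<noteq> j" "v (t i) = v (t j)"
    unfolding inj_on_def by blast
  then obtain i j where ij: "i \<in> A" "j \<in> A" "i < j" "v (t i) = v (t j)"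
    by (metis linorder_neqE_nat)
  let ?a = "coeff g i" and ?b = "coeff g j"
  have ab: "?a \<noteq> 0" "?b \<noteq> 0" "?a \<in> K" "?b \<in> K" using ij poly_over_coeff[OF g(1)] by (auto simp: A_def)
  have "x ^ j = x ^ (j - i) * x ^ i" using ij(3) by (simp flip: power_add)
  then have "x ^ (j - i) * (?b * x ^ i) = t j" "?a / ?b * (?b * x ^ i) = t i"
    using ab by (simp_all add: t_def)
  then have eq: "v (x ^ (j - i) * (?b * x ^ i)) = v (?a / ?b * (?b * x ^ i))" using ij(4) by simp
  have "?b * x ^ i \<noteq> 0" using ab x by simp
  note cancel = v_cancel[OF this]
  have "v (x ^ (j - i)) = v (?a / ?b)"
    using eq cancel[of "x ^ (j - i)" "?a / ?b"] cancel[of "?a / ?b" "x ^ (j - i)"]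
    by (metis order_antisym order_refl)
  then show ?thesis using ij(3) ab sf_divide[OF K] by (intro exI[of _ "j - i"] exI[of _ "?a / ?b"]) auto
qed

end

locale rank_one_valued_field = valued_field v for v :: "'a::field \<Rightarrow> 'g::linordered_ab_group_add extended" +
  fixes K :: "'a set"
  assumes K: "subfield K Kbar" and rank: "rank_one v K"
    and K_algebraic: "\<And>x. \<exists>g. poly_over K g \<and> g \<noteq> 0 \<and> poly g x = 0"
begin

text \<open>The values bounded in absolute value by multiples of v u form a convex subgroup
  containing v u. Since {0} already is the unique proper convex subgroup, this one is the whole
  value group.\<close>

lemma value_group_bounded:
  assumes u: "u \<in> K" "0 < v u" "u \<noteq> 0" and k: "k \<in> K" "k \<noteq> 0"
  shows "\<exists>n. v k \<le> v (u ^ n)"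
proof -
  define G where "G = value_group v K"
  \<comment> \<open>The two conditions on \<open>k\<close> say that v k lies between -n (v u) and n
    (v u), written without multiples and negatives in the extended group.\<close>
  define H where "H = {h. \<exists>k\<in>K. v k = Fin h \<and> (\<exists>n. v 1 \<le> v (k * u ^ n) \<and> v k \<le> v (u ^ n))}"
  have zero: "0 \<in> G" unfolding G_def value_group_def using v_1 sf_1[OF K]
    by (auto simp: zero_extended_def intro!: bexI[of _ 1])
  have diff: "h - h' \<in> G" if "h \<in> G" "h' \<in> G" for h h'
  proof -
    obtain k k' where k: "k \<in> K" "v k = Fin h" "k' \<in> K" "v k' = Fin h'"
      using \<open>h \<in> G\<close> \<open>h' \<in> G\<close> by (auto simp: G_def value_group_def)
    have "k' \<noteq> 0" using k by auto
    then have "v k = v (k / k') + v k'" "k / k' \<noteq> 0" using k v_mult[of "k / k'" k'] by auto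
    then have "v (k / k') = Fin (h - h')" using k v_Fin[of "k / k'"] by auto
    then show ?thesis using sf_divide[OF K k(1,3)] by (auto simp: G_def value_group_def)
  qed
  have pow: "v 1 \<le> v (u ^ n)" for n using v_power_mono[of 1 u n] u(2) by simp
  have conv0: "convex_subgroup {0} G"
    unfolding convex_subgroup_def using zero by auto
  have convH: "convex_subgroup H G"
    unfolding convex_subgroup_def
  proof (intro conjI ballI impI)
    show "H \<subseteq> G" by (auto simp: H_def G_def value_group_def)
    show "0 \<in> H" unfolding H_def using v_1 sf_1[OF K]
      by (auto simp: zero_extended_def intro!: bexI[of _ 1] exI[of _ 0])
  next
    fix h h' assume "h \<in> H" "h' \<in> H"
    then obtain k n k' n' where k: "k \<in> K" "v k = Fin h" "v 1 \<le> v (k * u ^ n)" "v k \<le> v (u ^ n)"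
      and k': "k' \<in> K" "v k' = Fin h'" "v 1 \<le> v (k' * u ^ n')" "v k' \<le> v (u ^ n')"
      unfolding H_def by blast
    have k'0: "k' \<noteq> 0" using k' by auto
    have "v k = v (k / k') + v k'" "k / k' \<noteq> 0" using k k'0 v_mult[of "k / k'" k'] by auto
    then have 1: "v (k / k') = Fin (h - h')" using k k' v_Fin[of "k / k'"] by auto
    have "v (1 * k') \<le> v (k * u ^ n * u ^ n')" by (intro v_mono k k')
    also have "k * u ^ n * u ^ n' = k / k' * u ^ (n + n') * k'" using k'0 by (simp add: power_add)
    finally have 2: "v 1 \<le> v (k / k' * u ^ (n + n'))" using v_cancel[OF k'0] by blast
    have "v (k * 1) \<le> v (u ^ n * (k' * u ^ n'))" by (intro v_mono k k')
    then have "v (k / k' * k') \<le> v (u ^ (n + n') * k')" using k'0 by (simp add: power_add ac_simps)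
    then have 3: "v (k / k') \<le> v (u ^ (n + n'))" using v_cancel[OF k'0] by blast
    show "h - h' \<in> H" unfolding H_def using sf_divide[OF K k(1) k'(1)] 1 2 3 by blast
  next
    fix h h' g assume *: "h \<in> H" "h' \<in> H" "g \<in> G" "h \<le> g" "g \<le> h'"
    then obtain k n k' n' where k: "k \<in> K" "v k = Fin h" "v 1 \<le> v (k * u ^ n)" "v k \<le> v (u ^ n)"
      and k': "k' \<in> K" "v k' = Fin h'" "v 1 \<le> v (k' * u ^ n')" "v k' \<le> v (u ^ n')"
      unfolding H_def by blast
    obtain l where l: "l \<in> K" "v l = Fin g" using *(3) by (auto simp: G_def value_group_def)
    have kl: "v k \<le> v l" "v l \<le> v k'" using * k k' l by auto
    have "v (k * u ^ n * 1) \<le> v (l * u ^ n * u ^ n')" by (intro v_mono kl order_refl pow)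
    then have "v 1 \<le> v (l * u ^ (n + n'))" using k(3) by (simp add: power_add ac_simps)
    moreover have "v (k' * 1) \<le> v (u ^ n' * u ^ n)" by (intro v_mono k' pow)
    then have "v l \<le> v (u ^ (n + n'))" using kl by (simp add: power_add ac_simps)
    ultimately show "g \<in> H" unfolding H_def using l by blast
  qed
  obtain gu where gu: "v u = Fin gu" using v_Fin[OF u(3)] by blast
  have "gu \<in> H" unfolding H_def
    using gu u pow[of 2] by (auto intro!: bexI[of _ u] exI[of _ 1] simp: power2_eq_square)
  moreover have "gu \<noteq> 0" using gu u(2) by (auto simp: zero_extended_def)
  moreover have "gu \<in> G" using gu u by (auto simp: G_def value_group_def)
  ultimately have "{0} \<noteq> G" "H \<noteq> {0}" by auto
  have "H = G"
  proof (rule ccontr)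
    assume "H \<noteq> G"
    then have sub: "{{0}, H} \<subseteq> {H. convex_subgroup H G \<and> H \<noteq> G}" using conv0 convH \<open>{0} \<noteq> G\<close> by auto
    have card: "card {H. convex_subgroup H G \<and> H \<noteq> G} = 1"
      using rank by (simp only: rank_one_def G_def)
    then have "finite {H. convex_subgroup H G \<and> H \<noteq> G}" by (intro card_ge_0_finite) simp
    then have "card {{0}, H} \<le> 1" using card_mono[OF _ sub] card by simp
    then show False using \<open>H \<noteq> {0}\<close> by simp
  qed
  obtain gk where gk: "v k = Fin gk" using v_Fin[OF k(2)] by blast
  then have "gk \<in> H" using k \<open>H = G\<close> by (auto simp: G_def value_group_def)
  then show ?thesis using gk by (auto simp: H_def)
qed

text \<open>A trivial value group has no proper convex subgroup, so the count in
  \<open>rank_one\<close> would be 0.\<close>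

lemma positive_value: "\<exists>u\<in>K. u \<noteq> 0 \<and> 0 < v u"
proof (rule ccontr)
  assume *: "\<not> ?thesis"
  have "v u = 0" if "u \<in> K" "u \<noteq> 0" for u
  proof -
    have "v u \<le> v 1" using * that by (auto simp: not_less)
    moreover have "inverse u \<in> K" "inverse u \<noteq> 0" using that sf_inverse[OF K] by auto
    then have "v (inverse u) \<le> v 1" using * unfolding v_1 by (meson not_less)
    then have "v (inverse u * u) \<le> v (1 * u)" using v_mono by blast
    ultimately show ?thesis using that by auto
  qed
  then have "value_group v K \<subseteq> {0}"
    by (force simp: value_group_def zero_extended_def)
  then have "{H. convex_subgroup H (value_group v K) \<and> H \<noteq> value_group v K} = {}"
    by (auto simp: convex_subgroup_def)
  then show False using rank unfolding rank_one_def by (metis card.empty zero_neq_one)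
qed

lemma archimedean:
  assumes x: "x \<noteq> 0" "0 < v x" and y: "y \<noteq> 0"
  shows "\<exists>n. v y \<le> v (x ^ n)"
proof -
  obtain n k where k: "n > 0" "k \<in> K" "k \<noteq> 0" "v (x ^ n) = v k"
    using value_torsion[OF K] K_algebraic x(1) by metis
  obtain m l where l: "m > 0" "l \<in> K" "l \<noteq> 0" "v (y ^ m) = v l"
    using value_torsion[OF K] K_algebraic y by metis
  have "0 < v k"
  proof (rule ccontr)
    assume "\<not> 0 < v k"
    then have "v (x ^ n) \<le> v (1 ^ n)" using k by simp
    then have "v x \<le> v 1" using v_power_cancel[OF k(1) _ x(1), of 1] by simp
    then show False using x(2) by simp
  qed
  then obtain M where "v l \<le> v (k ^ M)"
    using value_group_bounded[OF k(2) _ k(3) l(2,3)] by blast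
  moreover have "v (k ^ M) = v ((x ^ n) ^ M)"
    using k(4) v_power_mono[of k "x ^ n" M] v_power_mono[of "x ^ n" k M] by (intro antisym) auto
  ultimately have 1: "v (y ^ m) \<le> v (x ^ (n * M))" using l by (simp add: power_mult)
  \<comment> \<open>Enlarging the exponent \<open>n * M\<close> to \<open>n * M * m\<close> makes
    the right-hand side an m-th power, after which the exponent m can be cancelled.\<close>
  have "v (1 ^ (n * M * (m - 1))) \<le> v (x ^ (n * M * (m - 1)))"
    using x(2) by (intro v_power_mono) simp
  then have "v 1 \<le> v (x ^ (n * M * (m - 1)))" by (simp only: power_one)
  then have 2: "v (x ^ (n * M) * 1) \<le> v (x ^ (n * M) * x ^ (n * M * (m - 1)))"
    by (rule v_mono[OF order_refl])
  have "n * M + n * M * (m - 1) = n * M * m" using l(1) by (cases m) auto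
  then have 3: "x ^ (n * M) * x ^ (n * M * (m - 1)) = (x ^ (n * M)) ^ m"
    unfolding power_add[symmetric] power_mult[symmetric] by (rule arg_cong)
  have "v (y ^ m) \<le> v ((x ^ (n * M)) ^ m)"
    by (rule order_trans[OF 1 2[unfolded 3 mult_1_right]])
  then have "v y \<le> v (x ^ (n * M))"
    by (rule v_power_cancel[OF l(1) _ y]) (use x(1) in simp)
  then show ?thesis ..
qed

subsection \<open>The embedding of the value group into the real numbers\<close>

text \<open>A unit of measurement, fixing the scale of \<open>val\<close>; the value group need not
  be discrete.\<close>

definition unif :: 'a where
  "unif = (SOME u. u \<in> K \<and> u \<noteq> 0 \<and> 0 < v u)"

lemma unif: "unif \<in> K" "unif \<noteq> 0" "0 < v unif"
  using someI_ex[of "\<lambda>u. u \<in> K \<and> u \<noteq> 0 \<and> 0 < v u"] positive_value unfolding unif_def by blast+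

text \<open>Hoelder's embedding of an archimedean group: the rationals m/n with m (v unif) \<le> n
  (v x) form the lower half of the Dedekind cut for the ratio of v x to v unif.\<close>

definition slopes :: "'a \<Rightarrow> real set" where
  "slopes x = {of_int m / of_nat n | m n. n > 0 \<and> v (unif powi m) \<le> v (x ^ n)}"

definition val :: "'a \<Rightarrow> real" where
  "val x = Sup (slopes x)"

lemma v_inverse_le: "x \<noteq> 0 \<Longrightarrow> y \<noteq> 0 \<Longrightarrow> v (inverse x) \<le> v (inverse y) \<longleftrightarrow> v y \<le> v x"
proof -
  assume "x \<noteq> 0" "y \<noteq> 0"
  then have "x * y \<noteq> 0" "inverse x * (x * y) = y" "inverse y * (x * y) = x" by auto
  then show ?thesis using v_cancel[of "x * y" "inverse x" "inverse y"] by metis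
qed

lemma powi_le_iff: "v (unif powi m) \<le> v (unif powi m') \<longleftrightarrow> m \<le> m'"
proof -
  have less: "v (unif powi m) < v (unif powi m')" if "m < m'" for m m'
  proof -
    define k where "k = nat (m' - m - 1)"
    have k: "m' - m = int (Suc k)" using that by (simp add: k_def)
    have "v (1 ^ k) \<le> v (unif ^ k)" using unif by (intro v_power_mono) simp
    then have "v 1 \<le> v (unif ^ k)" by (simp only: power_one)
    moreover have "v 1 < v unif" using unif by simp
    ultimately have "v (1 * 1) < v (unif * unif ^ k)"
      by (intro v_strict_mono) auto
    then have "v 1 < v (unif powi (m' - m))" unfolding k power_int_of_nat by simp
    then have "v (1 * unif powi m) < v (unif powi (m' - m) * unif powi m)"
      by (rule v_strict_mono) (use unif(2) in auto)
    then show ?thesis using unif(2) by (simp flip: power_int_add)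
  qed
  show ?thesis using less[of m m'] less[of m' m] by (cases m m' rule: linorder_cases) auto
qed

lemma powi_bounds:
  assumes "x \<noteq> 0"
  shows "\<exists>M. v x \<le> v (unif powi int M)" "\<exists>M. v (unif powi - int M) \<le> v x"
proof -
  obtain M where "v x \<le> v (unif ^ M)" using archimedean[OF unif(2,3) assms] by blast
  then show "\<exists>M. v x \<le> v (unif powi int M)" by auto
  obtain M where "v (inverse x) \<le> v (unif ^ M)" using archimedean[OF unif(2,3)] assms by fastforce
  then have "v (inverse (unif ^ M)) \<le> v x"
    using v_inverse_le[of "unif ^ M" "inverse x"] assms unif(2) by simp
  then show "\<exists>M. v (unif powi - int M) \<le> v x" by (auto simp: power_int_minus)
qed

lemma powi_power: "(unif powi m) ^ n = unif powi (m * int n)"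
  by (metis power_int_mult power_int_of_nat)

lemma slopes:
  assumes "x \<noteq> 0"
  shows "slopes x \<noteq> {}" "bdd_above (slopes x)"
proof -
  obtain M where M: "v (unif powi - int M) \<le> v x" using powi_bounds(2)[OF assms] by blast
  then have "of_int (- int M) / of_nat 1 \<in> slopes x"
    unfolding slopes_def by (intro CollectI exI[of _ "- int M"] exI[of _ 1]) auto
  then show "slopes x \<noteq> {}" by blast
  obtain M where M: "v x \<le> v (unif powi int M)" using powi_bounds(1)[OF assms] by blast
  have "q \<le> of_nat M" if q: "q \<in> slopes x" for q
  proof -
    obtain m n where mn: "q = of_int m / of_nat n" "n > 0" "v (unif powi m) \<le> v (x ^ n)"
      using q by (auto simp: slopes_def)
    have "v (x ^ n) \<le> v (unif powi (int M * int n))"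
      using v_power_mono[OF M, of n] unfolding powi_power .
    then have "m \<le> int M * int n" using mn(3) powi_le_iff order_trans by blast
    then have "real_of_int m \<le> real_of_int (int M * int n)" by (simp only: of_int_le_iff)
    then show ?thesis unfolding mn(1) using mn(2) by (simp add: field_simps)
  qed
  then show "bdd_above (slopes x)" by (rule bdd_aboveI)
qed

lemma val_ge: "x \<noteq> 0 \<Longrightarrow> n > 0 \<Longrightarrow> v (unif powi m) \<le> v (x ^ n) \<Longrightarrow> of_int m / of_nat n \<le> val x"
  unfolding val_def by (rule cSup_upper[OF _ slopes(2)]) (auto simp: slopes_def)

lemma val_gt:
  assumes x: "x \<noteq> 0" and n: "n > 0" and less: "of_int m / of_nat n < val x"
  shows "v (unif powi m) \<le> v (x ^ n)"
proof -
  obtain q where "q \<in> slopes x" "of_int m / of_nat n < q"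
    using less less_cSup_iff[OF slopes[OF x]] unfolding val_def by blast
  then obtain m' n' where q: "n' > 0" "v (unif powi m') \<le> v (x ^ n')" "of_int m / real n < of_int m' / real n'"
    by (auto simp: slopes_def)
  then have "real_of_int m * real n' < of_int m' * real n" using n by (simp add: field_simps)
  then have "real_of_int (m * int n') < real_of_int (m' * int n)" by simp
  then have "m * int n' \<le> m' * int n" by linarith
  then have "v ((unif powi m) ^ n') \<le> v ((unif powi m') ^ n)"
    unfolding powi_power powi_le_iff .
  also have "\<dots> \<le> v ((x ^ n') ^ n)" by (rule v_power_mono[OF q(2)])
  also have "(x ^ n') ^ n = (x ^ n) ^ n'" by (simp flip: power_mult add: mult.commute)
  finally show ?thesis
    by (rule v_power_cancel[OF q(1)]) (use unif(2) x in auto)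
qed

lemma val_mult:
  assumes x: "x \<noteq> 0" and y: "y \<noteq> 0"
  shows "val (x * y) = val x + val y"
proof (rule linorder_cases)
  assume less: "val (x * y) < val x + val y"
  define e where "e = val x + val y - val (x * y)"
  \<comment> \<open>Rounding the multiples by \<open>n\<close> of val x and val y to integers costs
    at most 1 each, so the gap must exceed 2 after multiplication by \<open>n\<close>.\<close>
  obtain n :: nat where n: "2 / e < n" using reals_Archimedean2 by blast
  have e: "e > 0" using less by (simp add: e_def)
  then have n0: "real n > 0" using n by (meson divide_pos_pos less_trans zero_less_numeral)
  have ne: "2 < e * n" using n e by (simp add: field_simps)
  define m1 where "m1 = \<lceil>val x * n\<rceil> - 1"
  define m2 where "m2 = \<lceil>val y * n\<rceil> - 1"
  have m: "of_int m1 < val x * n" "of_int m2 < val y * n" "of_int m1 \<ge> val x * n - 1" "of_int m2 \<ge> val y * n - 1"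
    unfolding m1_def m2_def by linarith+
  then have "of_int m1 / of_nat n < val x" "of_int m2 / of_nat n < val y"
    using n0 by (auto simp: field_simps)
  then have "v (unif powi m1 * unif powi m2) \<le> v (x ^ n * y ^ n)"
    using n0 by (intro v_mono val_gt x y) auto
  then have "v (unif powi (m1 + m2)) \<le> v ((x * y) ^ n)"
    using unif(2) by (simp add: power_int_add power_mult_distrib)
  then have "of_int (m1 + m2) / of_nat n \<le> val (x * y)"
    using n0 x y by (intro val_ge) auto
  then have "of_int m1 + of_int m2 \<le> val (x * y) * n" using n0 by (simp add: field_simps)
  moreover have "val x * n + val y * n - 2 > val (x * y) * n"
    using ne by (simp add: e_def algebra_simps)
  ultimately show ?thesis using m by linarith
next
  assume less: "val x + val y < val (x * y)"
  define e where "e = val (x * y) - (val x + val y)"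
  obtain n :: nat where n: "2 / e < n" using reals_Archimedean2 by blast
  have e: "e > 0" using less by (simp add: e_def)
  then have n0: "real n > 0" using n by (meson divide_pos_pos less_trans zero_less_numeral)
  have ne: "2 < e * n" using n e by (simp add: field_simps)
  define m1 where "m1 = \<lfloor>val x * n\<rfloor> + 1"
  define m2 where "m2 = \<lfloor>val y * n\<rfloor> + 1"
  have m: "of_int m1 > val x * n" "of_int m2 > val y * n" "of_int m1 \<le> val x * n + 1" "of_int m2 \<le> val y * n + 1"
    unfolding m1_def m2_def by linarith+
  then have "val x < of_int m1 / of_nat n" "val y < of_int m2 / of_nat n"
    unfolding pos_less_divide_eq[OF n0] by simp_all
  then have "v (x ^ n) < v (unif powi m1)" "v (y ^ n) < v (unif powi m2)"
    using val_ge[OF x, of n m1] val_ge[OF y, of n m2] n0 by (meson not_le of_nat_0_less_iff)+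
  then have "v (x ^ n * y ^ n) < v (unif powi m1 * unif powi m2)"
    using y by (intro v_strict_mono) auto
  then have "\<not> v (unif powi (m1 + m2)) \<le> v ((x * y) ^ n)"
    using unif(2) by (simp add: power_int_add power_mult_distrib not_le)
  then have "\<not> of_int (m1 + m2) / of_nat n < val (x * y)"
    using val_gt[of "x * y" n "m1 + m2"] n0 x y by auto
  then have "of_int m1 + of_int m2 \<ge> val (x * y) * n" using n0 by (simp add: field_simps)
  moreover have "val x * n + val y * n + 2 < val (x * y) * n"
    using ne by (simp add: e_def algebra_simps)
  ultimately show ?thesis using m by linarith
qed

lemma val_pos:
  assumes "x \<noteq> 0" "0 < v x"
  shows "0 < val x"
proof -
  obtain n where n: "v unif \<le> v (x ^ n)" using archimedean[OF assms unif(2)] by blast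
  have "n > 0" using n unif(3) by (intro gr0I) auto
  then have "1 / n \<le> val x" using val_ge[OF assms(1), of n 1] n by simp
  moreover have "0 < 1 / real n" using \<open>n > 0\<close> by simp
  ultimately show ?thesis by linarith
qed

text \<open>A supremum by itself preserves only weak inequalities. Strictness comes from the
  archimedean property, through the positivity of \<open>val\<close> at a quotient of positive
  value.\<close>

lemma val_le_iff:
  assumes x: "x \<noteq> 0" and y: "y \<noteq> 0"
  shows "val x \<le> val y \<longleftrightarrow> v x \<le> v y"
proof -
  have less: "val x < val y" if xy: "v x < v y" "x \<noteq> 0" "y \<noteq> 0" for x y
  proof -
    have "v (x * inverse x) < v (y * inverse x)" using xy by (intro v_strict_mono) auto
    then have "0 < v (y * inverse x)" using xy by simp
    then have "0 < val (y * inverse x)" using xy by (intro val_pos) auto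
    moreover have "val y = val (y * inverse x) + val x"
      using val_mult[of "y * inverse x" x] xy by (simp add: mult.assoc)
    ultimately show ?thesis by simp
  qed
  have eq: "val x \<le> val y" if xy: "v x = v y" "x \<noteq> 0" "y \<noteq> 0" for x y
  proof -
    have *: "v (x ^ n) = v (y ^ n)" for n
      using v_power_mono[of x y n] v_power_mono[of y x n] xy(1) by (intro antisym) auto
    have "slopes x = slopes y" unfolding slopes_def * ..
    then show ?thesis by (simp add: val_def)
  qed
  show ?thesis
    using less[OF _ x y] less[OF _ y x] eq[OF _ x y] by (cases "v x" "v y" rule: linorder_cases) auto
qed

definition N :: "'a \<Rightarrow> real" where
  "N x = (if x = 0 then 0 else exp (- val x))"

lemma N_le_iff: "N x \<le> N y \<longleftrightarrow> v y \<le> v x"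
  using val_le_iff[of y x] by (cases "x = 0"; cases "y = 0") (auto simp: N_def not_le intro: less_imp_le)

lemma N_less_iff: "N x < N y \<longleftrightarrow> v y < v x"
  using N_le_iff by (metis not_le)

lemma N_one: "N 1 = 1"
  using val_mult[of 1 1] by (simp add: N_def)

lemma N_eq_1_iff: "N x = 1 \<longleftrightarrow> v x = 0" and N_less_1_iff: "N x < 1 \<longleftrightarrow> 0 < v x"
  and N_le_1_iff: "N x \<le> 1 \<longleftrightarrow> 0 \<le> v x"
  using N_le_iff[of x 1] N_le_iff[of 1 x] N_less_iff[of x 1] N_one by force+

lemma ultrametric_N:
  assumes "alg_closed TYPE('a)"
  shows "ultrametric N"
proof (intro ultrametric.intro ultrametric_axioms.intro assms)
  fix x y :: 'a
  show "0 \<le> N x" "N x = 0 \<longleftrightarrow> x = 0" by (auto simp: N_def)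
  show "N (x * y) = N x * N y" using val_mult[of x y] exp_add[of "- val x" "- val y"] by (auto simp: N_def)
  show "N (x + y) \<le> max (N x) (N y)"
    using v_add[of x y] N_le_iff[of "x + y"] by (auto simp: le_max_iff_disj min_le_iff_disj)
qed

end

section \<open>Degrees and conjugates in HOL-Algebra terms\<close>

lemma nat_pow_Kbar [simp]: "x [^]\<^bsub>Kbar\<^esub> n = (x :: 'a::field) ^ (n :: nat)"
  by (induct n) (simp_all add: nat_pow_def)

text \<open>Polynomials of HOL-Algebra are lists starting with the leading coefficient, whereas
  \<open>Poly\<close> expects the constant coefficient first.\<close>

lemma eval_Kbar: "ring.eval Kbar l x = poly (Poly (rev l)) (x :: 'a::field)"
proof -
  interpret R: Ring.field "Kbar :: 'a ring" by (rule field_Kbar)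
  show ?thesis
  proof (induct l)
    case (Cons a l)
    have "poly (Poly (rev (a # l))) x = poly (Poly (rev l)) x + x ^ length l * a"
      by (simp add: Poly_append poly_monom algebra_simps)
    then show ?case using Cons by (simp add: algebra_simps)
  qed simp
qed

context
  fixes E :: "'a::field set"
  assumes E: "subfield E Kbar"
begin

interpretation R: Ring.field "Kbar :: 'a ring" by (rule field_Kbar)

lemma poly_over_list: "set l \<subseteq> E \<Longrightarrow> poly_over E (Poly (rev l))"
  using sf_0[OF E] by (auto simp: poly_over_def coeff_Poly_eq nth_default_def subset_eq rev_nth)

lemma univ_poly_Poly: "l \<in> carrier (univ_poly Kbar E) \<Longrightarrow> poly_over E (Poly (rev l))"
  by (intro poly_over_list) (auto simp: univ_poly_def polynomial_def)

lemma Poly_univ_poly: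
  assumes "poly_over E f"
  shows "rev (coeffs f) \<in> carrier (univ_poly Kbar E)"
proof (cases "f = 0")
  case False
  have "set (coeffs f) \<subseteq> E" using assms by (auto simp: coeffs_def poly_over_def)
  moreover have "hd (rev (coeffs f)) = lead_coeff f" using False by (simp add: hd_rev last_coeffs_eq_coeff_degree)
  ultimately show ?thesis using False by (auto simp: univ_poly_def polynomial_def)
qed (simp add: univ_poly_def polynomial_def)

lemma algebraic_Kbar:
  "poly_over E g \<Longrightarrow> g \<noteq> 0 \<Longrightarrow> poly g x = 0 \<Longrightarrow> (R.algebraic over E) x"
  using R.algebraicI[OF Poly_univ_poly, of g x] by (simp add: eval_Kbar over_def)

lemma algebraic_Kbar_imp:
  assumes "(R.algebraic over E) x"
  shows "\<exists>g. poly_over E g \<and> g \<noteq> 0 \<and> poly g x = 0"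
proof -
  obtain l where l: "l \<in> carrier (univ_poly Kbar E)" "l \<noteq> []" "R.eval l x = 0"
    using R.algebraicE[OF subfieldE(1)[OF E] _ assms] by auto
  have "hd l \<noteq> 0" using l(1,2) by (auto simp: univ_poly_def polynomial_def)
  then have "coeff (Poly (rev l)) (length l - 1) \<noteq> 0"
    using l(2) by (simp add: coeff_Poly_eq nth_default_def rev_nth hd_conv_nth)
  then have "Poly (rev l) \<noteq> 0" by (metis coeff_0)
  then show ?thesis using univ_poly_Poly[OF l(1)] l(3) by (auto simp: eval_Kbar)
qed

context
  fixes x f
  assumes f: "min_poly E x f"
begin

lemma alg_x: "(R.algebraic over E) x"
  using min_polyD[OF f] by (intro algebraic_Kbar)

lemma Irr_Kbar: "Poly (rev (R.Irr E x)) = f" "length (R.Irr E x) - 1 = degree f"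
proof -
  note I = R.IrrE[OF E _ alg_x, simplified]
  have nz: "R.Irr E x \<noteq> []" using I(2) by (auto simp: ring_irreducible_def univ_poly_zero)
  have coeff: "coeff (Poly (rev (R.Irr E x))) (length (R.Irr E x) - 1) = 1"
    using nz I(3) by (simp add: coeff_Poly_eq nth_default_def rev_nth hd_conv_nth)
  have deg: "degree (Poly (rev (R.Irr E x))) = length (R.Irr E x) - 1"
  proof (rule antisym)
    show "degree (Poly (rev (R.Irr E x))) \<le> length (R.Irr E x) - 1"
      by (rule degree_le) (auto simp: coeff_Poly_eq nth_default_def)
    show "length (R.Irr E x) - 1 \<le> degree (Poly (rev (R.Irr E x)))"
      by (rule le_degree) (unfold coeff, simp)
  qed
  have "min_poly E x (Poly (rev (R.Irr E x)))"
    unfolding min_poly_def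
  proof (intro conjI allI impI)
    show "poly_over E (Poly (rev (R.Irr E x)))" by (rule univ_poly_Poly[OF I(1)])
    show "lead_coeff (Poly (rev (R.Irr E x))) = 1" unfolding deg by (rule coeff)
    show "poly (Poly (rev (R.Irr E x))) x = 0" using I(4) by (simp add: eval_Kbar)
    fix g assume g: "poly_over E g" "poly g x = 0" "g \<noteq> 0"
    have *: "rev (coeffs g) \<in> carrier (univ_poly Kbar E)" "rev (coeffs g) \<noteq> []"
      using Poly_univ_poly g by auto
    have "R.eval (rev (coeffs g)) x = \<zero>\<^bsub>Kbar\<^esub>" using g(2) by (simp add: eval_Kbar)
    from R.pdivides_imp_degree_le[OF subfieldE(1)[OF E] I(1) * R.Irr_minimal[OF E _ alg_x *(1) this]]
    have "length (R.Irr E x) - 1 \<le> length (rev (coeffs g)) - 1" by simp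
    also have "\<dots> = degree g" by (simp add: length_coeffs degree_eq_length_coeffs)
    finally show "degree (Poly (rev (R.Irr E x))) \<le> degree g" unfolding deg .
  qed
  then show "Poly (rev (R.Irr E x)) = f" by (rule min_poly_unique[OF E _ f])
  then show "length (R.Irr E x) - 1 = degree f" using deg by simp
qed

lemma adjoin_simple_extension: "adjoin E {x} = R.simple_extension E x"
proof
  have "subfield (R.simple_extension E x) Kbar"
    using R.simple_extension_is_subfield[OF E, of x] alg_x by simp
  then show "adjoin E {x} \<subseteq> R.simple_extension E x"
    unfolding adjoin_def using R.simple_extension_incl[of E x] R.simple_extension_mem[OF subfieldE(1)[OF E], of x]
    by (intro R.generate_field_min_subfield1) auto
  show "R.simple_extension E x \<subseteq> adjoin E {x}"
    unfolding adjoin_def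
    by (rule R.simple_extension_subring_incl[OF subfieldE(1)[OF R.generate_field_is_subfield]])
      (auto intro: generate_field.incl)
qed

lemma deg_over_eq: "deg_over E x = degree f"
  unfolding deg_over_def adjoin_simple_extension
  using R.dimension_simple_extension[OF E _ alg_x] R.dimI[OF E] Irr_Kbar(2) by (simp add: over_def)

lemma conjugate_iff: "conjugate E x y \<longleftrightarrow> poly f y = 0"
  unfolding conjugate_def eval_Kbar Irr_Kbar(1) ..

lemma adjoin_eq: "adjoin E {x} = {poly g x | g. poly_over E g}"
proof -
  have "adjoin E {x} = (\<lambda>l. R.eval l x) ` carrier (univ_poly Kbar E)"
    unfolding adjoin_simple_extension by (rule R.simple_extension_as_eval_img) auto
  also have "\<dots> = {poly g x | g. poly_over E g}"
  proof (intro equalityI subsetI)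
    fix y assume "y \<in> {poly g x | g. poly_over E g}"
    then obtain g where "y = poly g x" "poly_over E g" by blast
    then show "y \<in> (\<lambda>l. R.eval l x) ` carrier (univ_poly Kbar E)"
      by (intro image_eqI[OF _ Poly_univ_poly]) (auto simp: eval_Kbar)
  qed (use univ_poly_Poly in \<open>force simp: eval_Kbar\<close>)
  finally show ?thesis .
qed

lemma adjoin_eq_degree: "adjoin E {x} = {poly g x | g. poly_over E g \<and> degree g < degree f}"
  unfolding adjoin_eq
proof (intro equalityI subsetI)
  fix y assume "y \<in> {poly g x | g. poly_over E g}"
  then obtain g where g: "y = poly g x" "poly_over E g" by blast
  have "poly g x = poly (g div f * f + g mod f) x" by simp
  also have "\<dots> = poly (g mod f) x" unfolding poly_add poly_mult using min_polyD(3)[OF f] by simp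
  finally have "y = poly (g mod f) x" using g by simp
  moreover have "poly_over E (g mod f)"
    by (rule poly_over_div_mod(2)[OF E g(2) min_polyD(1)[OF f]])
  moreover have "degree (g mod f) < degree f"
    using degree_mod_less[of f g] min_polyD(4)[OF f] min_poly_degree_pos[OF f] by auto
  ultimately show "y \<in> {poly g x | g. poly_over E g \<and> degree g < degree f}" by blast
qed blast

end

end

lemma adjoin_subfield: "subfield (adjoin E S) (Kbar :: 'a::field ring)"
proof -
  interpret R: Ring.field "Kbar :: 'a ring" by (rule field_Kbar)
  show ?thesis unfolding adjoin_def by (rule R.generate_field_is_subfield) simp
qed

lemma adjoin_incl: "E \<subseteq> adjoin E S" "S \<subseteq> adjoin E S"
  by (auto simp: adjoin_def intro: generate_field.incl)

lemma adjoin_subset: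
  assumes "subfield F (Kbar :: 'a::field ring)" "E \<subseteq> F" "S \<subseteq> F"
  shows "adjoin E S \<subseteq> F"
proof -
  interpret R: Ring.field "Kbar :: 'a ring" by (rule field_Kbar)
  show ?thesis unfolding adjoin_def by (rule R.generate_field_min_subfield1) (use assms in auto)
qed

section \<open>Henselizations\<close>

locale rank_one_char = rank_one_valued_field v K + alg_closed_char ty p
  for v :: "'a::field \<Rightarrow> 'g::linordered_ab_group_add extended" and K and ty :: "'a itself" and p
begin

sublocale valued_char ty N p K
proof (intro valued_char.intro valued_char_axioms.intro alg_closed_char_axioms K K_algebraic)
  show "ultrametric N"
    by (rule ultrametric_N) (rule alg_closed_axioms)
qed

lemma valuation_ring_iff: "x \<in> valuation_ring v F \<longleftrightarrow> x \<in> F \<and> N x \<le> 1"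
  by (auto simp: valuation_ring_def N_le_1_iff)

lemma maximal_ideal_iff: "x \<in> maximal_ideal v \<longleftrightarrow> N x < 1"
  by (auto simp: maximal_ideal_def N_less_1_iff)

lemma henselianD:
  assumes "henselian v F" "lead_coeff f = 1" "poly_over F f" "gauss_le 1 f 1" "x \<in> F" "N x \<le> 1"
    "N (poly f x) < 1" "N (poly (pderiv f) x) = 1"
  shows "\<exists>y\<in>F. poly f y = 0 \<and> N (y - x) < 1"
proof -
  have "\<forall>i. coeff f i \<in> valuation_ring v F"
    using assms(3,4) by (auto simp: valuation_ring_iff poly_over_def gauss_le_def)
  then have "\<exists>y\<in>F. poly f y = 0 \<and> 0 < v (y - x)"
    using assms(1)[unfolded henselian_def, rule_format, of x f] assms(2,5-)
    by (auto simp: valuation_ring_iff N_less_1_iff N_eq_1_iff)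
  then show ?thesis by (simp add: N_less_1_iff)
qed

lemma gauss_le_eval:
  assumes f: "gauss_le 1 f B" and x: "N x \<le> 1"
  shows "N (poly f x) \<le> B"
  unfolding poly_altdef
proof (rule N_sum_le)
  fix i
  have "N (coeff f i) * N x ^ i \<le> B * 1"
    using f x gauss_le_nonneg[OF _ f] by (intro mult_mono power_le_one) (auto simp: gauss_le_def)
  then show "N (coeff f i * x ^ i) \<le> B" by (simp add: N_mult N_power)
qed (use gauss_le_nonneg[OF _ f] in simp)

lemma gauss_le_pderiv:
  assumes f: "gauss_le 1 f B"
  shows "gauss_le 1 (pderiv f) B"
  unfolding gauss_le_def
proof
  fix i
  have "N (of_nat (Suc i)) * N (coeff f (Suc i)) \<le> 1 * B"
    using f N_of_nat[of "Suc i"] by (intro mult_mono) (auto simp: gauss_le_def simp del: of_nat_Suc)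
  then show "N (coeff (pderiv f) i) * 1 ^ i \<le> B" by (simp add: coeff_pderiv N_mult del: of_nat_Suc)
qed

lemma integral_root:
  assumes f: "lead_coeff f = 1" "gauss_le 1 f 1" and x: "poly f x = 0"
  shows "N x \<le> 1"
proof (rule ccontr)
  assume "\<not> N x \<le> 1"
  then have x1: "1 < N x" by simp
  define n where "n = degree f"
  have n0: "n \<noteq> 0"
  proof
    assume "n = 0"
    then obtain c where "f = [:c:]" by (auto simp: n_def elim: degree_eq_zeroE)
    then show False using f(1) x by simp
  qed
  have "poly f x = x ^ n + (\<Sum>i<n. coeff f i * x ^ i)"
    unfolding poly_altdef n_def[symmetric] lessThan_Suc_atMost[symmetric]
    using f(1) by (simp add: n_def)
  moreover have "N (\<Sum>i<n. coeff f i * x ^ i) \<le> N x ^ (n - 1)"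
  proof (rule N_sum_le)
    fix i assume "i \<in> {..<n}"
    then have "N x ^ i \<le> N x ^ (n - 1)" using x1 by (intro power_increasing) auto
    then have "N (coeff f i) * N x ^ i \<le> 1 * N x ^ (n - 1)"
      using f(2) by (intro mult_mono) (auto simp: gauss_le_def)
    then show "N (coeff f i * x ^ i) \<le> N x ^ (n - 1)" by (simp add: N_mult N_power)
  qed simp
  moreover have "N x ^ (n - 1) < N x ^ n" using x1 n0 by (intro power_strict_increasing) auto
  ultimately have "N (poly f x) = N (x ^ n)"
    using N_add_eq[of "\<Sum>i<n. coeff f i * x ^ i" "x ^ n"] by (simp add: N_power add.commute)
  then show False using x x1 by simp
qed

text \<open>The product of the distances from \<open>x\<close> to the roots is less than 1, so some
  root \<open>y\<close> is close. Writing f = (X - y)g, the unit f'(x) is congruent to g(x), which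
  keeps all other roots at distance exactly 1.\<close>

lemma hensel_root:
  assumes f: "lead_coeff f = 1" "gauss_le 1 f 1" and x: "N x \<le> 1"
    and small: "N (poly f x) < 1" and unit: "N (poly (pderiv f) x) = 1"
  obtains y where "poly f y = 0" "N (y - x) < 1" "poly (pderiv f) y \<noteq> 0"
    "\<And>z. poly f z = 0 \<Longrightarrow> N (z - x) < 1 \<Longrightarrow> z = y"
proof -
  obtain A where A: "f = (\<Prod>a\<in>#A. [:-a, 1:])" using factorization[OF f(1)] by blast
  have roots: "poly f a = 0 \<longleftrightarrow> a \<in># A" for a
    unfolding A poly_prod_mset_linear_eq_0_iff ..
  have A1: "N a \<le> 1" if "a \<in># A" for a using integral_root[OF f] roots that by blast
  have "N (poly f x) = (\<Prod>a\<in>#A. N (x - a))" unfolding A poly_prod_mset_linear N_prod_mset ..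
  then obtain y where y: "y \<in># A" "N (x - y) < 1"
    using small prod_mset_ge_1[of A "\<lambda>a. N (x - a)"] by force
  then obtain B where B: "A = add_mset y B" by (meson multi_member_split)
  let ?g = "\<Prod>a\<in>#B. [:-a, 1:]"
  have fg: "f = [:-y, 1:] * ?g" unfolding A B by simp
  have g: "gauss_le 1 ?g 1"
    using gauss_le_small_roots[of 1 B] A1 by (auto simp: B)
  have df: "poly (pderiv f) z = poly ?g z + (z - y) * poly (pderiv ?g) z" for z
    unfolding fg pderiv_mult by (simp add: pderiv_pCons algebra_simps)
  have "N ((x - y) * poly (pderiv ?g) x) < 1"
    using y(2) gauss_le_eval[OF gauss_le_pderiv[OF g] x] mult_left_le[of "N (poly (pderiv ?g) x)" "N (x - y)"]
    by (simp add: N_mult)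
  then have "N (poly ?g x) = 1"
    using unit N_diff_eq'[of "(x - y) * poly (pderiv ?g) x" "poly (pderiv f) x"] by (simp add: df)
  moreover have "N (x - b) \<le> 1" if "b \<in># B" for b
    using N_diff[of x b] x A1[of b] that by (auto simp: B)
  ultimately have far: "N (x - b) = 1" if "b \<in># B" for b
    using prod_mset_less_1[of B "\<lambda>b. N (x - b)" b] that
    unfolding poly_prod_mset_linear N_prod_mset by force
  show ?thesis
  proof
    show "poly f y = 0" using roots y by simp
    show "N (y - x) < 1" using y N_minus_commute[of x y] by simp
    have "y \<notin># B" using far y(2) by force
    then show "poly (pderiv f) y \<noteq> 0"
      unfolding df using poly_prod_mset_linear_eq_0_iff[of B y] by simp
    fix z assume "poly f z = 0" "N (z - x) < 1"
    then show "z = y" using roots[of z] far[of z] N_minus_commute[of x z] by (auto simp: B)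
  qed
qed

text \<open>The conjugates over \<open>M\<close> of z = y - x are conjugates over \<open>C\<close>,
  hence have the norm of \<open>z\<close>. Adding \<open>x\<close> to them gives roots of
  \<open>f\<close> close to \<open>x\<close>, of which there is only one.\<close>

lemma algebraic_extension_henselian:
  assumes M: "subfield M Kbar" "C \<subseteq> M"
  shows "henselian v M"
  unfolding henselian_def
proof (intro allI ballI impI)
  fix f x
  assume x: "x \<in> valuation_ring v M" and f: "lead_coeff f = 1" "\<forall>i. coeff f i \<in> valuation_ring v M"
    and small: "0 < v (poly f x)" and unit: "v (poly (pderiv f) x) = 0"
  have f1: "gauss_le 1 f 1" "poly_over M f"
    using f(2) by (auto simp: gauss_le_def valuation_ring_iff poly_over_def)
  have x1: "x \<in> M" "N x \<le> 1" using x by (auto simp: valuation_ring_iff)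
  obtain y where y: "poly f y = 0" "N (y - x) < 1" "poly (pderiv f) y \<noteq> 0"
    "\<And>z. poly f z = 0 \<Longrightarrow> N (z - x) < 1 \<Longrightarrow> z = y"
    using hensel_root[OF f(1) f1(1) x1(2)] small unit by (metis N_less_1_iff N_eq_1_iff)
  define z where "z = y - x"
  obtain F where F: "min_poly C z F" using C_min_poly by blast
  have FM: "poly_over M F" by (rule poly_over_mono[OF min_polyD(1)[OF F] M(2)])
  then obtain m where m: "min_poly M z m"
    using min_poly_exists[OF M(1) FM min_polyD(4,3)[OF F]] by blast
  let ?g = "pcompose f [:x, 1:]"
  have g: "poly_over M ?g"
    by (intro poly_over_pcompose poly_over_pCons poly_over_0 sf_1 M f1 x1)
  have "poly ?g z = 0" using y(1) by (simp add: z_def poly_pcompose)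
  then have mg: "m dvd ?g" by (rule min_poly_dvd[OF M(1) m g])
  have mF: "m dvd F" by (rule min_poly_dvd[OF M(1) m FM min_polyD(3)[OF F]])
  have roots: "w = z" if "poly m w = 0" for w
  proof -
    have "poly ?g w = 0" "poly F w = 0" using that mg mF by (auto elim: dvdE)
    then have "N w = N z" by (intro min_poly_roots_norm_eq[OF C F] min_polyD(3)[OF F])
    then have "N (x + w - x) < 1" using y(2) by (simp add: z_def)
    moreover have "poly f (x + w) = 0" using \<open>poly ?g w = 0\<close> by (simp add: poly_pcompose)
    ultimately have "x + w = y" using y(4) by blast
    then show ?thesis by (auto simp: z_def)
  qed
  have "poly (pderiv ?g) z = poly (pderiv f) y"
    by (simp add: pderiv_pcompose poly_pcompose z_def pderiv_pCons)
  then have dg: "poly (pderiv ?g) z \<noteq> 0" using y(3) by metis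
  have "z \<in> M" by (rule unique_simple_root_mem[OF M(1) m mg dg roots])
  then have "z + x \<in> M" by (rule sf_add[OF M(1) _ x1(1)])
  then have "y \<in> M" by (simp add: z_def)
  then show "\<exists>y\<in>M. poly f y = 0 \<and> 0 < v (y - x)"
    using y(1,2) by (auto simp: N_less_1_iff)
qed

lemma poly_bounded: "\<exists>L. \<forall>c. N c \<le> B \<longrightarrow> N (poly h c) \<le> L"
proof (induct h)
  case (pCons a h)
  then obtain L where L: "\<And>c. N c \<le> B \<Longrightarrow> N (poly h c) \<le> L" by blast
  have "N (poly (pCons a h) c) \<le> max (N a) (B * L)" if c: "N c \<le> B" for c
  proof -
    have "N c * N (poly h c) \<le> B * L"
      using L[OF c] c order_trans[OF N_nonneg c] by (intro mult_mono) auto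
    then show ?thesis
      using N_add[of a "c * poly h c"] by (auto simp: N_mult le_max_iff_disj)
  qed
  then show ?case by blast
qed (auto intro: exI[of _ 0])

lemma poly_bounded_finite:
  assumes "finite I"
  shows "\<exists>L\<ge>1. \<forall>i\<in>I. \<forall>c. N c \<le> B \<longrightarrow> N (poly (h i) c) \<le> L"
  using assms
proof (induct I)
  case (insert i I)
  then obtain L where L: "L \<ge> 1" "\<forall>i\<in>I. \<forall>c. N c \<le> B \<longrightarrow> N (poly (h i) c) \<le> L" by blast
  obtain L' where "\<forall>c. N c \<le> B \<longrightarrow> N (poly (h i) c) \<le> L'" using poly_bounded by blast
  then show ?case using L by (intro exI[of _ "max L L'"]) (auto simp: le_max_iff_disj)
qed (auto intro: exI[of _ 1])

lemma hasse_1: "poly (hasse 1 g) z = poly (pderiv g) z"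
proof -
  have "coeff (pcompose g [:z, 1:]) 1 = poly (pderiv (pcompose g [:z, 1:])) 0"
    by (simp add: poly_0_coeff_0 coeff_pderiv)
  then show ?thesis by (simp add: poly_hasse pderiv_pcompose poly_pcompose pderiv_pCons)
qed

end

section \<open>Comparison of the closure \<open>C\<close> with the henselization of
  \<open>K\<close>\<close>

context rank_one_char
begin

lemma gauss_le_sum:
  assumes "finite I" "\<And>i. i \<in> I \<Longrightarrow> gauss_le 1 (f i) B" "0 \<le> B"
  shows "gauss_le 1 (\<Sum>i\<in>I. f i) B"
  using assms(1,2)
proof (induct I)
  case empty
  show ?case using assms(3) by (simp add: gauss_le_0)
next
  case (insert i I)
  then show ?case using gauss_le_add[of 1 "f i" B] by simp
qed

text \<open>Hensel's lemma for simple roots: the substitution \<open>x = c + u/w\<close> with \<open>u = g(c)/g'(c)\<close> turns \<open>g\<close> into a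
  monic integral polynomial congruent to \<open>w\<^sup>n + w\<^sup>n\<^sup>-\<^sup>1\<close>, which has the approximate root \<open>-1\<close>.\<close>

lemma nagata_polynomial:
  fixes a :: "nat \<Rightarrow> 'a" and u :: 'a and m :: nat
  assumes E: "subfield E Kbar" "henselian v E" and a: "\<And>j. a j \<in> E" "u \<in> E"
    and u: "a 0 = a 1 * u" "a 1 \<noteq> 0"
    and small: "\<And>j. 2 \<le> j \<Longrightarrow> j \<le> m + 2 \<Longrightarrow> N (a j * u ^ (j - 1) / a 1) \<le> d" "0 \<le> d" "d < 1"
  shows "\<exists>w\<in>E. N w = 1 \<and> (\<Sum>j\<le>m + 2. a j * (u / w) ^ j) = 0"
proof -
  define b where "b j = a j * u ^ (j - 1) / a 1" for j
  define Q where "Q = (\<Sum>j\<in>{2..m + 2}. monom (b j) (m + 2 - j))"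
  define P where "P = monom 1 (m + 2) + (monom 1 (m + 1) + Q)"
  have bE: "b j \<in> E" for j
    unfolding b_def by (intro sf_divide sf_mult sf_power E a)
  have "gauss_le 1 Q d"
    unfolding Q_def by (intro gauss_le_sum) (use small in \<open>auto simp: b_def gauss_le_def\<close>)
  moreover have "poly_over E Q"
    unfolding Q_def by (intro poly_over_sum poly_over_monom E bE)
  ultimately have Q: "gauss_le 1 Q d" "poly_over E Q" by auto
  have "degree Q \<le> m"
    unfolding Q_def by (intro degree_sum_le) (auto intro!: order_trans[OF degree_monom_le])
  then have low: "degree (monom 1 (m + 1) + Q) < m + 2"
    using degree_add_le[of "monom (1 :: 'a) (m + 1)" "m + 1" Q] by (simp add: degree_monom_eq)
  then have dP: "degree P = m + 2"
    unfolding P_def by (subst degree_add_eq_left) (simp_all add: degree_monom_eq)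
  have lP: "lead_coeff P = 1"
    unfolding dP unfolding P_def using coeff_eq_0[OF low] by simp
  have PE: "poly_over E P"
    unfolding P_def by (intro poly_over_add poly_over_monom sf_1 E Q)
  have mon: "gauss_le 1 (monom 1 n) 1" for n by (auto simp: gauss_le_def)
  have gP: "gauss_le 1 P 1"
    unfolding P_def using gauss_le_mono[OF _ Q(1), of 1] small(3) by (intro gauss_le_add mon) auto
  have "poly P (- 1) = poly Q (- 1)" by (simp add: P_def poly_monom)
  then have "N (poly P (- 1)) \<le> d" using gauss_le_eval[OF Q(1), of "- 1"] by simp
  then have P1: "N (poly P (- 1)) < 1" using small(3) by linarith
  \<comment> \<open>The two leading terms contribute consecutive integers with opposite signs, so
    they leave 1 or -1, a unit in every characteristic.\<close>
  have "poly (pderiv P) (- 1) = of_nat (m + 2) * (- 1) ^ (m + 1) + of_nat (m + 1) * (- 1) ^ m + poly (pderiv Q) (- 1)"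
    by (simp add: P_def pderiv_add pderiv_monom poly_monom)
  also have "of_nat (m + 2) * (- 1) ^ (m + 1) + of_nat (m + 1) * (- 1) ^ m = - ((- 1 :: 'a) ^ m)"
    by (simp add: algebra_simps)
  finally have dP1: "poly (pderiv P) (- 1) = - ((- 1) ^ m) + poly (pderiv Q) (- 1)" .
  have "N (poly (pderiv Q) (- 1)) \<le> d"
    using gauss_le_eval[OF gauss_le_pderiv[OF Q(1)], of "- 1"] by simp
  then have "N (poly (pderiv Q) (- 1)) < N (- ((- 1) ^ m))" using small(3) by (simp add: N_power)
  then have P2: "N (poly (pderiv P) (- 1)) = 1"
    using N_add_eq[of "poly (pderiv Q) (- 1)" "- ((- 1) ^ m)"] by (simp add: dP1 N_power add.commute)
  have "- 1 \<in> E" by (intro sf_minus sf_1 E)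
  then obtain w where w: "w \<in> E" "poly P w = 0" "N (w - (- 1)) < 1"
    using henselianD[OF E(2) lP PE gP _ _ P1 P2] by auto
  have Nw: "N w = 1" using N_close_eq[of w "- 1"] w(3) by simp
  then have w0: "w \<noteq> 0" by auto
  have "(\<Sum>j\<le>m + 2. a j * (u / w) ^ j) * w ^ (m + 2) = (\<Sum>j\<le>m + 2. a j * u ^ j * w ^ (m + 2 - j))"
    unfolding sum_distrib_right
  proof (rule sum.cong)
    fix j assume "j \<in> {..m + 2}"
    then have "w ^ (m + 2) = w ^ j * w ^ (m + 2 - j)" by (simp flip: power_add)
    then show "a j * (u / w) ^ j * w ^ (m + 2) = a j * u ^ j * w ^ (m + 2 - j)"
      using w0 by (simp add: power_divide)
  qed simp
  also have "(\<Sum>j\<le>m + 2. a j * u ^ j * w ^ (m + 2 - j)) =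
      a 0 * w ^ (m + 2) + (a 1 * u * w ^ (m + 1) + (\<Sum>j\<in>{2..m + 2}. a j * u ^ j * w ^ (m + 2 - j)))"
  proof -
    have "{..m + 2} = insert 0 (insert 1 {2..m + 2})" by auto
    then show ?thesis by (simp only: sum.insert finite_insert finite_atLeastAtMost) simp
  qed
  also have "(\<Sum>j\<in>{2..m + 2}. a j * u ^ j * w ^ (m + 2 - j)) = a 1 * u * poly Q w"
    unfolding Q_def poly_sum poly_monom sum_distrib_left
  proof (rule sum.cong)
    fix j assume "j \<in> {2..m + 2}"
    then have "u ^ j = u * u ^ (j - 1)" by (cases j) auto
    then show "a j * u ^ j * w ^ (m + 2 - j) = a 1 * u * (b j * w ^ (m + 2 - j))"
      using u(2) by (simp add: b_def)
  qed simp
  also have "a 0 * w ^ (m + 2) + (a 1 * u * w ^ (m + 1) + a 1 * u * poly Q w) = a 1 * u * poly P w"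
    by (simp add: P_def poly_monom u algebra_simps)
  finally have "(\<Sum>j\<le>m + 2. a j * (u / w) ^ j) * w ^ (m + 2) = 0" unfolding w(2) mult_zero_right .
  moreover have "w ^ (m + 2) \<noteq> 0" using w0 by (rule power_not_zero)
  ultimately have "(\<Sum>j\<le>m + 2. a j * (u / w) ^ j) = 0" by (meson mult_eq_0_iff)
  then show ?thesis using w(1) Nw by blast
qed

text \<open>\<open>E\<close> need not be closed, so density of \<open>K\<close> alone does not
  suffice. Hensel's lemma, started at an element of \<open>K\<close> close to \<open>y\<close>,
  yields a root of \<open>g\<close> in \<open>E\<close> so close to \<open>y\<close> that it equals
  \<open>y\<close>.\<close>

lemma simple_root_in_henselian:
  assumes E: "subfield E Kbar" "K \<subseteq> E" "henselian v E"
    and y: "y \<in> C" and g: "poly_over K g" "poly g y = 0" "poly (pderiv g) y \<noteq> 0"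
  shows "y \<in> E"
proof -
  \<comment> \<open>The lemma on \<open>nagata_polynomial\<close> takes sums up to an index m + 2;
    the Taylor coefficients beyond the degree of \<open>g\<close> are 0.\<close>
  define n where "n = degree g + 2"
  define B where "B = max 1 (N y)"
  obtain k where k: "g = [:-y, 1:] * k" using g(2) poly_eq_0_iff_dvd[of g y] by (auto elim: dvdE)
  have factor: "\<exists>k'. h - [:poly h y:] = [:-y, 1:] * k'" for h
  proof -
    have "[:-y, 1:] dvd h - [:poly h y:]" by (simp flip: poly_eq_0_iff_dvd)
    then show ?thesis unfolding dvd_def .
  qed
  obtain k2 where k2: "pderiv g - [:poly (pderiv g) y:] = [:-y, 1:] * k2" using factor by blast
  obtain k3 where k3: "k - [:poly k y:] = [:-y, 1:] * k3" using factor by blast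
  define l where "l = N (poly (pderiv g) y)"
  have l: "l > 0" using g(3) by (simp add: l_def)
  have "pderiv g = k + [:-y, 1:] * pderiv k"
    unfolding k pderiv_mult by (simp add: pderiv_pCons algebra_simps)
  then have ky: "poly k y = poly (pderiv g) y" by simp
  \<comment> \<open>The Hasse derivatives and the three cofactors are put into one finite family to
    obtain a single bound \<open>L\<close> near \<open>y\<close>.\<close>
  define h where "h i = (if i \<le> n then hasse i g else if i = n + 1 then k else if i = n + 2 then k2 else k3)" for i
  obtain L where L: "L \<ge> 1" "\<forall>i\<in>{..n + 3}. \<forall>c. N c \<le> B \<longrightarrow> N (poly (h i) c) \<le> L"
    using poly_bounded_finite[of "{..n + 3}" B h] by auto
  have Lh: "N (poly (hasse i g) c) \<le> L" if "i \<le> n" "N c \<le> B" for i c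
    using L(2)[rule_format, of i c] that by (simp add: h_def)
  have Lk: "N (poly k c) \<le> L" "N (poly k2 c) \<le> L" "N (poly k3 c) \<le> L" if "N c \<le> B" for c
    using L(2)[rule_format, of "n + 1" c] L(2)[rule_format, of "n + 2" c] L(2)[rule_format, of "n + 3" c] that
    by (simp_all add: h_def)
  have near: "N c \<le> B" if "N (c - y) \<le> 1" for c
    using N_add[of "c - y" y] that by (auto simp: B_def le_max_iff_disj)
  \<comment> \<open>Within distance less than \<mu> of \<open>y\<close> there is no other root of
    \<open>g\<close>. Choosing \<open>c\<close> within \<mu>^2 makes the Newton step
    \<open>u\<close> shorter than \<mu>.\<close>
  define \<mu> where "\<mu> = min 1 (l / L)"
  have \<mu>: "0 < \<mu>" "\<mu> \<le> 1" "\<mu> * L \<le> l"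
    using l L(1) by (auto simp: \<mu>_def min_def field_simps)
  obtain c where c: "c \<in> K" "N (y - c) < \<mu> * \<mu>" using cl_D[OF y, of "\<mu> * \<mu>"] \<mu> by auto
  define e where "e = N (c - y)"
  have "e < \<mu> * \<mu>" "0 \<le> e" using c(2) by (auto simp: e_def N_minus_commute)
  moreover have "\<mu> * \<mu> \<le> \<mu> * 1" using \<mu> by (intro mult_left_mono) auto
  ultimately have e: "e < \<mu> * \<mu>" "e < \<mu>" "e \<le> 1" "0 \<le> e" using \<mu>(2) by linarith+
  have cB: "N c \<le> B" using near e by (simp add: e_def)
  define a where "a j = poly (hasse j g) c" for j
  have aK: "a j \<in> K" for j
    unfolding a_def by (intro poly_over_eval poly_over_hasse K g c)
  have "poly (pderiv g) c - poly (pderiv g) y = (c - y) * poly k2 c"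
    using arg_cong[OF k2, of "\<lambda>h. poly h c"] by (simp add: algebra_simps)
  moreover have "N ((c - y) * poly k2 c) < l"
  proof -
    have "e * N (poly k2 c) \<le> e * L" using Lk[OF cB] e by (intro mult_left_mono) auto
    also have "\<dots> < \<mu> * L" using e L by (intro mult_strict_right_mono) auto
    finally show ?thesis using \<mu> by (simp add: N_mult e_def)
  qed
  ultimately have Na1: "N (a 1) = l"
    using N_close_eq[of "poly (pderiv g) c" "poly (pderiv g) y"] hasse_1[of g c] by (simp add: a_def l_def)
  then have a1: "a 1 \<noteq> 0" using l by auto
  define u where "u = a 0 / a 1"
  have "a 0 = poly g c" by (simp add: a_def poly_hasse)
  then have "a 0 = (c - y) * poly k c" unfolding k by (simp add: algebra_simps)
  then have "N (a 0) \<le> e * L" using Lk[OF cB] e by (auto simp: N_mult e_def intro!: mult_left_mono)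
  then have "N u * l \<le> e * L" using a1 l Na1 by (simp add: u_def N_divide)
  then have "N u * (\<mu> * L) \<le> e * L" using mult_left_mono[OF \<mu>(3) N_nonneg[of u]] by linarith
  then have "N u * \<mu> \<le> e" using L(1) by (simp add: mult.assoc[symmetric])
  then have "N u * \<mu> < \<mu> * \<mu>" using e by linarith
  then have Nu: "N u < \<mu>" using \<mu> by simp
  have "\<exists>w\<in>E. N w = 1 \<and> (\<Sum>j\<le>degree g + 2. a j * (u / w) ^ j) = 0"
  proof (rule nagata_polynomial[OF E(1,3)])
    show "a j \<in> E" for j using aK E by auto
    show "u \<in> E" unfolding u_def using aK E by (intro sf_divide) auto
    show "a 0 = a 1 * u" "a 1 \<noteq> 0" using a1 by (auto simp: u_def)
    show "N (a j * u ^ (j - 1) / a 1) \<le> N u / \<mu>" if j: "2 \<le> j" "j \<le> degree g + 2" for j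
    proof -
      have "N u ^ (j - 1) \<le> N u ^ 1" using j Nu \<mu> by (intro power_decreasing) auto
      moreover have "N (a j) \<le> L" using Lh[of j c] j cB by (simp add: a_def n_def)
      ultimately have "N (a j) * N u ^ (j - 1) \<le> L * N u" using L by (intro mult_mono) auto
      then have "N (a j * u ^ (j - 1) / a 1) \<le> L * N u / l"
        unfolding N_divide N_mult N_power Na1 using l by (intro divide_right_mono) auto
      also have "\<dots> \<le> N u / \<mu>"
        using mult_right_mono[OF \<mu>(3), of "N u"] \<mu> l by (simp add: field_simps)
      finally show ?thesis .
    qed
    show "0 \<le> N u / \<mu>" "N u / \<mu> < 1" using Nu \<mu> by auto
  qed
  then obtain w where w: "w \<in> E" "N w = 1" "(\<Sum>j\<le>n. a j * (u / w) ^ j) = 0"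
    unfolding n_def by blast
  define x where "x = c + u / w"
  have xE: "x \<in> E" unfolding x_def u_def using c aK E w by (intro sf_add sf_divide) auto
  have "poly g x = poly (pcompose g [:c, 1:]) (u / w)" by (simp add: poly_pcompose x_def)
  also have "\<dots> = (\<Sum>j\<le>n. coeff (pcompose g [:c, 1:]) j * (u / w) ^ j)"
    unfolding poly_altdef by (rule sum.mono_neutral_left) (auto simp: n_def degree_pcompose coeff_eq_0)
  also have "\<dots> = 0" using w(3) by (simp add: a_def poly_hasse)
  finally have gx: "poly g x = 0" .
  have "x - y = (c - y) + u / w" by (simp add: x_def)
  moreover have "N (u / w) < \<mu>" using Nu w(2) by (simp add: N_divide)
  ultimately have xy: "N (x - y) < \<mu>"
    using N_add[of "c - y" "u / w"] e(2) unfolding e_def by (metis le_less_trans max_less_iff_conj)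
  have "x = y"
  proof (rule ccontr)
    assume "x \<noteq> y"
    then have "poly k x = 0" using gx unfolding k by simp
    then have "- poly k y = (x - y) * poly k3 x"
      using arg_cong[OF k3, of "\<lambda>h. poly h x"] by (simp add: algebra_simps)
    then have "l = N (x - y) * N (poly k3 x)"
      using N_minus[of "poly k y"] by (simp only: l_def ky N_mult)
    also have "\<dots> \<le> N (x - y) * L" using Lk(3)[OF near] xy \<mu> by (intro mult_left_mono) auto
    also have "\<dots> < \<mu> * L" using xy L by (intro mult_strict_right_mono) auto
    finally show False using \<mu> by simp
  qed
  then show ?thesis using xE by simp
qed

lemma pderiv_eq_0_imp_power:
  assumes g: "poly_over K g" "pderiv g = 0" "degree g > 0" "lead_coeff g = 1"
  shows "\<exists>h. poly_over K h \<and> h \<noteq> 0 \<and> degree h < degree g \<and> (\<forall>y. poly h (y ^ p) = poly g y)"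
proof -
  have zero: "coeff g i = 0" if "\<not> p dvd i" for i
  proof (cases i)
    case (Suc j)
    have "of_nat i * coeff g i = 0"
      using arg_cong[OF g(2), of "\<lambda>h. coeff h j"] Suc by (simp add: coeff_pderiv)
    moreover have "of_nat i \<noteq> (0 :: 'a)" using that p(2) by (simp add: of_nat_eq_0_iff_char_dvd)
    ultimately show ?thesis by simp
  qed (use that in simp)
  define h where "h = (\<Sum>j\<le>degree g div p. monom (coeff g (p * j)) j)"
  have "degree h \<le> degree g div p"
    unfolding h_def by (intro degree_sum_le) (auto intro!: order_trans[OF degree_monom_le])
  moreover have "degree g div p < degree g" using g(3) p_gt_1 by simp
  moreover have "poly_over K h"
    unfolding h_def by (intro poly_over_sum poly_over_monom K poly_over_coeff g)
  moreover have hy: "poly h (y ^ p) = poly g y" for y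
  proof -
    have "poly h (y ^ p) = (\<Sum>j\<le>degree g div p. coeff g (p * j) * y ^ (p * j))"
      by (simp add: h_def poly_sum poly_monom power_mult)
    also have "\<dots> = (\<Sum>i\<in>(\<lambda>j. p * j) ` {..degree g div p}. coeff g i * y ^ i)"
      using p_pos by (subst sum.reindex) (auto simp: inj_on_def)
    also have "\<dots> = (\<Sum>i\<le>degree g. coeff g i * y ^ i)"
    proof (rule sum.mono_neutral_left)
      show "(\<lambda>j. p * j) ` {..degree g div p} \<subseteq> {..degree g}"
      proof clarsimp
        fix j assume "j \<le> degree g div p"
        then have "p * j \<le> p * (degree g div p)" by simp
        also have "\<dots> \<le> degree g" by simp
        finally show "p * j \<le> degree g" .
      qed
      show "\<forall>i\<in>{..degree g} - (\<lambda>j. p * j) ` {..degree g div p}. coeff g i * y ^ i = 0"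
      proof
        fix i assume i: "i \<in> {..degree g} - (\<lambda>j. p * j) ` {..degree g div p}"
        have "\<not> p dvd i"
        proof
          assume "p dvd i"
          then have "i = p * (i div p)" "i div p \<le> degree g div p" using i by (auto intro: div_le_mono)
          then show False using i by blast
        qed
        then show "coeff g i * y ^ i = 0" using zero by simp
      qed
    qed simp
    finally show ?thesis by (simp add: poly_altdef)
  qed
  moreover have "h \<noteq> 0"
  proof
    \<comment> \<open>Then \<open>g\<close> would vanish at every point, while g + 1 has a
      root.\<close>
    assume "h = 0"
    then have "poly g y = 0" for y using hy[of y] by simp
    moreover have "degree (g + 1) > 0" using g(3) by (simp add: degree_add_eq_left)
    then obtain y where "poly (g + 1) y = 0" using has_root by blast
    ultimately show False by simp
  qed
  ultimately show ?thesis by (intro exI[of _ h]) auto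
qed

text \<open>An inseparable minimal polynomial is a polynomial in X^p, so y^p has smaller degree; a
  separable one is handled by \<open>simple_root_in_henselian\<close>. The exponent is chosen before
  \<open>E\<close>, so the power lies in the intersection of all such \<open>E\<close>.\<close>

lemma closure_power_in_henselian:
  "y \<in> C \<Longrightarrow> \<exists>k. \<forall>E. subfield E Kbar \<longrightarrow> K \<subseteq> E \<longrightarrow> henselian v E \<longrightarrow> y ^ (p ^ k) \<in> E"
proof (induct "mdeg K y" arbitrary: y rule: less_induct)
  case less
  obtain g where g: "min_poly K y g" using K_min_poly by blast
  note gD = min_polyD[OF g]
  show ?case
  proof (cases "poly (pderiv g) y = 0")
    case False
    then show ?thesis
      using simple_root_in_henselian[OF _ _ _ less(2) gD(1,3)] by (intro exI[of _ 0]) simp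
  next
    case True
    have "degree (pderiv g) \<le> degree g - 1"
      by (rule degree_le) (auto simp: coeff_pderiv coeff_eq_0)
    then have "degree (pderiv g) < degree g" using min_poly_degree_pos[OF g] by simp
    then have "pderiv g = 0"
      using gD(5)[OF poly_over_pderiv[OF K gD(1)] True] by fastforce
    then obtain h where h: "poly_over K h" "h \<noteq> 0" "degree h < degree g" "\<And>y. poly h (y ^ p) = poly g y"
      using pderiv_eq_0_imp_power[OF gD(1) _ min_poly_degree_pos[OF g] gD(2)] by blast
    have "mdeg K (y ^ p) \<le> degree h"
      using gD(3) by (intro mdeg_le[OF K h(1) _ h(2)]) (simp add: h(4))
    also have "\<dots> < mdeg K y" using h(3) mdeg_eq[OF K g] by simp
    finally obtain k where k: "\<forall>E. subfield E Kbar \<longrightarrow> K \<subseteq> E \<longrightarrow> henselian v E \<longrightarrow> (y ^ p) ^ (p ^ k) \<in> E"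
      using less(1)[of "y ^ p"] sf_power[OF C(1) less(2)] by blast
    then show ?thesis by (intro exI[of _ "Suc k"]) (simp add: power_mult)
  qed
qed

abbreviation Kh :: "'a set" where "Kh \<equiv> henselization v K"

lemma Kh_subfield: "subfield Kh Kbar" and Kh_incl: "K \<subseteq> Kh" and Kh_subset_C: "Kh \<subseteq> C"
proof -
  show "subfield Kh Kbar" unfolding henselization_def by (rule subfield_Inter) auto
  show "K \<subseteq> Kh" by (auto simp: henselization_def)
  have "henselian v C" by (rule algebraic_extension_henselian[OF C(1)]) simp
  then show "Kh \<subseteq> C" using C(1) subset_cl by (auto simp: henselization_def)
qed

lemma closure_power_in_Kh:
  assumes "y \<in> C"
  shows "\<exists>k. y ^ (p ^ k) \<in> Kh"
  using closure_power_in_henselian[OF assms] by (auto simp: henselization_def)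

lemma closure_powers_in_Kh:
  assumes "finite Y" "Y \<subseteq> C"
  shows "\<exists>k. \<forall>y\<in>Y. y ^ (p ^ k) \<in> Kh"
  using assms
proof (induct Y)
  case (insert y Y)
  then obtain k l where kl: "\<forall>y\<in>Y. y ^ (p ^ k) \<in> Kh" "y ^ (p ^ l) \<in> Kh"
    using closure_power_in_Kh[of y] by auto
  have "x ^ (p ^ (k + l)) = (x ^ (p ^ k)) ^ (p ^ l)" "x ^ (p ^ (k + l)) = (x ^ (p ^ l)) ^ (p ^ k)" for x :: 'a
    by (simp_all add: power_add mult.commute flip: power_mult)
  then show ?case
    using kl sf_power[OF Kh_subfield] by (intro exI[of _ "k + l"]) (metis insert_iff)
qed simp

lemma frob_inj: "x ^ (p ^ k) = y ^ (p ^ k) \<Longrightarrow> x = (y :: 'a)"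
proof (induct k)
  case (Suc k)
  then have "(x ^ (p ^ k) - y ^ (p ^ k)) ^ p = 0"
    by (simp add: frob_diff mult.commute flip: power_mult)
  then show ?case using Suc(1) by simp
qed simp

text \<open>The Hensel root lies in C(\<alpha>), and a p-power of it lies in Kh(\<alpha>) because
  this holds for the coefficients from \<open>C\<close>. It is thus the only root of its minimal
  polynomial over Kh(\<alpha>), and a simple one.\<close>

lemma adjoin_Kh_henselian: "henselian v (adjoin Kh {\<alpha>})"
  unfolding henselian_def
proof (intro allI ballI impI)
  let ?E = "adjoin Kh {\<alpha>}" and ?M = "adjoin C {\<alpha>}"
  have E: "subfield ?E Kbar" and M: "subfield ?M Kbar" by (rule adjoin_subfield)+
  have EM: "?E \<subseteq> ?M"
    by (rule adjoin_subset[OF M]) (use Kh_subset_C adjoin_incl in blast)+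
  have hM: "henselian v ?M" by (rule algebraic_extension_henselian[OF M]) (rule adjoin_incl)
  fix f x
  assume x: "x \<in> valuation_ring v ?E" and f: "lead_coeff f = 1" "\<forall>i. coeff f i \<in> valuation_ring v ?E"
    and small: "0 < v (poly f x)" and unit: "v (poly (pderiv f) x) = 0"
  have f1: "gauss_le 1 f 1" "poly_over ?E f"
    using f(2) by (auto simp: gauss_le_def valuation_ring_iff poly_over_def)
  have x1: "x \<in> ?E" "N x \<le> 1" using x by (auto simp: valuation_ring_iff)
  have su: "N (poly f x) < 1" "N (poly (pderiv f) x) = 1"
    using small unit by (simp_all add: N_less_1_iff N_eq_1_iff)
  obtain y where y: "poly f y = 0" "N (y - x) < 1" "poly (pderiv f) y \<noteq> 0"
    "\<And>z. poly f z = 0 \<Longrightarrow> N (z - x) < 1 \<Longrightarrow> z = y"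
    by (rule hensel_root[OF f(1) f1(1) x1(2) su]) blast
  have "\<exists>y\<in>?M. poly f y = 0 \<and> N (y - x) < 1"
    by (rule henselianD[OF hM f(1) poly_over_mono[OF f1(2) EM] f1(1) _ x1(2) su]) (use EM x1 in blast)
  then have "y \<in> ?M" using y(4) by blast
  obtain F where F: "min_poly C \<alpha> F" using C_min_poly by blast
  obtain g where g: "poly_over C g" "y = poly g \<alpha>"
    using \<open>y \<in> ?M\<close> unfolding adjoin_eq[OF C(1) F] by blast
  obtain k where k: "\<forall>c\<in>coeff g ` {..degree g}. c ^ (p ^ k) \<in> Kh"
    using closure_powers_in_Kh[of "coeff g ` {..degree g}"] poly_over_coeff[OF g(1)] by blast
  define q where "q = p ^ k"
  have "y ^ q = (\<Sum>i\<le>degree g. (coeff g i * \<alpha> ^ i) ^ q)"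
    unfolding g(2) poly_altdef q_def by (rule freshmans_dream_sum') (use p in auto)
  also have "\<dots> = (\<Sum>i\<le>degree g. coeff g i ^ q * (\<alpha> ^ i) ^ q)" by (simp add: power_mult_distrib)
  also have "\<dots> \<in> ?E"
  proof (intro sf_sum sf_mult E)
    fix i assume "i \<in> {..degree g}"
    then have "coeff g i ^ q \<in> Kh" using k by (simp add: q_def)
    then show "coeff g i ^ q \<in> ?E" using adjoin_incl(1)[of Kh] by blast
    have "\<alpha> \<in> ?E" using adjoin_incl(2)[where S = "{\<alpha>}"] by blast
    then show "(\<alpha> ^ i) ^ q \<in> ?E" by (intro sf_power E)
  qed
  finally have yq: "y ^ q \<in> ?E" .
  have fn: "f \<noteq> 0" using f(1) by auto
  obtain m where m: "min_poly ?E y m" using min_poly_exists[OF E f1(2) fn y(1)] by blast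
  have mf: "m dvd f" by (rule min_poly_dvd[OF E m f1(2) y(1)])
  have mq: "m dvd monom 1 q - [:y ^ q:]"
    by (rule min_poly_dvd[OF E m])
      (auto simp: poly_monom intro!: poly_over_diff poly_over_monom poly_over_pCons poly_over_0 sf_1 E yq)
  have roots: "w = y" if "poly m w = 0" for w
  proof -
    obtain m' where m': "monom 1 q - [:y ^ q:] = m * m'" using mq by (elim dvdE)
    have "poly (monom 1 q - [:y ^ q:]) w = 0" unfolding m' using that by simp
    then show ?thesis using frob_inj[of w k y] by (simp add: poly_monom q_def)
  qed
  have "y \<in> ?E" by (rule unique_simple_root_mem[OF E m mf y(3) roots])
  then show "\<exists>y\<in>?E. poly f y = 0 \<and> 0 < v (y - x)"
    using y(1,2) by (auto simp: N_less_1_iff)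
qed

lemma henselization_adjoin: "henselization v (adjoin K {\<alpha>}) = adjoin Kh {\<alpha>}"
proof
  have "adjoin K {\<alpha>} \<subseteq> adjoin Kh {\<alpha>}"
    by (rule adjoin_subset[OF adjoin_subfield]) (use Kh_incl adjoin_incl in blast)+
  then show "henselization v (adjoin K {\<alpha>}) \<subseteq> adjoin Kh {\<alpha>}"
    using adjoin_Kh_henselian adjoin_subfield unfolding henselization_def[of _ "adjoin K {\<alpha>}"] by blast
  show "adjoin Kh {\<alpha>} \<subseteq> henselization v (adjoin K {\<alpha>})"
    unfolding henselization_def[of _ "adjoin K {\<alpha>}"]
  proof (rule Inter_greatest)
    fix E assume "E \<in> {E. subfield E Kbar \<and> adjoin K {\<alpha>} \<subseteq> E \<and> henselian v E}"
    then have E: "subfield E Kbar" "adjoin K {\<alpha>} \<subseteq> E" "henselian v E" by auto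
    then have "K \<subseteq> E" "\<alpha> \<in> E" using adjoin_incl[where E = K and S = "{\<alpha>}"] by auto
    then have "Kh \<subseteq> E" using E by (auto simp: henselization_def)
    then show "adjoin Kh {\<alpha>} \<subseteq> E" using \<open>\<alpha> \<in> E\<close> by (intro adjoin_subset E) auto
  qed
qed

end

section \<open>Artin-Schreier extensions without defect\<close>

lemma coeff_prod_mset_linear_subleading:
  "A \<noteq> {#} \<Longrightarrow> coeff (\<Prod>x\<in>#A. [:-x, 1:]) (size A - 1) = - (\<Sum>\<^sub># A :: 'a::field)"
proof (induct A)
  case (add x A)
  let ?P = "\<Prod>x\<in>#A. [:-x, 1:]"
  have "coeff ?P (size A) = 1"
    using lead_coeff_prod_mset_linear[of A] degree_prod_mset_linear[of A] by simp
  then have *: "coeff ([:-x, 1:] * ?P) (size A) = coeff (pCons 0 ?P) (size A) - x" by simp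
  show ?case
  proof (cases "A = {#}")
    case False
    then obtain n where n: "size A = Suc n" by (metis gr0_implies_Suc nonempty_has_size)
    then show ?thesis using * add(1)[OF False] by (simp del: mult_pCons_left)
  qed simp
qed simp

context rank_one_char
begin

lemma N_sum_mset_less:
  "(\<And>a. a \<in># A \<Longrightarrow> N (f a) < 1) \<Longrightarrow> N (\<Sum>a\<in>#A. f a) < 1"
proof (induct A)
  case (add a A)
  then have "N (f a) < 1" "N (\<Sum>a\<in>#A. f a) < 1" by auto
  then show ?case using N_add[of "f a" "\<Sum>a\<in>#A. f a"] by simp
qed simp

lemma gauss_le_roots:
  assumes "\<And>a. a \<in># A \<Longrightarrow> N a \<le> r a \<and> 1 \<le> r a"
  shows "gauss_le 1 (\<Prod>a\<in>#A. [:-a, 1:]) (\<Prod>a\<in>#A. r a)"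
  using assms
proof (induct A)
  case empty
  show ?case by (auto simp: gauss_le_def one_pCons coeff_pCons split: nat.splits)
next
  case (add a A)
  have "gauss_le 1 ([:-a, 1:] * (\<Prod>a\<in>#A. [:-a, 1:])) (r a * (\<Prod>a\<in>#A. r a))"
    using add by (intro gauss_le_mult gauss_le_linear) auto
  then show ?case by (simp del: mult_pCons_left)
qed

context
  fixes \<alpha>
  assumes \<alpha>: "\<alpha> ^ p - \<alpha> \<in> K" "N \<alpha> \<le> 1"
begin

text \<open>The conjugates of \<open>\<xi>\<close> are congruent to conjugates of \<open>\<alpha>\<close>, so their sum is congruent to \<open>e\<alpha> + c\<close> with
  \<open>e\<close> prime to \<open>p\<close> and \<open>c\<close> in the prime field.\<close>

lemma close_element_of_K:
  assumes \<xi>: "N (\<alpha> - \<xi>) < 1" "mdeg C \<xi> < p"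
  shows "\<exists>x\<in>K. N (\<alpha> - x) < 1"
proof -
  obtain F where F: "min_poly C \<xi> F" using C_min_poly by blast
  obtain A where A: "size A = degree F" "F = (\<Prod>a\<in>#A. [:-a, 1:])"
    using factorization[OF min_polyD(2)[OF F]] by blast
  define e where "e = size A"
  have e: "0 < e" "e < p"
    using min_poly_degree_pos[OF F] \<xi>(2) C_mdeg[OF F] A(1) by (auto simp: e_def)
  define s where "s = \<alpha> ^ p - \<alpha>"
  let ?g = "monom 1 p - [:s, 1:]"
  have g: "poly_over C ?g"
    using poly_over_AS[OF C(1)] \<alpha>(1) subset_cl by (auto simp: s_def)
  have gx: "poly ?g x = (x - \<alpha>) ^ p - (x - \<alpha>)" for x
    unfolding poly_AS frob_diff s_def by (simp add: algebra_simps)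
  have "N (poly ?g \<xi>) < 1"
  proof -
    have "N (\<xi> - \<alpha>) < 1" using \<xi>(1) by (simp add: N_minus_commute)
    moreover from this have "N ((\<xi> - \<alpha>) ^ p) < 1"
      using p_pos by (simp add: N_power power_less_one_iff)
    ultimately show ?thesis unfolding gx using N_diff[of "(\<xi> - \<alpha>) ^ p" "\<xi> - \<alpha>"] by simp
  qed
  then have "N (poly ?g a) < 1" if "a \<in># A" for a
    using conj_norm_eq[OF F _ g, of a] that poly_prod_mset_linear_eq_0_iff[of A a] A(2) by simp
  then have "N (\<Prod>c\<in>Fp. a - \<alpha> - c) < 1" if "a \<in># A" for a
    using that unfolding gx prod_AS by blast
  then have "\<exists>c\<in>Fp. N (a - \<alpha> - c) < 1" if "a \<in># A" for a
    using that prod_ge_1[of Fp "\<lambda>c. N (a - \<alpha> - c)"] unfolding N_prod by force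
  then obtain c where c: "\<And>a. a \<in># A \<Longrightarrow> c a \<in> Fp \<and> N (a - \<alpha> - c a) < 1" by metis
  have sum: "N (\<Sum>a\<in>#A. a - \<alpha> - c a) < 1" by (rule N_sum_mset_less) (use c in auto)
  have sum_eq: "(\<Sum>a\<in>#A. a - \<alpha> - c a) = \<Sum>\<^sub># A - of_nat e * \<alpha> - (\<Sum>a\<in>#A. c a)"
    unfolding e_def by (induct A) (simp_all add: algebra_simps)
  have "coeff F (degree F - 1) = - \<Sum>\<^sub># A"
  proof -
    have "A \<noteq> {#}" using e by (auto simp: e_def)
    then show ?thesis
      unfolding A(1)[symmetric] by (subst A(2)) (rule coeff_prod_mset_linear_subleading)
  qed
  then have "\<Sum>\<^sub># A \<in> C"
    using sf_minus[OF C(1) poly_over_coeff[OF min_polyD(1)[OF F]]] by (metis minus_minus)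
  moreover have "(\<Sum>a\<in>#A. c a) \<in> Fp"
    using c by (induct A) (auto intro: sf_0 sf_add subfield_Fp)
  ultimately have diff: "\<Sum>\<^sub># A - (\<Sum>a\<in>#A. c a) \<in> C"
    using Fp_subset[OF C(1)] by (intro sf_diff C) auto
  have e0: "of_nat e \<noteq> (0 :: 'a)"
    using e p(2) by (auto simp: of_nat_eq_0_iff_char_dvd dest: dvd_imp_le)
  \<comment> \<open>Division by \<open>e\<close> preserves the congruence since 0 < e < p makes
    \<open>e\<close> a unit. The result is an element of \<open>C\<close> congruent to \<alpha>, and
    density of \<open>K\<close> finishes.\<close>
  define x where "x = (\<Sum>\<^sub># A - (\<Sum>a\<in>#A. c a)) / of_nat e"
  have xC: "x \<in> C" unfolding x_def by (intro sf_divide C diff sf_of_nat)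
  have "of_nat e * (x - \<alpha>) = (\<Sum>a\<in>#A. a - \<alpha> - c a)"
    unfolding sum_eq x_def using e0 by (simp add: field_simps)
  then have "N (of_nat e) * N (x - \<alpha>) < 1" using sum by (simp flip: N_mult)
  then have x\<alpha>: "N (x - \<alpha>) < 1" using N_of_nat_eq_1[OF _ e0] p by simp
  obtain k where k: "k \<in> K" "N (x - k) < 1" using cl_D[OF xC, of 1] by auto
  have "N (\<alpha> - k) < 1"
    using N_triangle[of \<alpha> k x] x\<alpha> k(2) by (simp add: N_minus_commute)
  then show ?thesis using k by blast
qed

text \<open>The powers of \<alpha> below p are thus norm-orthogonal over \<open>K\<close>. A root a
  of \<open>g\<close> has degree less than p, so it is at distance at least 1 from \<alpha>; hence
  max(1, N a) \<le> N (\<alpha> - a), and multiplying over the roots bounds the Gauss norm by the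
  norm of g(\<alpha>).\<close>

lemma gauss_norm_at_\<alpha>:
  assumes far: "\<And>x. x \<in> K \<Longrightarrow> 1 \<le> N (\<alpha> - x)" and g: "poly_over K g" "degree g < p"
  shows "gauss_le 1 g (N (poly g \<alpha>))"
proof (cases "g = 0")
  case False
  define l where "l = lead_coeff g"
  have l: "l \<noteq> 0" using False by (simp add: l_def)
  have "lead_coeff (smult (inverse l) g) = 1" using l by (simp add: l_def)
  then obtain A where A: "smult (inverse l) g = (\<Prod>a\<in>#A. [:-a, 1:])"
    using factorization by blast
  have gA: "g = smult l (\<Prod>a\<in>#A. [:-a, 1:])" using l by (simp flip: A)
  have "N a \<le> N (\<alpha> - a) \<and> 1 \<le> N (\<alpha> - a)" if a: "a \<in># A" for a
  proof -
    have "poly g a = 0" using a poly_prod_mset_linear_eq_0_iff[of A a] by (simp add: gA)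
    then have "mdeg K a \<le> degree g" by (intro mdeg_le[OF K g(1)] False)
    then have "mdeg C a < p" using mdeg_C_le[of a] g(2) by linarith
    then have "1 \<le> N (\<alpha> - a)" using close_element_of_K[of a] far by (meson not_le)
    moreover have "N a \<le> max (N \<alpha>) (N (\<alpha> - a))" using N_diff[of \<alpha> "\<alpha> - a"] by simp
    ultimately show ?thesis using \<alpha>(2) by auto
  qed
  then have "gauss_le 1 g (N l * (\<Prod>a\<in>#A. N (\<alpha> - a)))"
    unfolding gA by (intro gauss_le_smult gauss_le_roots) auto
  also have "N l * (\<Prod>a\<in>#A. N (\<alpha> - a)) = N (poly g \<alpha>)"
    by (simp only: gA poly_smult N_mult poly_prod_mset_linear N_prod_mset)
  finally show ?thesis .
qed (simp add: gauss_le_0)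

end

subsection \<open>The residue field\<close>

definition res :: "'a \<Rightarrow> 'a set" where
  "res x = maximal_ideal v +>\<^bsub>Kbar\<^esub> x"

abbreviation (input) VR :: "'a ring" where
  "VR \<equiv> Kbar \<lparr>carrier := valuation_ring v UNIV\<rparr>"

lemma res_eq_iff: "res x = res y \<longleftrightarrow> N (x - y) < 1"
proof
  have r: "res x = (\<lambda>h. h + x) ` {h. N h < 1}" for x
    unfolding res_def a_r_coset_def' by (auto simp: maximal_ideal_iff)
  show "N (x - y) < 1" if "res x = res y"
  proof -
    have "x \<in> res x" unfolding r by (auto intro!: image_eqI[of _ _ 0])
    then show ?thesis unfolding that unfolding r by auto
  qed
  have sub: "res x \<subseteq> res y" if "N (x - y) < 1" for x y
  proof
    fix z assume "z \<in> res x"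
    then obtain h where h: "N h < 1" "z = h + x" unfolding r by auto
    then have "z = (h + (x - y)) + y" "N (h + (x - y)) < 1"
      using that N_add[of h "x - y"] by auto
    then show "z \<in> res y" unfolding r by blast
  qed
  show "res x = res y" if "N (x - y) < 1"
    using sub[of x y] sub[of y x] that by (auto simp: N_minus_commute)
qed

lemma residue_field_eq: "residue_field v F = res ` valuation_ring v F"
  by (simp add: residue_field_def res_def)

lemma ring_VR: "cring VR"
proof -
  interpret R: Ring.field "Kbar :: 'a ring" by (rule field_Kbar)
  have "subring (valuation_ring v UNIV) (Kbar :: 'a ring)"
  proof (rule R.subringI)
    fix x y assume "x \<in> valuation_ring v UNIV" "y \<in> valuation_ring v UNIV"
    then show "x \<otimes>\<^bsub>Kbar\<^esub> y \<in> valuation_ring v UNIV" "x \<oplus>\<^bsub>Kbar\<^esub> y \<in> valuation_ring v UNIV"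
      using N_add[of x y] by (auto simp: valuation_ring_iff N_mult mult_le_one)
  qed (auto simp: valuation_ring_iff)
  then show ?thesis using R.subcring_iff[of "valuation_ring v UNIV"] R.subcringI' by simp
qed

lemma ideal_VR: "ideal (maximal_ideal v) VR"
proof (rule idealI)
  show "Ring.ring VR" using ring_VR by (rule cring.axioms)
  interpret VR: cring VR by (rule ring_VR)
  show "subgroup (maximal_ideal v) (add_monoid VR)"
  proof (rule VR.add.subgroupI)
    show "maximal_ideal v \<noteq> {}" using maximal_ideal_iff[of 0] by auto
    fix x assume x: "x \<in> maximal_ideal v"
    then have "x \<in> carrier VR" by (simp add: maximal_ideal_iff valuation_ring_iff)
    moreover have "- x \<in> carrier VR" using x by (simp add: maximal_ideal_iff valuation_ring_iff)
    ultimately have "\<ominus>\<^bsub>VR\<^esub> x = - x" by (intro VR.minus_equality) auto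
    then show "\<ominus>\<^bsub>VR\<^esub> x \<in> maximal_ideal v" using x by (simp add: maximal_ideal_iff)
    fix y assume "y \<in> maximal_ideal v"
    then show "x \<oplus>\<^bsub>VR\<^esub> y \<in> maximal_ideal v"
      using x N_add[of x y] by (simp add: maximal_ideal_iff)
  qed (auto simp: maximal_ideal_iff valuation_ring_iff)
  fix a x assume "a \<in> maximal_ideal v" "x \<in> carrier VR"
  then have "N (x * a) < 1"
    using mult_right_mono[of "N x" 1 "N a"] by (simp add: maximal_ideal_iff valuation_ring_iff N_mult)
  then show "x \<otimes>\<^bsub>VR\<^esub> a \<in> maximal_ideal v" "a \<otimes>\<^bsub>VR\<^esub> x \<in> maximal_ideal v"
    by (auto simp: maximal_ideal_iff mult.commute)
qed

abbreviation RF :: "'a set ring" where "RF \<equiv> residue_ring v"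

lemma cring_RF: "cring RF"
  unfolding residue_ring_def by (rule ideal.quotient_is_cring[OF ideal_VR ring_VR])

lemma res_hom: "res \<in> ring_hom VR RF"
proof -
  have "(+>\<^bsub>VR\<^esub>) (maximal_ideal v) = res"
    by (rule ext) (simp add: res_def a_r_coset_def')
  then show ?thesis
    using ideal.rcos_ring_hom[OF ideal_VR] by (simp add: residue_ring_def)
qed

lemma carrier_RF: "carrier RF = res ` {x. N x \<le> 1}"
  unfolding residue_ring_def FactRing_def A_RCOSETS_def' a_r_coset_def' res_def
  by (auto simp: valuation_ring_iff)

lemma res_add: "N x \<le> 1 \<Longrightarrow> N y \<le> 1 \<Longrightarrow> res x \<oplus>\<^bsub>RF\<^esub> res y = res (x + y)"
  and res_mult: "N x \<le> 1 \<Longrightarrow> N y \<le> 1 \<Longrightarrow> res x \<otimes>\<^bsub>RF\<^esub> res y = res (x * y)"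
  and res_1: "\<one>\<^bsub>RF\<^esub> = res 1"
  using ring_hom_add[OF res_hom, of x y] ring_hom_mult[OF res_hom, of x y] ring_hom_one[OF res_hom]
  by (auto simp: valuation_ring_iff)

lemma res_0: "\<zero>\<^bsub>RF\<^esub> = res 0"
proof -
  interpret RF: cring RF by (rule cring_RF)
  have "res 0 \<in> carrier RF" unfolding carrier_RF by (rule imageI) simp
  moreover have "res 0 \<oplus>\<^bsub>RF\<^esub> res 0 = res 0" using res_add[of 0 0] by simp
  ultimately show ?thesis by (metis RF.add.l_cancel_one)
qed

lemma res_minus: "N x \<le> 1 \<Longrightarrow> \<ominus>\<^bsub>RF\<^esub> res x = res (- x)"
proof -
  assume x: "N x \<le> 1"
  interpret RF: cring RF by (rule cring_RF)
  show ?thesis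
    by (rule RF.minus_equality) (use x res_add[of "- x" x] in \<open>auto simp: res_0 carrier_RF\<close>)
qed

lemma field_RF: "Ring.field RF"
proof -
  interpret RF: cring RF by (rule cring_RF)
  show ?thesis
  proof (rule RF.cring_fieldI2)
    show "\<zero>\<^bsub>RF\<^esub> \<noteq> \<one>\<^bsub>RF\<^esub>" by (simp add: res_0 res_1 res_eq_iff)
    fix a assume a: "a \<in> carrier RF" "a \<noteq> \<zero>\<^bsub>RF\<^esub>"
    then obtain x where x: "a = res x" "N x \<le> 1" by (auto simp: carrier_RF)
    then have Nx: "N x = 1" using a(2) by (simp add: res_0 res_eq_iff)
    then have "x \<noteq> 0" by auto
    then have "x * inverse x = 1" "N (inverse x) \<le> 1" using Nx by (auto simp: N_inverse)
    then have "a \<otimes>\<^bsub>RF\<^esub> res (inverse x) = \<one>\<^bsub>RF\<^esub>" using x res_mult[of x "inverse x"] by (simp add: res_1)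
    then show "\<exists>b\<in>carrier RF. a \<otimes>\<^bsub>RF\<^esub> b = \<one>\<^bsub>RF\<^esub>"
      using \<open>N (inverse x) \<le> 1\<close> by (auto simp: carrier_RF)
  qed
qed

lemma subfield_residue_field:
  assumes F: "subfield F Kbar"
  shows "subfield (residue_field v F) RF"
proof -
  interpret RF: Ring.field RF by (rule field_RF)
  have in_rf: "res x \<in> residue_field v F" if "x \<in> F" "N x \<le> 1" for x
    using that by (auto simp: residue_field_eq valuation_ring_iff)
  have from_rf: "\<exists>x\<in>F. N x \<le> 1 \<and> z = res x" if "z \<in> residue_field v F" for z
    using that by (auto simp: residue_field_eq valuation_ring_iff)
  show ?thesis
  proof (rule RF.subfieldI')
    show "subring (residue_field v F) RF"
    proof (rule RF.subringI)
      show "residue_field v F \<subseteq> carrier RF" using from_rf by (auto simp: carrier_RF)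
      show "\<one>\<^bsub>RF\<^esub> \<in> residue_field v F" unfolding res_1 by (rule in_rf) (auto intro: sf_1 F)
      fix z assume z: "z \<in> residue_field v F"
      then obtain x where x: "x \<in> F" "N x \<le> 1" "z = res x" using from_rf by blast
      then show "\<ominus>\<^bsub>RF\<^esub> z \<in> residue_field v F" by (auto simp: res_minus intro!: in_rf sf_minus F)
      fix z' assume "z' \<in> residue_field v F"
      then obtain y where y: "y \<in> F" "N y \<le> 1" "z' = res y" using from_rf by blast
      show "z \<otimes>\<^bsub>RF\<^esub> z' \<in> residue_field v F" "z \<oplus>\<^bsub>RF\<^esub> z' \<in> residue_field v F"
        using x y N_add[of x y]
        by (auto simp: res_add res_mult N_mult mult_le_one intro!: in_rf sf_add sf_mult F)
    qed
    fix z assume z: "z \<in> residue_field v F - {\<zero>\<^bsub>RF\<^esub>}"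
    then obtain x where x: "x \<in> F" "N x \<le> 1" "z = res x" using from_rf by blast
    then have Nx: "N x = 1" using z by (simp add: res_0 res_eq_iff)
    then have "x \<noteq> 0" by auto
    then have 1: "x * inverse x = 1" "N (inverse x) \<le> 1" using Nx by (auto simp: N_inverse)
    then have "res (inverse x) \<otimes>\<^bsub>RF\<^esub> z = \<one>\<^bsub>RF\<^esub>"
      using x res_mult[of "inverse x" x] by (simp add: res_1 mult.commute)
    then have "inv\<^bsub>RF\<^esub> z = res (inverse x)"
      using x 1 by (intro RF.comm_inv_char) (auto simp: carrier_RF RF.m_comm)
    then show "inv\<^bsub>RF\<^esub> z \<in> residue_field v F" using in_rf[OF sf_inverse[OF F x(1)] 1(2)] by simp
  qed
qed

lemma combine_res:
  "(\<And>c. c \<in> set cs \<Longrightarrow> N c \<le> 1) \<Longrightarrow> (\<And>u. u \<in> set us \<Longrightarrow> N u \<le> 1) \<Longrightarrow>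
   ring.combine RF (map res cs) (map res us) = res (ring.combine Kbar cs us) \<and> N (ring.combine Kbar cs us) \<le> 1"
proof (induct cs arbitrary: us)
  interpret RF: Ring.field RF by (rule field_RF)
  interpret R: Ring.field "Kbar :: 'a ring" by (rule field_Kbar)
  case Nil
  then show ?case by (simp add: res_0)
next
  interpret RF: Ring.field RF by (rule field_RF)
  interpret R: Ring.field "Kbar :: 'a ring" by (rule field_Kbar)
  case (Cons c cs)
  show ?case
  proof (cases us)
    case Nil
    then show ?thesis by (simp add: res_0)
  next
    case (Cons u us')
    have IH: "ring.combine RF (map res cs) (map res us') = res (ring.combine Kbar cs us')"
      "N (ring.combine Kbar cs us') \<le> 1"
      using Cons.hyps[of us'] Cons.prems Cons by auto
    have cu: "N c \<le> 1" "N u \<le> 1" "N (c * u) \<le> 1"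
      using Cons.prems Cons by (auto simp: N_mult mult_le_one)
    then show ?thesis
      using Cons IH N_add[of "c * u" "ring.combine Kbar cs us'"] by (simp add: res_add res_mult)
  qed
qed

section \<open>Value groups, and the defect of Artin-Schreier extensions at distance at most
  1\<close>

lemma value_group_add:
  assumes F: "subfield F Kbar" and g: "g \<in> value_group v F" "h \<in> value_group v F"
  shows "g + h \<in> value_group v F"
proof -
  obtain x y where "x \<in> F" "v x = Fin g" "y \<in> F" "v y = Fin h" using g by (auto simp: value_group_def)
  then show ?thesis using v_mult[of x y] sf_mult[OF F, of x y] by (auto simp: value_group_def)
qed

lemma value_group_uminus:
  assumes F: "subfield F Kbar" and g: "g \<in> value_group v F"
  shows "- g \<in> value_group v F"
proof -
  obtain x where x: "x \<in> F" "v x = Fin g" using g by (auto simp: value_group_def)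
  then have x0: "x \<noteq> 0" by auto
  then obtain h where h: "v (inverse x) = Fin h" using v_Fin[of "inverse x"] by auto
  have "v (inverse x) + v x = 0" using v_mult[of "inverse x" x] x0 by simp
  then have "h + g = 0" using h x by (simp add: zero_extended_def)
  then show ?thesis
    using h sf_inverse[OF F x(1)] by (auto simp: value_group_def eq_neg_iff_add_eq_0[symmetric])
qed

lemma ramification_index_1:
  assumes "value_group v L = value_group v K"
  shows "ramification_index v K L = 1"
proof -
  let ?G = "value_group v K"
  have "(+) g ` ?G = ?G" if g: "g \<in> ?G" for g
  proof (intro equalityI subsetI)
    fix h assume "h \<in> ?G"
    then have "- g + h \<in> ?G" using value_group_add[OF K value_group_uminus[OF K g]] by blast
    then show "h \<in> (+) g ` ?G" by (intro image_eqI[of _ _ "- g + h"]) auto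
  qed (use g value_group_add[OF K] in auto)
  moreover have "1 \<in> K" by (rule sf_1[OF K])
  then have "?G \<noteq> {}" by (auto simp: value_group_def zero_extended_def intro!: exI[of _ 0] bexI[of _ 1])
  ultimately have "(\<lambda>g. (+) g ` ?G) ` ?G = {?G}" by auto
  then show ?thesis by (simp add: ramification_index_def assms)
qed

lemma N_eq_iff_v: "N x = N y \<longleftrightarrow> v x = v y"
  using N_le_iff[of x y] N_le_iff[of y x] by (auto simp: order_eq_iff)

lemma value_group_eqI:
  assumes L: "K \<subseteq> L" and "\<And>y. y \<in> L \<Longrightarrow> y \<noteq> 0 \<Longrightarrow> \<exists>c\<in>K. N c = N y"
  shows "value_group v L = value_group v K"
proof (intro equalityI subsetI)
  fix g assume "g \<in> value_group v L"
  then obtain y where y: "y \<in> L" "v y = Fin g" by (auto simp: value_group_def)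
  then have "y \<noteq> 0" by auto
  then obtain c where "c \<in> K" "v c = v y" using assms(2) y(1) by (auto simp: N_eq_iff_v)
  then show "g \<in> value_group v K" using y by (auto simp: value_group_def)
qed (use L in \<open>auto simp: value_group_def\<close>)

text \<open>The translate z = \<alpha> - x solves X^p - X = t with \<open>t\<close> in the maximal
  ideal. Hensel's lemma at 0 puts it into every henselian field containing \<open>K\<close>; so the
  henselizations agree, and K(\<alpha>) lies in \<open>C\<close>, where \<open>K\<close> is dense
  and hence gives all residues and values.\<close>

lemma defect_immediate:
  assumes \<alpha>: "\<alpha> ^ p - \<alpha> \<in> K" and x: "x \<in> K" "N (\<alpha> - x) < 1"
  shows "defect v K (adjoin K {\<alpha>}) = 1"
proof -
  let ?L = "adjoin K {\<alpha>}"
  define z where "z = \<alpha> - x"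
  define t where "t = z ^ p - z"
  have "t = (\<alpha> ^ p - \<alpha>) - (x ^ p - x)" by (simp add: t_def z_def frob_diff algebra_simps)
  then have tK: "t \<in> K" using sf_diff[OF K \<alpha> sf_diff[OF K sf_power[OF K x(1)] x(1)]] by simp
  have Nz: "N z < 1" using x by (simp add: z_def)
  then have "N (z ^ p) < 1" using p_pos by (simp add: N_power power_less_one_iff)
  then have Nt: "N t < 1" using Nz N_diff[of "z ^ p" z] by (simp add: t_def)
  have in_henselian: "\<alpha> \<in> E" if E: "subfield E Kbar" "K \<subseteq> E" "henselian v E" for E
  proof -
    let ?f = "monom 1 p - [:t, 1:]"
    have "gauss_le 1 ?f 1"
    proof (rule gauss_le_diff)
      show "gauss_le 1 (monom 1 p) 1" by (auto simp: gauss_le_def)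
      show "gauss_le 1 [:t, 1:] 1" using Nt by (auto simp: gauss_le_def coeff_pCons split: nat.splits)
    qed simp
    moreover have "poly_over E ?f" using E tK by (intro poly_over_AS) auto
    moreover have "N (poly ?f 0) < 1" using Nt p_pos by (simp add: poly_AS[of t 0, simplified] power_0_left poly_monom)
    moreover have "N (poly (pderiv ?f) 0) = 1" by (simp add: pderiv_AS)
    ultimately obtain y where y: "y \<in> E" "poly ?f y = 0" "N (y - 0) < 1"
      using henselianD[OF E(3) monic_AS(2), of t 0] sf_0[OF E(1)] by auto
    have "y ^ p - y = z ^ p - z" using y(2)[unfolded poly_AS] by (simp add: t_def)
    \<comment> \<open>The solutions differ by elements of the prime field, whose nonzero elements
      have norm 1, so two solutions of norm less than 1 coincide.\<close>
    then have "y - z \<in> Fp" by (simp only: AS_roots)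
    moreover have "N (y - z) < 1" using N_diff[of y z] y(3) Nz by simp
    ultimately obtain n where n: "y - z = of_nat n" "N (of_nat n) < 1" by (auto simp: prime_subfield_def)
    then have "of_nat n = (0 :: 'a)" using N_of_nat_eq_1[of n] p by auto
    then have "y - z = 0" using n(1) by simp
    then have "\<alpha> = y + x" by (simp add: z_def)
    then show ?thesis using sf_add[OF E(1) y(1)] x(1) E(2) by auto
  qed
  have LE: "?L \<subseteq> E" if "subfield E Kbar" "K \<subseteq> E" "henselian v E" for E
    using in_henselian[OF that] that by (intro adjoin_subset) auto
  have KL: "K \<subseteq> ?L" by (rule adjoin_incl)
  have "{E. subfield E Kbar \<and> ?L \<subseteq> E \<and> henselian v E} = {E. subfield E Kbar \<and> K \<subseteq> E \<and> henselian v E}"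
    using LE KL by blast
  then have h: "henselization v ?L = Kh" unfolding henselization_def by simp
  interpret R: Ring.field "Kbar :: 'a ring" by (rule field_Kbar)
  have dim1: "ring.dim Kbar Kh (henselization v ?L) = 1"
    using R.dimI[OF Kh_subfield R.dimension_one[OF Kh_subfield]] by (simp add: h over_def)
  have LC: "?L \<subseteq> C"
    using LE[OF C(1) subset_cl] algebraic_extension_henselian[OF C(1)] by blast
  have "residue_field v ?L = residue_field v K"
  proof (intro equalityI subsetI)
    fix r assume "r \<in> residue_field v ?L"
    then obtain y where y: "y \<in> ?L" "N y \<le> 1" "r = res y" by (auto simp: residue_field_eq valuation_ring_iff)
    then obtain c where c: "c \<in> K" "N (y - c) < 1" using cl_D[of y K 1] LC by auto
    then have "N c \<le> 1" using N_diff[of y "y - c"] y(2) by simp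
    then show "r \<in> residue_field v K"
      using c y(3) res_eq_iff[of y c] by (auto simp: residue_field_eq valuation_ring_iff)
  qed (use KL in \<open>auto simp: residue_field_eq valuation_ring_iff\<close>)
  moreover interpret RF: Ring.field RF by (rule field_RF)
  have "ring.dim RF (residue_field v K) (residue_field v K) = 1"
    using RF.dimI[OF subfield_residue_field[OF K] RF.dimension_one[OF subfield_residue_field[OF K]]]
    by (simp add: over_def)
  ultimately have f1: "residue_degree v K ?L = 1" by (simp add: residue_degree_def)
  have "value_group v ?L = value_group v K"
  proof (rule value_group_eqI[OF KL])
    fix y assume "y \<in> ?L" "y \<noteq> 0"
    then obtain c where "c \<in> K" "N (y - c) < N y" using cl_D[of y K "N y"] LC by auto
    then show "\<exists>c\<in>K. N c = N y" using N_close_eq[of c y] by (auto simp: N_minus_commute)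
  qed
  then have "ramification_index v K ?L = 1" by (rule ramification_index_1)
  then show ?thesis by (simp add: defect_def dim1 f1)
qed

text \<open>No element of \<open>C\<close> is congruent to \<alpha>, so the degree over the
  henselization is still p. By orthogonality of the powers of \<alpha>, their residues form a basis
  of the residue field extension and no new values appear.\<close>

lemma defect_residual:
  assumes \<alpha>: "\<alpha> \<notin> K" "\<alpha> ^ p - \<alpha> \<in> K" "N \<alpha> \<le> 1" and far: "\<And>x. x \<in> K \<Longrightarrow> 1 \<le> N (\<alpha> - x)"
  shows "defect v K (adjoin K {\<alpha>}) = 1"
proof -
  let ?L = "adjoin K {\<alpha>}"
  have gauss: "gauss_le 1 g (N (poly g \<alpha>))" if "poly_over K g" "degree g < p" for g
    by (rule gauss_norm_at_\<alpha>[OF \<alpha>(2,3)]) (use far that in auto)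
  have KL: "K \<subseteq> ?L" by (rule adjoin_incl)
  obtain f where f: "min_poly K \<alpha> f" using K_min_poly by blast
  have df: "degree f = p" by (rule AS_degree[OF K \<alpha>(1,2) f])
  have L: "?L = {poly g \<alpha> | g. poly_over K g \<and> degree g < p}"
    using adjoin_eq_degree[OF K f] df by simp
  interpret R: Ring.field "Kbar :: 'a ring" by (rule field_Kbar)
  interpret RF: Ring.field RF by (rule field_RF)
  have "\<alpha> \<notin> C"
  proof
    assume "\<alpha> \<in> C"
    then obtain x where "x \<in> K" "N (\<alpha> - x) < 1" using cl_D[of \<alpha> K 1] by auto
    then show False using far[of x] by simp
  qed
  then have \<alpha>h: "\<alpha> \<notin> Kh" using Kh_subset_C by blast
  have "poly_over Kh f" by (rule poly_over_mono[OF min_polyD(1)[OF f] Kh_incl])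
  then obtain h where h: "min_poly Kh \<alpha> h"
    using min_poly_exists[OF Kh_subfield _ min_polyD(4,3)[OF f]] by blast
  have "degree h = p" using AS_degree[OF Kh_subfield \<alpha>h _ h] \<alpha>(2) Kh_incl by blast
  then have dim: "ring.dim Kbar Kh (henselization v ?L) = p"
    using deg_over_eq[OF Kh_subfield h] by (simp add: henselization_adjoin deg_over_def)
  have "value_group v ?L = value_group v K"
  proof (rule value_group_eqI[OF KL])
    fix y assume "y \<in> ?L" "y \<noteq> 0"
    then obtain g where g: "poly_over K g" "degree g < p" "y = poly g \<alpha>" unfolding L by blast
    \<comment> \<open>The largest coefficient norm is attained at an element of \<open>K\<close> and
      equals N y: one inequality holds for every integral argument, the other is
      orthogonality.\<close>
    define M where "M = Max ((\<lambda>j. N (coeff g j)) ` {..degree g})"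
    have "M \<in> (\<lambda>j. N (coeff g j)) ` {..degree g}" unfolding M_def by (intro Max_in) auto
    then obtain j where j: "M = N (coeff g j)" by blast
    have "N (coeff g i) \<le> M" for i
    proof (cases "i \<le> degree g")
      case True
      then show ?thesis unfolding M_def by (intro Max_ge) auto
    qed (simp add: coeff_eq_0 j)
    then have "gauss_le 1 g M" by (auto simp: gauss_le_def)
    then have "N y \<le> M" unfolding g(3) by (rule gauss_le_eval) (rule \<alpha>(3))
    moreover have "M \<le> N y" using gauss[OF g(1,2)] by (auto simp: gauss_le_def j g(3))
    ultimately show "\<exists>c\<in>K. N c = N y" using j poly_over_coeff[OF g(1)] by auto
  qed
  then have e1: "ramification_index v K ?L = 1" by (rule ramification_index_1)
  \<comment> \<open>The powers of \<alpha> with the highest first, which matches coefficient lists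
    that start with the leading coefficient.\<close>
  define us where "us = R.exp_base \<alpha> p"
  have us: "\<And>u. u \<in> set us \<Longrightarrow> N u \<le> 1" "length us = p"
    using \<alpha>(3) by (auto simp: us_def R.exp_base_def N_power power_le_one)
  have len: "length (map res us) = p" using us by simp
  have carrier: "set (map res us) \<subseteq> carrier RF" using us(1) by (auto simp: carrier_RF)
  have k: "subfield (residue_field v K) RF" by (rule subfield_residue_field[OF K])
  have comb: "RF.combine (map res cs) (map res us) = res (poly (Poly (rev cs)) \<alpha>)"
    if "length cs = p" "\<And>c. c \<in> set cs \<Longrightarrow> N c \<le> 1" for cs
  proof -
    have "R.combine cs us = R.eval cs \<alpha>"
      using R.combine_eq_eval[of cs \<alpha>] that(1) by (simp add: us_def)
    then show ?thesis using combine_res[of cs us] that(2) us(1) by (simp add: eval_Kbar)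
  qed
  have list: "\<exists>cs. Ks = map res cs \<and> set cs \<subseteq> K \<and> (\<forall>c\<in>set cs. N c \<le> 1)"
    if "set Ks \<subseteq> residue_field v K" for Ks
  proof -
    have "Ks \<in> lists (res ` valuation_ring v K)" using that by (auto simp: residue_field_eq in_lists_conv_set)
    then obtain cs where "cs \<in> lists (valuation_ring v K)" "Ks = map res cs" unfolding lists_image by blast
    then show ?thesis by (intro exI[of _ cs]) (auto simp: in_lists_conv_set valuation_ring_iff)
  qed
  have degP: "degree (Poly (rev cs)) < p" if "length cs = p" for cs :: "'a list"
  proof -
    have "degree (Poly (rev cs)) \<le> p - 1"
      by (rule degree_le) (use that in \<open>auto simp: coeff_Poly_eq nth_default_def\<close>)
    then show ?thesis using p_pos by simp
  qed
  have ind: "RF.independent (residue_field v K) (map res us)"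
  proof (rule ccontr)
    assume "\<not> ?thesis"
    then obtain Ks where Ks: "length Ks = length (map res us)" "RF.combine Ks (map res us) = \<zero>\<^bsub>RF\<^esub>"
      "set Ks \<subseteq> residue_field v K" "set Ks \<noteq> {\<zero>\<^bsub>RF\<^esub>}"
      by (rule RF.dependent_imp_non_trivial_combine[OF k carrier])
    obtain cs where cs: "Ks = map res cs" "set cs \<subseteq> K" "\<forall>c\<in>set cs. N c \<le> 1" using list[OF Ks(3)] by blast
    have lcs: "length cs = p" using Ks(1) len cs by simp
    let ?g = "Poly (rev cs)"
    have "N (poly ?g \<alpha>) < 1" using comb[OF lcs] Ks(2) cs by (simp add: res_0 res_eq_iff)
    then have small: "N (coeff ?g i) < 1" for i
      using gauss[OF poly_over_list[OF K cs(2)] degP[OF lcs]] unfolding gauss_le_def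
      by (metis le_less_trans mult.right_neutral power_one)
    have "res c = \<zero>\<^bsub>RF\<^esub>" if "c \<in> set cs" for c
    proof -
      obtain i where "i < length (rev cs)" "rev cs ! i = c" using \<open>c \<in> set cs\<close> by (metis in_set_conv_nth set_rev)
      then have "coeff ?g i = c" by (simp add: coeff_Poly_eq nth_default_def)
      then show ?thesis using small[of i] by (simp add: res_0 res_eq_iff)
    qed
    then have "set Ks \<subseteq> {\<zero>\<^bsub>RF\<^esub>}" using cs(1) by auto
    moreover have "Ks \<noteq> []" using Ks(1) len p_pos by auto
    ultimately show False using Ks(4) by (metis set_empty subset_singletonD)
  qed
  have span: "RF.Span (residue_field v K) (map res us) = residue_field v ?L"
    unfolding RF.Span_eq_combine_set_length_version[OF k carrier] len
  proof (intro equalityI subsetI)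
    fix r assume "r \<in> {RF.combine Ks (map res us) | Ks. length Ks = p \<and> set Ks \<subseteq> residue_field v K}"
    then obtain Ks where Ks: "r = RF.combine Ks (map res us)" "length Ks = p" "set Ks \<subseteq> residue_field v K" by blast
    obtain cs where cs: "Ks = map res cs" "set cs \<subseteq> K" "\<forall>c\<in>set cs. N c \<le> 1" using list[OF Ks(3)] by blast
    have lcs: "length cs = p" using Ks(2) cs by simp
    let ?g = "Poly (rev cs)"
    have r: "r = res (poly ?g \<alpha>)" using comb[OF lcs] Ks(1) cs by simp
    have "gauss_le 1 ?g 1" using cs(3) lcs by (auto simp: gauss_le_def coeff_Poly_eq nth_default_def rev_nth)
    then have "N (poly ?g \<alpha>) \<le> 1" by (rule gauss_le_eval) (rule \<alpha>(3))
    moreover have "poly ?g \<alpha> \<in> ?L" unfolding L using poly_over_list[OF K cs(2)] degP[OF lcs] by blast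
    ultimately show "r \<in> residue_field v ?L" unfolding r by (auto simp: residue_field_eq valuation_ring_iff)
  next
    fix r assume "r \<in> residue_field v ?L"
    then obtain y where y: "y \<in> ?L" "N y \<le> 1" "r = res y" by (auto simp: residue_field_eq valuation_ring_iff)
    then obtain g where g: "poly_over K g" "degree g < p" "y = poly g \<alpha>" unfolding L by blast
    define cs where "cs = rev (map (coeff g) [0..<p])"
    have lcs: "length cs = p" by (simp add: cs_def)
    have "Poly (rev cs) = g"
      by (rule poly_eqI) (use g(2) in \<open>auto simp: cs_def coeff_Poly_eq nth_default_def coeff_eq_0\<close>)
    moreover have N1: "N c \<le> 1" if "c \<in> set cs" for c
      using that gauss[OF g(1,2)] y(2) g(3) by (auto simp: cs_def gauss_le_def intro: order_trans)
    ultimately have "r = RF.combine (map res cs) (map res us)" using comb[OF lcs] y(3) g(3) by simp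
    moreover have "set (map res cs) \<subseteq> residue_field v K"
      using N1 poly_over_coeff[OF g(1)] by (auto simp: residue_field_eq valuation_ring_iff cs_def)
    ultimately show "r \<in> {RF.combine Ks (map res us) | Ks. length Ks = p \<and> set Ks \<subseteq> residue_field v K}"
      using lcs by (intro CollectI exI[of _ "map res cs"]) simp
  qed
  have "RF.dimension p (residue_field v K) (residue_field v ?L)"
    using RF.dimensionI[OF k ind span] len by simp
  then have "residue_degree v K ?L = p"
    using RF.dimI[OF k] by (simp add: residue_degree_def over_def)
  then show ?thesis using p_pos by (simp add: defect_def dim e1)
qed

text \<open>Translating by \<open>c\<close> changes neither the field nor the Artin-Schreier
  property, so \<alpha> may be assumed integral. It is then either congruent to an element of
  \<open>K\<close> or not, and the defect is 1 in both cases.\<close>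

lemma defect_AS_far:
  assumes "defect_artin_schreier_element p v K \<alpha>" and c: "c \<in> K"
  shows "1 < N (\<alpha> - c)"
proof (rule ccontr)
  assume le: "\<not> 1 < N (\<alpha> - c)"
  have \<alpha>: "\<alpha> \<notin> K" "\<alpha> ^ p - \<alpha> \<in> K" "defect v K (adjoin K {\<alpha>}) \<noteq> 1"
    using assms(1) by (auto simp: defect_artin_schreier_element_def artin_schreier_element_def)
  define \<beta> where "\<beta> = \<alpha> - c"
  have "\<beta> \<notin> K" using \<alpha>(1) sf_add[OF K _ c] by (force simp: \<beta>_def)
  moreover have "\<beta> ^ p - \<beta> = (\<alpha> ^ p - \<alpha>) - (c ^ p - c)" by (simp add: \<beta>_def frob_diff algebra_simps)
  then have "\<beta> ^ p - \<beta> \<in> K" using sf_diff[OF K \<alpha>(2) sf_diff[OF K sf_power[OF K c] c]] by simp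
  moreover have "N \<beta> \<le> 1" using le by (simp add: \<beta>_def)
  ultimately have "defect v K (adjoin K {\<beta>}) = 1"
    using defect_immediate[of \<beta>] defect_residual[of \<beta>] by (meson not_le)
  moreover have "adjoin K {\<beta>} = adjoin K {\<alpha>}"
  proof
    have "\<alpha> \<in> adjoin K {\<alpha>}" "c \<in> adjoin K {\<alpha>}" "\<beta> \<in> adjoin K {\<beta>}" "c \<in> adjoin K {\<beta>}"
      using adjoin_incl c by blast+
    then have "\<beta> \<in> adjoin K {\<alpha>}" "\<alpha> \<in> adjoin K {\<beta>}"
      using sf_diff[OF adjoin_subfield, of \<alpha> K "{\<alpha>}" c] sf_add[OF adjoin_subfield, of \<beta> K "{\<beta>}" c]
      by (simp_all add: \<beta>_def)
    then show "adjoin K {\<beta>} \<subseteq> adjoin K {\<alpha>}" "adjoin K {\<alpha>} \<subseteq> adjoin K {\<beta>}"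
      using adjoin_incl(1)[of K] by (intro adjoin_subset[OF adjoin_subfield]; simp)+
  qed
  ultimately show False using \<alpha>(3) by simp
qed

end

section \<open>The depth of \<open>\<theta>\<close>\<close>

lemma alg_closed_Kbar:
  assumes "algebraic_closure (Kbar :: 'a::field ring) K"
  shows "alg_closed TYPE('a)"
proof
  interpret ac: algebraic_closure "Kbar :: 'a ring" K by (rule assms)
  fix f :: "'a poly" assume deg: "degree f > 0"
  define P where "P = rev (coeffs f)"
  have P: "P \<in> carrier (poly_ring (Kbar :: 'a ring))"
    unfolding P_def using ac.carrier_is_subfield by (intro Poly_univ_poly) (auto simp: poly_over_def)
  have "length P - 1 = degree f" by (simp add: P_def degree_eq_length_coeffs)
  moreover have "ac.splitted P" using ac.roots_over_carrier P by blast
  ultimately have "ac.roots P \<noteq> {#}" using deg unfolding ac.splitted_def by auto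
  then obtain x where "x \<in># ac.roots P" by blast
  then have "ac.is_root P x" using ac.roots_mem_iff_is_root[OF P] by auto
  then have "poly f x = 0" by (simp add: ac.is_root_def eval_Kbar P_def)
  then show "\<exists>x. poly f x = 0" ..
qed

context rank_one_char
begin

lemma deg_over_mdeg: "deg_over K x = mdeg K x"
  using K_min_poly[of x] deg_over_eq[OF K] mdeg_eq[OF K] by metis

lemma D_set_less_iff:
  "(\<exists>\<epsilon>\<in>D_set v K m \<theta>. \<forall>\<eta>\<in>D_set v K d \<theta>. \<eta> < \<epsilon>) \<longleftrightarrow>
   (\<exists>x. mdeg K x = m \<and> (\<forall>y. mdeg K y = d \<longrightarrow> N (\<theta> - x) < N (\<theta> - y)))"
  by (auto simp: D_set_def deg_over_mdeg N_less_iff)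

lemma next_degree_eqI:
  assumes "d < m" "mdeg K x = m" "\<And>y. mdeg K y = d \<Longrightarrow> N (\<theta> - x) < N (\<theta> - y)"
    and "\<And>z. d < mdeg K z \<Longrightarrow> mdeg K z < m \<Longrightarrow> \<exists>y. mdeg K y = d \<and> N (\<theta> - y) \<le> N (\<theta> - z)"
  shows "next_degree v K \<theta> d = m"
  unfolding next_degree_def D_set_less_iff
proof (rule Least_equality)
  show "d < m \<and> (\<exists>x. mdeg K x = m \<and> (\<forall>y. mdeg K y = d \<longrightarrow> N (\<theta> - x) < N (\<theta> - y)))"
    using assms(1-3) by blast
  fix n assume n: "d < n \<and> (\<exists>x. mdeg K x = n \<and> (\<forall>y. mdeg K y = d \<longrightarrow> N (\<theta> - x) < N (\<theta> - y)))"
  then obtain z where z: "d < mdeg K z" "mdeg K z = n" "\<And>y. mdeg K y = d \<Longrightarrow> N (\<theta> - z) < N (\<theta> - y)"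
    by blast
  show "m \<le> n"
  proof (rule ccontr)
    assume "\<not> m \<le> n"
    then obtain y where "mdeg K y = d" "N (\<theta> - y) \<le> N (\<theta> - z)" using assms(4)[of z] z by auto
    then show False using z(3)[of y] by simp
  qed
qed

lemma depth_eq_2:
  assumes ab: "a \<in> K" "b \<in> K"
    and \<alpha>: "\<alpha> ^ p - \<alpha> \<in> K" and \<beta>: "\<beta> ^ p - \<beta> \<in> K"
    and N_ind: "\<And>c d. c \<in> Fp \<Longrightarrow> d \<in> Fp \<Longrightarrow> (c, d) \<noteq> (0, 0) \<Longrightarrow> N (a * c + b * d) = 1"
    and far: "\<And>c. c \<in> K \<Longrightarrow> 1 < N (\<alpha> - c)" "\<And>c. c \<in> K \<Longrightarrow> 1 < N (\<beta> - c)"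
    and cut: "\<exists>c\<in>K. \<forall>c'\<in>K. N (a * \<alpha> - c) < N (b * \<beta> - c')"
    and \<theta>: "\<theta> = a * \<alpha> + b * \<beta>"
  shows "depth v K \<theta> = 2"
proof -
  note hyps = ab \<alpha> \<beta> N_ind far cut \<theta>
  have md: "mdeg K \<theta> = p ^ 2" by (rule mdeg_\<theta>) (fact hyps)+
  have pp: "p < p ^ 2" using p_gt_1 by (simp add: power2_eq_square)
  obtain x where x: "mdeg K x = p" "\<And>c. c \<in> K \<Longrightarrow> N (\<theta> - x) < N (\<theta> - c)"
  proof -
    have "\<exists>y. mdeg K y = p \<and> (\<forall>c\<in>K. N (\<theta> - y) < N (\<theta> - c))"
      by (rule good_approximation) (fact hyps)+
    then show ?thesis using that by blast
  qed
  have 1: "next_degree v K \<theta> 1 = p"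
  proof (rule next_degree_eqI[OF p_gt_1 x(1)])
    show "N (\<theta> - x) < N (\<theta> - y)" if "mdeg K y = 1" for y using x(2) that mdeg_1_iff by blast
    fix z assume z: "mdeg K z < p"
    have "\<exists>c\<in>K. N (\<theta> - c) \<le> N (\<theta> - z)"
      by (rule no_approximation_below_p[OF _ _ _ _ _ _ _ _ _ z]) (fact hyps)+
    then show "\<exists>y. mdeg K y = 1 \<and> N (\<theta> - y) \<le> N (\<theta> - z)" using mdeg_1_iff by blast
  qed
  have 2: "next_degree v K \<theta> p = p ^ 2"
  proof (rule next_degree_eqI[OF pp md])
    \<comment> \<open>The witness of degree p^2 is \<theta> itself, at distance 0, that is with
      value \<infinity>; elements of degree p differ from it.\<close>
    fix y assume "mdeg K y = p"
    then have "y \<noteq> \<theta>" using md pp by auto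
    then show "N (\<theta> - \<theta>) < N (\<theta> - y)" by simp
  next
    fix z assume z: "mdeg K z < p ^ 2"
    show "\<exists>y. mdeg K y = p \<and> N (\<theta> - y) \<le> N (\<theta> - z)"
      by (rule no_approximation_below_p2[OF _ _ _ _ _ _ _ _ _ z]) (fact hyps)+
  qed
  show ?thesis
    unfolding depth_def deg_over_mdeg md
  proof (rule Least_equality)
    show "(next_degree v K \<theta> ^^ 2) 1 = p ^ 2" by (simp add: numeral_2_eq_2 1[unfolded One_nat_def] 2)
    fix s assume s: "(next_degree v K \<theta> ^^ s) 1 = p ^ 2"
    show "2 \<le> s"
    proof (rule ccontr)
      assume "\<not> 2 \<le> s"
      then have "s = 0 \<or> s = 1" by auto
      then show False using s 1 pp p_gt_1 by auto
    qed
  qed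
qed

end

theorem lemma5p2:
  fixes K :: "'a::field set"
    and v :: "'a \<Rightarrow> 'g::linordered_ab_group_add extended"
    and p :: nat
    and \<alpha> \<beta> a b \<theta> :: 'a
  assumes "algebraic_closure (Kbar :: 'a ring) K"
    and "valuation v"
    and "rank_one v K"
    and "CHAR('a) = p" and "0 < p"
    and "defect_artin_schreier_element p v K \<alpha>"
    and "defect_artin_schreier_element p v K \<beta>"
    and "linearly_disjoint K (adjoin K {\<alpha>}) (adjoin K {\<beta>})"
    and "a \<in> K" and "b \<in> K"
    and "\<forall>c\<in>prime_subfield. \<forall>d\<in>prime_subfield. (c, d) \<noteq> (0, 0) \<longrightarrow> v (a * c + b * d) = 0"
    and "cut_less (d1_cut v K (b * \<beta>)) (d1_cut v K (a * \<alpha>))"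
    and "\<theta> = a * \<alpha> + b * \<beta>"
  shows "adjoin K {\<theta>} = adjoin K {\<alpha>, \<beta>} \<and>
         card (S_set v K \<theta>) = 1 \<and> card (S_set v K \<theta>) < depth v K \<theta> \<and> depth v K \<theta> = 2"
proof -
  interpret ac: algebraic_closure "Kbar :: 'a ring" K by (rule assms(1))
  have K: "subfield K Kbar" by (rule ac.subfield_axioms)
  have "prime p" using prime_CHAR_semidom[where 'a = 'a] assms(4,5) by simp
  interpret rank_one_char v K "TYPE('a)" p
  proof (intro rank_one_char.intro rank_one_valued_field.intro valued_field.intro
      rank_one_valued_field_axioms.intro alg_closed_char.intro alg_closed_char_axioms.intro)
    show "valuation v" "rank_one v K" "subfield K Kbar" "prime p" "CHAR('a) = p" "alg_closed TYPE('a)"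
      using assms K \<open>prime p\<close> alg_closed_Kbar by auto
    show "\<exists>g. poly_over K g \<and> g \<noteq> 0 \<and> poly g x = 0" for x
      using ac.algebraic_extension[of x] by (intro algebraic_Kbar_imp[OF K]) simp
  qed
  have \<alpha>: "\<alpha> ^ p - \<alpha> \<in> K" and \<beta>: "\<beta> ^ p - \<beta> \<in> K"
    using assms(6,7) by (auto simp: defect_artin_schreier_element_def artin_schreier_element_def)
  have N_ind: "N (a * c + b * d) = 1" if "c \<in> Fp" "d \<in> Fp" "(c, d) \<noteq> (0, 0)" for c d
    using assms(11) that by (auto simp: N_eq_1_iff)
  have far: "1 < N (\<alpha> - c)" "1 < N (\<beta> - c)" if "c \<in> K" for c
    using defect_AS_far assms(6,7) that by auto
  have cut: "\<exists>c\<in>K. \<forall>c'\<in>K. N (a * \<alpha> - c) < N (b * \<beta> - c')"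
  proof -
    \<comment> \<open>Properness of the inclusion supplies a \<gamma> that is reached by a\<alpha>
      but by no translate of b\<beta> under \<open>K\<close>.\<close>
    obtain \<gamma> c where c: "c \<in> K" "Fin \<gamma> \<le> v (a * \<alpha> - c)" "\<And>c'. c' \<in> K \<Longrightarrow> \<not> Fin \<gamma> \<le> v (b * \<beta> - c')"
      using assms(12) unfolding cut_less_def d1_cut_def Let_def fst_conv psubset_eq by blast
    have "N (a * \<alpha> - c) < N (b * \<beta> - c')" if "c' \<in> K" for c'
      unfolding N_less_iff using c(2) c(3)[OF that] by (auto simp: not_le)
    then show ?thesis using c(1) by blast
  qed
  note hyps = assms(9,10) \<alpha> \<beta> N_ind far cut assms(13)
  have depth: "depth v K \<theta> = 2" by (rule depth_eq_2) (fact hyps)+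
  have ind: "a * c + b * d \<noteq> 0" if "c \<in> Fp" "d \<in> Fp" "(c, d) \<noteq> (0, 0)" for c d
    using N_ind[OF that] by auto
  obtain f where f: "min_poly K \<theta> f" using K_min_poly by blast
  have ff: "f = (\<Prod>t\<in>#mset_set (fp_lattice a b \<theta>). [:-t, 1:])"
    by (rule min_poly_\<theta>(2)[OF _ _ _ _ _ _ _ _ _ f]) (fact hyps)+
  have conj: "conjugate K \<theta> \<theta>' \<longleftrightarrow> \<theta>' \<in> fp_lattice a b \<theta>" for \<theta>'
    unfolding conjugate_iff[OF K f] ff poly_prod_mset_linear_eq_0_iff
    using card_fp_lattice(1)[OF ind] by simp
  \<comment> \<open>A conjugate different from \<theta> is needed so that \<open>S_set\<close> is
    not empty; \<theta> + a is one, since v a = 0 gives a \<noteq> 0.\<close>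
  have "\<theta> + (a * 1 + b * 0) \<in> fp_lattice a b \<theta>"
    unfolding fp_lattice_def
    by (rule image_eqI[of _ _ "(1, 0)"]) (auto intro: sf_0 sf_1 subfield_Fp)
  moreover have a: "v a = 0"
    using N_ind[of 1 0] sf_0[OF subfield_Fp] sf_1[OF subfield_Fp] by (simp add: N_eq_1_iff)
  then have "a \<noteq> 0" by (auto simp: zero_extended_def)
  ultimately have "0 \<in> S_set v K \<theta>"
    unfolding S_set_def conj using a by (intro CollectI exI[of _ "\<theta> + a"]) auto
  moreover have "s = 0" if s: "s \<in> S_set v K \<theta>" for s
  proof -
    obtain \<theta>' where \<theta>': "s = v (\<theta>' - \<theta>)" "\<theta>' \<in> fp_lattice a b \<theta>" "\<theta>' \<noteq> \<theta>"
      using s unfolding S_set_def conj by blast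
    then obtain c d where cd: "c \<in> Fp" "d \<in> Fp" "\<theta>' = \<theta> + (a * c + b * d)"
      by (auto simp: fp_lattice_def)
    then have "(c, d) \<noteq> (0, 0)" using \<theta>'(3) by auto
    then show ?thesis using N_ind[OF cd(1,2)] cd(3) \<theta>'(1) by (simp add: N_eq_1_iff)
  qed
  ultimately have "S_set v K \<theta> = {0}" by blast
  then have S: "card (S_set v K \<theta>) = 1" by simp
  have "\<exists>A B. poly_over K A \<and> poly_over K B \<and> poly A \<theta> = \<alpha> \<and> poly B \<theta> = \<beta>"
  proof (rule AS_pair[OF K assms(9,10) \<alpha> \<beta> _ assms(13)])
    fix c d assume "c \<in> Fp" "d \<in> Fp" "(c, d) \<noteq> (0, 0)"
    then show "a * c + b * d \<noteq> 0" by (rule ind)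
  next
    fix A B assume "poly_over K A" "poly_over K B" "poly A \<theta> = \<alpha>" "poly B \<theta> = \<beta>"
    then show "\<exists>A B. poly_over K A \<and> poly_over K B \<and> poly A \<theta> = \<alpha> \<and> poly B \<theta> = \<beta>" by blast
  qed
  then obtain A B where AB: "poly_over K A" "poly_over K B" "poly A \<theta> = \<alpha>" "poly B \<theta> = \<beta>"
    by (elim exE conjE)
  have "adjoin K {\<theta>} = adjoin K {\<alpha>, \<beta>}"
  proof
    have "\<theta> \<in> adjoin K {\<alpha>, \<beta>}"
      unfolding assms(13) using adjoin_incl[of K "{\<alpha>, \<beta>}"] adjoin_incl(2)[of "{\<alpha>, \<beta>}" K] assms(9,10)
      by (intro sf_add sf_mult adjoin_subfield) auto
    then show "adjoin K {\<theta>} \<subseteq> adjoin K {\<alpha>, \<beta>}"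
      using adjoin_incl(1)[of K "{\<alpha>, \<beta>}"] by (intro adjoin_subset[OF adjoin_subfield]) auto
    have "\<alpha> \<in> adjoin K {\<theta>}" "\<beta> \<in> adjoin K {\<theta>}"
      unfolding adjoin_eq[OF K f] using AB by blast+
    then show "adjoin K {\<alpha>, \<beta>} \<subseteq> adjoin K {\<theta>}"
      using adjoin_incl(1)[of K "{\<theta>}"] by (intro adjoin_subset[OF adjoin_subfield]) auto
  qed
  then show ?thesis using S depth by simp
qed

end
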